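(* The category $\mathscr D$, the full subcategory of the subword complex category $\mathscr C$ on the root independent objects, is a proto-abelian category.
   Context: Quadruples. For a Coxeter group $W$ of finite rank with simple reflections $s_1,\dots,s_n$, let $V$ be the real vector space with basis the simple roots $\alpha_1,\dots,\alpha_n$, with the form $\langle\alpha_i,\alpha_j\rangle=-\cos(\pi/\operatorname{ord}(s_is_j))$, the usual geometric action of $W$, and root system $\Phi=\Phi^+\sqcup\Phi^-$. Write $[m]=\{1,\dots,m\}$. For a word $Q=s_{i_1}\cdots s_{i_m}$ and $\pi\in W$, the subword complex $\mathcal{SC}_W(Q,\pi)$ is the simplicial complex whose faces are the subsets $I\subseteq[m]$ such that the subword of $Q$ at positions $[m]\setminus I$ contains a reduced expression of $\pi$. A quadruple is $X=(W_X,Q_X,\pi_X,I_X)$ with $I_X$ a maximal face of $\mathcal{SC}_{W_X}(Q_X,\pi_X)$; $n_X$ is the length of $Q_X$, and $V_X,\Phi_X$ are the vector space and root system of $W_X$. The root function is $r_X(l)=\big(\prod_{j\in[l-1]\setminus I_X}s_{i_j}\big)(\alpha_{i_l})$ for $l\in[n_X]$ (product in increasing order of $j$). For $H\subseteq[n_X]$ let $\mathrm V(H)=\operatorname{span}\{r_X(i):i\in H\}$. $X$ is irreducible if $V_X=\mathrm V(I_X)$; $\mathcal C$ is the collection of irreducible quadruples. Equivalence. $X\sim X'$ if there is a group isomorphism $\phi:W_X\to W_{X'}$ given by a bijection of the generators with $\phi(Q_X)=Q_{X'}$ up to commutations of consecutive distinct commuting letters, $\phi(\pi_X)=\pi_{X'}$,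 and $I_{X'}$ is the set of positions corresponding to $I_X$ after these commutations (swapping two identical letters is not allowed). Flats. For a subspace $V\subseteq V_X$, the flat associated with $V$ is $\mathrm F(V)=\{i\in[n_X]: r_X(i)\in V\}$. A flat $F=\{j_1<\dots<j_r\}$ induces a quadruple $X_F$ with $V_{X_F}=\mathrm V(F)$ and $n_{X_F}=|F|$: its root system is $\Phi_X\cap \mathrm V(F)$ (positive roots $\Phi_X^+\cap \mathrm V(F)$), its simple roots are given by the list $\beta_F=(\beta_1,\dots,\beta_r)$, $\beta_k=\big(\prod_{j\in([j_k-1]\setminus I_X)\setminus F}s_{i_j}\big)(\alpha_{i_{j_k}})$, the $k$-th letter of its word is the reflection in $\beta_k$, its maximal face is the image of $F\cap I_X$ under the order-preserving bijection $b_F:F\to[|F|]$, its group element is the product of the letters outside this face, and $r_X(i)=r_{X_F}(b_F(i))$ for $i\in F$. $F$ is irreducible if $X_F\in\mathcal C$, i.e. $\mathrm V(F)=\mathrm V(F\cap I_X)$. The empty flat is irreducible. Category $\mathscr C$. Objects: $\mathcal C$. $\operatorname{Mor}(X,Y)$ is the set of pairs $(F_1,F_2)$ with $F_1$ an irreducible flat of $X$, $F_2$ an irreducible flat of $Y$ and $X_{F_1}\sim Y_{F_2}$. The equivalence gives a bijection of positions $F_1\to F_2$ and an induced linear isomorphism $l_{F_1,F_2}:\mathrm V(F_1)\to\mathrm V(F_2)$ (regarded as attached to the pair); composition is $(F_3,F_4)\circ(F_1,F_2)=(\mathrm F(l_{F_2,F_1}(\mathrm V(F_2\cap F_3\cap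 I_Y))),\mathrm F(l_{F_3,F_4}(\mathrm V(F_2\cap F_3\cap I_Y))))$. An object $X\in\mathcal C$ is root independent if $|I_X|$ equals the rank of $W_X$, equivalently $\{r_X(i)\}_{i\in I_X}$ is a basis of $V_X$. Proto-abelian. Let $\hookrightarrow$ denote monomorphisms and $\twoheadrightarrow$ epimorphisms. A category $\mathcal E$ is proto-abelian if: (1) $\mathcal E$ is pointed (has a zero object); (2) every diagram $C\twoheadleftarrow A\hookrightarrow B$ can be completed to a pushout square with $C\hookrightarrow D$ and $B\twoheadrightarrow D$; (3) every diagram $C\hookrightarrow D\twoheadleftarrow B$ can be completed to a pullback square with $A\hookrightarrow B$ and $A\twoheadrightarrow C$; (4) a commutative square with $A\hookrightarrow B$, $A\twoheadrightarrow C$, $C\hookrightarrow D$, $B\twoheadrightarrow D$ is a pushout square if and only if it is a pullback square.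
   Formalization: Objects are required to have V_{X_F}=V(F) for every irreducible flat F (β_F linearly independent, with form -cos(π/ord)); this can fail for infinite W, e.g. affine A3, and then X_F is undefined. A morphism is a pair of flats together with its linear isomorphism. *)

theory Defs
  imports
    "HOL-Algebra.Generated_Groups"
    "HOL-Algebra.Multiplicative_Group"
    "HOL-Analysis.Finite_Function_Topology"
    "HOL-Combinatorics.Transposition"
begin

section \<open>Proto-abelian categories\<close>

text \<open>
  \<open>Hom C X Y\<close> are the arrows from \<open>X\<close> to \<open>Y\<close>; \<open>Cmp C X Y Z g f\<close> is the composite
  \<open>g \<circ> f\<close> of \<open>f : X \<rightarrow> Y\<close> and \<open>g : Y \<rightarrow> Z\<close>. Hom-sets of different pairs of objects may overlap,
  so the objects are arguments of the composition.
\<close>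

record ('o, 'm) cat =
  Obj :: "'o set"
  Hom :: "'o \<Rightarrow> 'o \<Rightarrow> 'm set"
  Idn :: "'o \<Rightarrow> 'm"
  Cmp :: "'o \<Rightarrow> 'o \<Rightarrow> 'o \<Rightarrow> 'm \<Rightarrow> 'm \<Rightarrow> 'm"

definition category :: "('o, 'm) cat \<Rightarrow> bool" where
  "category C \<longleftrightarrow>
     (\<forall>X\<in>Obj C. Idn C X \<in> Hom C X X) \<and>
     (\<forall>X\<in>Obj C. \<forall>Y\<in>Obj C. \<forall>Z\<in>Obj C. \<forall>f\<in>Hom C X Y. \<forall>g\<in>Hom C Y Z.
        Cmp C X Y Z g f \<in> Hom C X Z) \<and>
     (\<forall>X\<in>Obj C. \<forall>Y\<in>Obj C. \<forall>f\<in>Hom C X Y.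
        Cmp C X X Y f (Idn C X) = f \<and> Cmp C X Y Y (Idn C Y) f = f) \<and>
     (\<forall>X\<in>Obj C. \<forall>Y\<in>Obj C. \<forall>Z\<in>Obj C. \<forall>T\<in>Obj C.
        \<forall>f\<in>Hom C X Y. \<forall>g\<in>Hom C Y Z. \<forall>h\<in>Hom C Z T.
        Cmp C X Z T h (Cmp C X Y Z g f) = Cmp C X Y T (Cmp C Y Z T h g) f)"

definition full_subcategory :: "('o, 'm) cat \<Rightarrow> ('o \<Rightarrow> bool) \<Rightarrow> ('o, 'm) cat" where
  "full_subcategory C P = C\<lparr>Obj := {X \<in> Obj C. P X}\<rparr>"

definition mono_arrow :: "('o, 'm) cat \<Rightarrow> 'o \<Rightarrow> 'o \<Rightarrow> 'm \<Rightarrow> bool" where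
  "mono_arrow C X Y f \<longleftrightarrow> f \<in> Hom C X Y \<and>
     (\<forall>T\<in>Obj C. \<forall>g\<in>Hom C T X. \<forall>h\<in>Hom C T X.
        Cmp C T X Y f g = Cmp C T X Y f h \<longrightarrow> g = h)"

definition epi_arrow :: "('o, 'm) cat \<Rightarrow> 'o \<Rightarrow> 'o \<Rightarrow> 'm \<Rightarrow> bool" where
  "epi_arrow C X Y f \<longleftrightarrow> f \<in> Hom C X Y \<and>
     (\<forall>T\<in>Obj C. \<forall>g\<in>Hom C Y T. \<forall>h\<in>Hom C Y T.
        Cmp C X Y T g f = Cmp C X Y T h f \<longrightarrow> g = h)"

definition zero_object :: "('o, 'm) cat \<Rightarrow> 'o \<Rightarrow> bool" where
  "zero_object C Z \<longleftrightarrow> Z \<in> Obj C \<and>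
     (\<forall>X\<in>Obj C. (\<exists>!f. f \<in> Hom C X Z) \<and> (\<exists>!f. f \<in> Hom C Z X))"

text \<open>
  In the next three definitions the square is \<open>i : A \<rightarrow> B\<close>, \<open>p : A \<rightarrow> C\<close>, \<open>j : C \<rightarrow> D\<close>,
  \<open>q : B \<rightarrow> D\<close>, in a category \<open>K\<close>.
\<close>

definition commutative_square ::
  "('o, 'm) cat \<Rightarrow> 'o \<Rightarrow> 'o \<Rightarrow> 'o \<Rightarrow> 'o \<Rightarrow> 'm \<Rightarrow> 'm \<Rightarrow> 'm \<Rightarrow> 'm \<Rightarrow> bool" where
  "commutative_square K A B C D i p j q \<longleftrightarrow>
     A \<in> Obj K \<and> B \<in> Obj K \<and> C \<in> Obj K \<and> D \<in> Obj K \<and>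
     i \<in> Hom K A B \<and> p \<in> Hom K A C \<and> j \<in> Hom K C D \<and> q \<in> Hom K B D \<and>
     Cmp K A B D q i = Cmp K A C D j p"

definition pushout_square ::
  "('o, 'm) cat \<Rightarrow> 'o \<Rightarrow> 'o \<Rightarrow> 'o \<Rightarrow> 'o \<Rightarrow> 'm \<Rightarrow> 'm \<Rightarrow> 'm \<Rightarrow> 'm \<Rightarrow> bool" where
  "pushout_square K A B C D i p j q \<longleftrightarrow>
     commutative_square K A B C D i p j q \<and>
     (\<forall>T f g. commutative_square K A B C T i p g f \<longrightarrow>
        (\<exists>!u. u \<in> Hom K D T \<and> Cmp K B D T u q = f \<and> Cmp K C D T u j = g))"

definition pullback_square ::
  "('o, 'm) cat \<Rightarrow> 'o \<Rightarrow> 'o \<Rightarrow> 'o \<Rightarrow> 'o \<Rightarrow> 'm \<Rightarrow> 'm \<Rightarrow> 'm \<Rightarrow> 'm \<Rightarrow> bool" where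
  "pullback_square K A B C D i p j q \<longleftrightarrow>
     commutative_square K A B C D i p j q \<and>
     (\<forall>T f g. commutative_square K T B C D f g j q \<longrightarrow>
        (\<exists>!u. u \<in> Hom K T A \<and> Cmp K T A B i u = f \<and> Cmp K T A C p u = g))"

definition proto_abelian :: "('o, 'm) cat \<Rightarrow> bool" where
  "proto_abelian K \<longleftrightarrow>
     category K \<and>
     (\<exists>Z. zero_object K Z) \<and>
     (\<forall>A\<in>Obj K. \<forall>B\<in>Obj K. \<forall>C\<in>Obj K. \<forall>i p.
        mono_arrow K A B i \<and> epi_arrow K A C p \<longrightarrow>
        (\<exists>D j q. pushout_square K A B C D i p j q \<and> mono_arrow K C D j \<and> epi_arrow K B D q)) \<and>
     (\<forall>B\<in>Obj K. \<forall>C\<in>Obj K. \<forall>D\<in>Obj K. \<forall>j q.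
        mono_arrow K C D j \<and> epi_arrow K B D q \<longrightarrow>
        (\<exists>A i p. pullback_square K A B C D i p j q \<and> mono_arrow K A B i \<and> epi_arrow K A C p)) \<and>
     (\<forall>A B C D i p j q.
        commutative_square K A B C D i p j q \<and>
        mono_arrow K A B i \<and> epi_arrow K A C p \<and> mono_arrow K C D j \<and> epi_arrow K B D q \<longrightarrow>
        (pushout_square K A B C D i p j q \<longleftrightarrow> pullback_square K A B C D i p j q))"


section \<open>Coxeter groups and their geometric action\<close>

definition word_prod :: "'g monoid \<Rightarrow> 'g list \<Rightarrow> 'g" where
  "word_prod G w = foldr (\<otimes>\<^bsub>G\<^esub>) w \<one>\<^bsub>G\<^esub>"

text \<open>
  The congruence on words generated by the relations \<open>(s t)\<^sup>m = 1\<close>, \<open>m\<close> the order of \<open>s t\<close>.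
  \<^term>\<open>group.ord\<close> is \<open>0\<close> on elements of infinite order, which gives no relation.
\<close>

inductive coxeter_congruent :: "'g monoid \<Rightarrow> 'g set \<Rightarrow> 'g list \<Rightarrow> 'g list \<Rightarrow> bool"
  for G S where
  relation: "s \<in> S \<Longrightarrow> t \<in> S \<Longrightarrow> u \<in> lists S \<Longrightarrow> v \<in> lists S \<Longrightarrow>
     coxeter_congruent G S (u @ concat (replicate (group.ord G (s \<otimes>\<^bsub>G\<^esub> t)) [s, t]) @ v) (u @ v)"
| refl: "u \<in> lists S \<Longrightarrow> coxeter_congruent G S u u"
| sym: "coxeter_congruent G S u v \<Longrightarrow> coxeter_congruent G S v u"
| trans: "coxeter_congruent G S u v \<Longrightarrow> coxeter_congruent G S v w \<Longrightarrow> coxeter_congruent G S u w"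

text \<open>The last condition says that \<open>G\<close> is presented by \<open>S\<close> and the relations above.\<close>

definition coxeter_system :: "'g monoid \<Rightarrow> 'g set \<Rightarrow> bool" where
  "coxeter_system G S \<longleftrightarrow>
     group G \<and> finite S \<and> S \<subseteq> carrier G \<and> generate G S = carrier G \<and>
     (\<forall>s\<in>S. group.ord G s = 2) \<and>
     (\<forall>w\<in>lists S. word_prod G w = \<one>\<^bsub>G\<^esub> \<longrightarrow> coxeter_congruent G S w [])"

definition reduced_expression :: "'g monoid \<Rightarrow> 'g set \<Rightarrow> 'g list \<Rightarrow> 'g \<Rightarrow> bool" where
  "reduced_expression G S w g \<longleftrightarrow>
     w \<in> lists S \<and> word_prod G w = g \<and>
     (\<forall>v\<in>lists S. word_prod G v = g \<longrightarrow> length w \<le> length v)"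

text \<open>
  The vectors with basis \<open>S\<close> are the finitely supported functions on the type of group elements
  whose support lies in \<open>S\<close>.
\<close>

type_synonym 'g vec = "'g \<Rightarrow>\<^sub>0 real"

definition simple_root :: "'g \<Rightarrow> 'g vec" where
  "simple_root s = Poly_Mapping.single s 1"

text \<open>
  For \<open>s t\<close> of infinite order the coefficient is \<open>- cos 0 = - 1\<close>, since \<open>pi / 0 = 0\<close>.
\<close>

definition coxeter_form :: "'g monoid \<Rightarrow> 'g vec \<Rightarrow> 'g vec \<Rightarrow> real" where
  "coxeter_form G u v =
     (\<Sum>s\<in>Poly_Mapping.keys u. \<Sum>t\<in>Poly_Mapping.keys v.
        Poly_Mapping.lookup u s * Poly_Mapping.lookup v t * (- cos (pi / real (group.ord G (s \<otimes>\<^bsub>G\<^esub> t)))))"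

definition simple_reflection :: "'g monoid \<Rightarrow> 'g \<Rightarrow> 'g vec \<Rightarrow> 'g vec" where
  "simple_reflection G s v = v - (2 * coxeter_form G (simple_root s) v) *\<^sub>R simple_root s"

definition word_action :: "'g monoid \<Rightarrow> 'g list \<Rightarrow> 'g vec \<Rightarrow> 'g vec" where
  "word_action G w v = foldr (simple_reflection G) w v"


section \<open>Quadruples\<close>

text \<open>
  The Coxeter system \<open>(W\<^sub>X, S\<^sub>X)\<close>, the word \<open>Q\<^sub>X\<close>, the element \<open>\<pi>\<^sub>X\<close> and the facet \<open>I\<^sub>X\<close>.
  Positions in a word are counted from \<open>0\<close>, so that \<open>[m]\<close> becomes \<open>{..<m}\<close>.
\<close>

record 'g quadruple =
  grp :: "'g monoid"
  gens :: "'g set"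
  word :: "'g list"
  elt :: 'g
  face :: "nat set"

definition subword_complex :: "'g monoid \<Rightarrow> 'g set \<Rightarrow> 'g list \<Rightarrow> 'g \<Rightarrow> nat set set" where
  "subword_complex G S Q g =
     {I. I \<subseteq> {..<length Q} \<and>
         (\<exists>J \<subseteq> {..<length Q} - I. reduced_expression G S (nths Q J) g)}"

definition quadruple :: "'g quadruple \<Rightarrow> bool" where
  "quadruple X \<longleftrightarrow>
     coxeter_system (grp X) (gens X) \<and> word X \<in> lists (gens X) \<and> elt X \<in> carrier (grp X) \<and>
     face X \<in> subword_complex (grp X) (gens X) (word X) (elt X) \<and>
     (\<forall>J \<in> subword_complex (grp X) (gens X) (word X) (elt X). face X \<subseteq> J \<longrightarrow> J = face X)"

definition positions :: "'g quadruple \<Rightarrow> nat set" where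
  "positions X = {..<length (word X)}"

definition root_space :: "'g quadruple \<Rightarrow> 'g vec set" where
  "root_space X = span (simple_root ` gens X)"

definition root_function :: "'g quadruple \<Rightarrow> nat \<Rightarrow> 'g vec" where
  "root_function X l =
     word_action (grp X) (nths (word X) ({..<l} - face X)) (simple_root (word X ! l))"

definition root_span :: "'g quadruple \<Rightarrow> nat set \<Rightarrow> 'g vec set" where
  "root_span X H = span (root_function X ` H)"

definition irreducible_quadruple :: "'g quadruple \<Rightarrow> bool" where
  "irreducible_quadruple X \<longleftrightarrow> root_space X = root_span X (face X)"

definition root_independent :: "'g quadruple \<Rightarrow> bool" where
  "root_independent X \<longleftrightarrow> card (face X) = card (gens X)"


section \<open>Equivalence of quadruples\<close>

text \<open>
  \<open>commutes_to G u v p\<close>: swapping consecutive distinct commuting letters turns \<open>u\<close> into \<open>v\<close>, and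
  the letter at position \<open>i\<close> of \<open>u\<close> ends up at position \<open>p i\<close> of \<open>v\<close>.
\<close>

inductive commutes_to :: "'g monoid \<Rightarrow> 'g list \<Rightarrow> 'g list \<Rightarrow> (nat \<Rightarrow> nat) \<Rightarrow> bool"
  for G u where
  refl: "commutes_to G u u id"
| swap: "commutes_to G u v p \<Longrightarrow> Suc i < length v \<Longrightarrow> v ! i \<noteq> v ! Suc i \<Longrightarrow>
     v ! i \<otimes>\<^bsub>G\<^esub> v ! Suc i = v ! Suc i \<otimes>\<^bsub>G\<^esub> v ! i \<Longrightarrow>
     commutes_to G u (v[i := v ! Suc i, Suc i := v ! i]) (transpose i (Suc i) \<circ> p)"

text \<open>
  An equivalence together with the isomorphism of groups \<open>\<phi>\<close> and the bijection of positions \<open>p\<close>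
  witnessing it.
\<close>

definition equivalence_via ::
  "'g quadruple \<Rightarrow> 'g quadruple \<Rightarrow> ('g \<Rightarrow> 'g) \<Rightarrow> (nat \<Rightarrow> nat) \<Rightarrow> bool" where
  "equivalence_via X Y \<phi> p \<longleftrightarrow>
     \<phi> \<in> iso (grp X) (grp Y) \<and> \<phi> ` gens X = gens Y \<and>
     commutes_to (grp Y) (map \<phi> (word X)) (word Y) p \<and>
     \<phi> (elt X) = elt Y \<and> face Y = p ` face X"


section \<open>Flats\<close>

definition flat_of :: "'g quadruple \<Rightarrow> 'g vec set \<Rightarrow> nat set" where
  "flat_of X U = {i \<in> positions X. root_function X i \<in> U}"

definition flat :: "'g quadruple \<Rightarrow> nat set \<Rightarrow> bool" where
  "flat X F \<longleftrightarrow> (\<exists>U. subspace U \<and> U \<subseteq> root_space X \<and> F = flat_of X U)"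

definition irreducible_flat :: "'g quadruple \<Rightarrow> nat set \<Rightarrow> bool" where
  "irreducible_flat X F \<longleftrightarrow> flat X F \<and> root_span X F = root_span X (F \<inter> face X)"

text \<open>
  \<open>flat_root X F j\<close> is the simple root \<open>\<beta>\<^sub>k\<close> of \<open>X\<^sub>F\<close> for the position \<open>j = j\<^sub>k \<in> F\<close>, and
  \<open>flat_letter X F j = w s w\<^sup>-\<^sup>1\<close> is the reflection in it, as an element of \<open>W\<^sub>X\<close>, where
  \<open>\<beta>\<^sub>k = w \<alpha>\<^sub>s\<close>.
\<close>

definition flat_prefix :: "'g quadruple \<Rightarrow> nat set \<Rightarrow> nat \<Rightarrow> 'g list" where
  "flat_prefix X F j = nths (word X) (({..<j} - face X) - F)"

definition flat_root :: "'g quadruple \<Rightarrow> nat set \<Rightarrow> nat \<Rightarrow> 'g vec" where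
  "flat_root X F j = word_action (grp X) (flat_prefix X F j) (simple_root (word X ! j))"

definition flat_letter :: "'g quadruple \<Rightarrow> nat set \<Rightarrow> nat \<Rightarrow> 'g" where
  "flat_letter X F j =
     (let w = word_prod (grp X) (flat_prefix X F j)
      in w \<otimes>\<^bsub>grp X\<^esub> (word X ! j) \<otimes>\<^bsub>grp X\<^esub> inv\<^bsub>grp X\<^esub> w)"

text \<open>The order-preserving bijection \<open>b\<^sub>F : F \<rightarrow> {..<card F}\<close>; its inverse is \<open>(!) (sorted_list_of_set F)\<close>.\<close>

definition flat_index :: "nat set \<Rightarrow> nat \<Rightarrow> nat" where
  "flat_index F j = card {i \<in> F. i < j}"

text \<open>
  The quadruple \<open>X\<^sub>F\<close>. Its group is the subgroup of \<open>W\<^sub>X\<close> generated by the reflections in the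
  \<open>\<beta>\<^sub>k\<close>; its abstract root space, with basis the set of these reflections, is identified with
  \<open>V(F)\<close> by sending the basis vector of the reflection in \<open>\<beta>\<^sub>k\<close> to \<open>\<beta>\<^sub>k\<close>.
\<close>

definition induced_quadruple :: "'g quadruple \<Rightarrow> nat set \<Rightarrow> 'g quadruple" where
  "induced_quadruple X F =
     (let Q = map (flat_letter X F) (sorted_list_of_set F);
          I = flat_index F ` (F \<inter> face X)
      in \<lparr>grp = (grp X)\<lparr>carrier := generate (grp X) (set Q)\<rparr>,
          gens = set Q,
          word = Q,
          elt = word_prod (grp X) (nths Q ({..<length Q} - I)),
          face = I\<rparr>)"

text \<open>
  The equality \<open>V\<^bsub>X\<^sub>F\<^esub> = V(F)\<close> of spaces with a form: the \<open>\<beta>\<^sub>k\<close> are linearly independent and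
  \<open>\<langle>\<beta>\<^sub>j, \<beta>\<^sub>k\<rangle> = - cos (\<pi> / m)\<close>, \<open>m\<close> the order of the product of the two reflections. (That the
  \<open>\<beta>\<^sub>k\<close> span \<open>V(F)\<close> is clear.) This holds for all flats if \<open>W\<^sub>X\<close> is finite, but can fail if
  \<open>W\<^sub>X\<close> is infinite. For instance, for \<open>W\<^sub>X\<close> of affine type \<open>A\<^sub>3\<close>, the roots in the
  three-dimensional space spanned by \<open>\<delta>\<close>, \<open>\<alpha>\<^sub>1\<close>, \<open>\<alpha>\<^sub>3\<close> have the four simple roots \<open>\<alpha>\<^sub>1\<close>,
  \<open>\<delta> - \<alpha>\<^sub>1\<close>, \<open>\<alpha>\<^sub>3\<close>, \<open>\<delta> - \<alpha>\<^sub>3\<close>, and these can all occur among the \<open>\<beta>\<^sub>k\<close> of an irreducible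
  flat; no quadruple \<open>X\<^sub>F\<close> with the stated properties exists then.
\<close>

definition realized_on_flat :: "'g quadruple \<Rightarrow> nat set \<Rightarrow> bool" where
  "realized_on_flat X F \<longleftrightarrow>
     independent (flat_root X F ` F) \<and>
     (\<forall>j\<in>F. \<forall>k\<in>F. coxeter_form (grp X) (flat_root X F j) (flat_root X F k)
        = - cos (pi / real (group.ord (grp X) (flat_letter X F j \<otimes>\<^bsub>grp X\<^esub> flat_letter X F k))))"

definition flats_induce_quadruples :: "'g quadruple \<Rightarrow> bool" where
  "flats_induce_quadruples X \<longleftrightarrow> (\<forall>F. irreducible_flat X F \<longrightarrow> realized_on_flat X F)"


section \<open>The subword complex category\<close>

text \<open>
  A morphism is a pair of irreducible flats with equivalent induced quadruples, together with the
  linear isomorphism \<open>l : V(F\<^sub>1) \<rightarrow> V(F\<^sub>2)\<close> that an equivalence induces. The linear isomorphism is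
  part of the morphism: the flats do not determine it (for \<open>Q = s t\<close> with \<open>s\<close>, \<open>t\<close> commuting and
  \<open>\<pi> = 1\<close>, both the identity and the exchange of \<open>s\<close> and \<open>t\<close> are equivalences), and the
  composition depends on it. As a function it is \<^term>\<open>undefined\<close> outside \<open>V(F\<^sub>1)\<close>, so that equal
  morphisms are equal as HOL objects.
\<close>

type_synonym 'g morphism = "nat set \<times> nat set \<times> ('g vec \<Rightarrow> 'g vec)"

definition induced_linear_map ::
  "'g quadruple \<Rightarrow> nat set \<Rightarrow> 'g quadruple \<Rightarrow> nat set \<Rightarrow> (nat \<Rightarrow> nat) \<Rightarrow> ('g vec \<Rightarrow> 'g vec) \<Rightarrow> bool"
  where
  "induced_linear_map X F1 Y F2 p l \<longleftrightarrow>
     (\<exists>h. linear h \<and> l = restrict h (root_span X F1) \<and>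
       (\<forall>k < card F1. h (flat_root X F1 (sorted_list_of_set F1 ! k))
          = flat_root Y F2 (sorted_list_of_set F2 ! p k)))"

definition subword_morphisms :: "'g quadruple \<Rightarrow> 'g quadruple \<Rightarrow> 'g morphism set" where
  "subword_morphisms X Y =
     {(F1, F2, l). irreducible_flat X F1 \<and> irreducible_flat Y F2 \<and>
        (\<exists>\<phi> p. equivalence_via (induced_quadruple X F1) (induced_quadruple Y F2) \<phi> p \<and>
               induced_linear_map X F1 Y F2 p l)}"

definition subword_identity :: "'g quadruple \<Rightarrow> 'g morphism" where
  "subword_identity X =
     (positions X, positions X, restrict (\<lambda>v. v) (root_span X (positions X)))"

fun subword_compose ::
  "'g quadruple \<Rightarrow> 'g quadruple \<Rightarrow> 'g quadruple \<Rightarrow> 'g morphism \<Rightarrow> 'g morphism \<Rightarrow> 'g morphism"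
  where
  "subword_compose X Y Z (F3, F4, m) (F1, F2, l) =
     (let U = root_span Y (F2 \<inter> F3 \<inter> face Y);
          G1 = flat_of X (inv_into (root_span X F1) l ` U);
          G4 = flat_of Z (m ` U)
      in (G1, G4, restrict (m \<circ> l) (root_span X G1)))"

definition subword_category :: "('g quadruple, 'g morphism) cat" where
  "subword_category =
     \<lparr>Obj = {X. quadruple X \<and> irreducible_quadruple X \<and> flats_induce_quadruples X},
      Hom = subword_morphisms,
      Idn = subword_identity,
      Cmp = subword_compose\<rparr>"

definition root_independent_category :: "('g quadruple, 'g morphism) cat" where
  "root_independent_category = full_subcategory subword_category root_independent"

end

theory Submission
  imports Defs
begin

text \<open>
  If \<open>X\<close> is root independent, the roots \<open>r\<^sub>X(i)\<close> with \<open>i \<in> I\<^sub>X\<close> form a basis. Hence an irreducible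
  flat \<open>F\<close> is determined by \<open>F \<inter> I\<^sub>X\<close>, every subset of \<open>I\<^sub>X\<close> arises in this way, and a morphism
  \<open>X \<rightarrow> Y\<close> is determined by the partial injection from \<open>I\<^sub>X\<close> to \<open>I\<^sub>Y\<close> that it induces. Composition
  of morphisms is composition of partial injections, equivalences can be inverted, and each subset of
  \<open>I\<^sub>X\<close> is the image of a monomorphism, namely of the embedding of \<open>X\<^sub>F\<close>. In a category of this kind
  the monomorphisms are the total partial injections, the epimorphisms the surjective ones, and a
  commutative square \<open>A \<hookrightarrow> B\<close>, \<open>A \<rightarrow> C\<close>, \<open>C \<hookrightarrow> D\<close>, \<open>B \<rightarrow> D\<close> of the shape in question is a pushout if
  and only if \<open>B\<close> is the union of the image of \<open>A\<close> and the domain of \<open>B \<rightarrow> D\<close>. This condition is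
  self-dual, so it also characterises the pullbacks.

  That \<open>X\<^sub>F\<close> is a quadruple follows from the theorem of Tits: since the \<open>\<beta>\<^sub>k\<close> span a copy of the
  geometric representation belonging to the orders of the products of the reflections in them, and
  this representation is faithful, these reflections form a Coxeter system. The \<open>\<beta>\<^sub>k\<close> are positive
  because \<open>F\<close> contains all positions whose root lies in \<open>V(F)\<close>, and so the word outside the face is
  reduced because its roots are positive. Equivalences restrict to flats because a single commutation
  changes the word of \<open>X\<^sub>F\<close> by at most one commutation.
\<close>

section \<open>Categories of partial injections\<close>

text \<open>The group of \<open>induced_quadruple X F\<close> is at first only a subgroup of
  \<open>grp X\<close> with finitely many distinguished involutions; its presentation has to come
  out as a conclusion. Tits' argument is therefore run for words modulo the Coxeter relations, in
  the locale \<open>involution_system\<close>, and lengths are measured in congruence classes of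
  words instead of in a group. All induced groups are kept inside \<open>grp X\<close>, with their
  reflections as actual elements. A flat of an induced quadruple then induces literally the same
  record as the corresponding flat of \<open>X\<close>, and this is what makes restrictions and
  composites of equivalences computable. On the categorical side, taking converses is a duality on
  partial injections, so each statement about pullbacks is obtained from one about pushouts in the
  opposite category.\<close>

definition opposite :: "('o, 'm) cat \<Rightarrow> ('o, 'm) cat" where
  "opposite K = \<lparr>Obj = Obj K, Hom = (\<lambda>X Y. Hom K Y X), Idn = Idn K,
     Cmp = (\<lambda>X Y Z g f. Cmp K Z Y X f g)\<rparr>"

lemma opposite_simps [simp]:
  "Obj (opposite K) = Obj K" "Hom (opposite K) X Y = Hom K Y X" "Idn (opposite K) = Idn K"
  "Cmp (opposite K) X Y Z g f = Cmp K Z Y X f g"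
  by (simp_all add: opposite_def)

lemma opposite_arrow_iff [simp]:
  "mono_arrow (opposite K) X Y f \<longleftrightarrow> epi_arrow K Y X f"
  "epi_arrow (opposite K) X Y f \<longleftrightarrow> mono_arrow K Y X f"
  by (simp_all add: mono_arrow_def epi_arrow_def)

lemma opposite_square_iff [simp]:
  "commutative_square (opposite K) D B C A q j p i \<longleftrightarrow> commutative_square K A B C D i p j q"
  "pushout_square (opposite K) D B C A q j p i \<longleftrightarrow> pullback_square K A B C D i p j q"
proof -
  show *: "commutative_square (opposite K) D B C A q j p i \<longleftrightarrow> commutative_square K A B C D i p j q"
    for A B C D i p j q by (auto simp: commutative_square_def)
  show "pushout_square (opposite K) D B C A q j p i \<longleftrightarrow> pullback_square K A B C D i p j q"
    by (auto simp: pushout_square_def pullback_square_def *)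
qed

text \<open>The category laws follow from faithfulness, which reduces each of them to a law of
  relations. \<open>converse_ex\<close> supplies partial inverses, \<open>subobject_ex\<close>
  enough objects, and \<open>hom_ne\<close> the arrows to and from a zero object. Relations compose
  in diagrammatic order, hence the reversal in \<open>gr_Cmp\<close>.\<close>

locale partial_injection_category =
  fixes K :: "('o, 'm) cat"
    and E :: "'o \<Rightarrow> 'e set"
    and gr :: "'o \<Rightarrow> 'o \<Rightarrow> 'm \<Rightarrow> ('e \<times> 'e) set"
  assumes obj_ne: "Obj K \<noteq> {}"
    and gr_sub: "\<lbrakk>X \<in> Obj K; Y \<in> Obj K; f \<in> Hom K X Y\<rbrakk> \<Longrightarrow> gr X Y f \<subseteq> E X \<times> E Y"
    and gr_sv: "\<lbrakk>X \<in> Obj K; Y \<in> Obj K; f \<in> Hom K X Y\<rbrakk> \<Longrightarrow> single_valued (gr X Y f)"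
    and gr_inj: "\<lbrakk>X \<in> Obj K; Y \<in> Obj K; f \<in> Hom K X Y\<rbrakk> \<Longrightarrow> single_valued ((gr X Y f)\<inverse>)"
    and gr_faithful: "\<lbrakk>X \<in> Obj K; Y \<in> Obj K; f \<in> Hom K X Y; g \<in> Hom K X Y; gr X Y f = gr X Y g\<rbrakk> \<Longrightarrow> f = g"
    and Idn_hom: "X \<in> Obj K \<Longrightarrow> Idn K X \<in> Hom K X X"
    and gr_Idn: "X \<in> Obj K \<Longrightarrow> gr X X (Idn K X) = Id_on (E X)"
    and Cmp_hom: "\<lbrakk>X \<in> Obj K; Y \<in> Obj K; Z \<in> Obj K; f \<in> Hom K X Y; g \<in> Hom K Y Z\<rbrakk>
        \<Longrightarrow> Cmp K X Y Z g f \<in> Hom K X Z"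
    and gr_Cmp: "\<lbrakk>X \<in> Obj K; Y \<in> Obj K; Z \<in> Obj K; f \<in> Hom K X Y; g \<in> Hom K Y Z\<rbrakk>
        \<Longrightarrow> gr X Z (Cmp K X Y Z g f) = gr X Y f O gr Y Z g"
    and hom_ne: "\<lbrakk>X \<in> Obj K; Y \<in> Obj K\<rbrakk> \<Longrightarrow> Hom K X Y \<noteq> {}"
    and converse_ex: "\<lbrakk>X \<in> Obj K; Y \<in> Obj K; f \<in> Hom K X Y\<rbrakk>
        \<Longrightarrow> \<exists>f'\<in>Hom K Y X. gr Y X f' = (gr X Y f)\<inverse>"
    and subobject_ex: "\<lbrakk>X \<in> Obj K; J \<subseteq> E X\<rbrakk>
        \<Longrightarrow> \<exists>A\<in>Obj K. \<exists>f\<in>Hom K A X. Domain (gr A X f) = E A \<and> Range (gr A X f) = J"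
begin

lemma gr_converse_comp:
  assumes "X \<in> Obj K" "Y \<in> Obj K" "f \<in> Hom K X Y"
  shows "gr X Y f O (gr X Y f)\<inverse> = Id_on (Domain (gr X Y f))"
    and "(gr X Y f)\<inverse> O gr X Y f = Id_on (Range (gr X Y f))"
  using gr_sv[OF assms] gr_inj[OF assms] unfolding single_valued_def by fast+

lemma category: "category K"
  unfolding category_def
proof (intro conjI ballI)
  fix X Y f assume XY: "X \<in> Obj K" "Y \<in> Obj K" and f: "f \<in> Hom K X Y"
  note sub = gr_sub[OF XY f]
  show "Cmp K X X Y f (Idn K X) = f"
    by (rule gr_faithful[OF XY]) (use sub in \<open>auto simp: gr_Cmp gr_Idn XY f Idn_hom Cmp_hom\<close>)
  show "Cmp K X Y Y (Idn K Y) f = f"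
    by (rule gr_faithful[OF XY]) (use sub in \<open>auto simp: gr_Cmp gr_Idn XY f Idn_hom Cmp_hom\<close>)
next
  fix X Y Z T f g h
  assume *: "X \<in> Obj K" "Y \<in> Obj K" "Z \<in> Obj K" "T \<in> Obj K"
    "f \<in> Hom K X Y" "g \<in> Hom K Y Z" "h \<in> Hom K Z T"
  show "Cmp K X Z T h (Cmp K X Y Z g f) = Cmp K X Y T (Cmp K Y Z T h g) f"
    by (rule gr_faithful[of X T]) (auto simp: gr_Cmp Cmp_hom * O_assoc)
qed (auto intro: Idn_hom Cmp_hom)

text \<open>A mono \<open>f\<close> can be cancelled from \<open>f f' f = f\<close>, where
  \<open>f'\<close> is the converse arrow; then \<open>f' f\<close> is the identity, while as a
  relation it is the identity on the domain of \<open>f\<close>. If \<open>f\<close> is total,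
  composing with the converse relation undoes it.\<close>

lemma mono_arrow_iff:
  assumes XY: "X \<in> Obj K" "Y \<in> Obj K" and f: "f \<in> Hom K X Y"
  shows "mono_arrow K X Y f \<longleftrightarrow> Domain (gr X Y f) = E X"
proof
  assume m: "mono_arrow K X Y f"
  obtain f' where f': "f' \<in> Hom K Y X" "gr Y X f' = (gr X Y f)\<inverse>"
    using converse_ex[OF XY f] by blast
  have "Cmp K X X Y f (Cmp K X Y X f' f) = Cmp K X X Y f (Idn K X)"
    by (rule gr_faithful[OF XY])
      (use gr_sub[OF XY f] in \<open>auto simp: gr_Cmp Cmp_hom gr_Idn Idn_hom XY f f' gr_converse_comp\<close>)
  hence "Cmp K X Y X f' f = Idn K X"
    using m XY f f'(1) unfolding mono_arrow_def by (meson Cmp_hom Idn_hom)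
  hence "gr X Y f O (gr X Y f)\<inverse> = Id_on (E X)"
    using gr_Cmp[OF XY XY(1) f f'(1)] gr_Idn[OF XY(1)] f'(2) by simp
  thus "Domain (gr X Y f) = E X"
    unfolding gr_converse_comp[OF XY f] by (metis Domain_Id_on)
next
  assume d: "Domain (gr X Y f) = E X"
  show "mono_arrow K X Y f" unfolding mono_arrow_def
  proof (intro conjI ballI impI f)
    fix T g h assume T: "T \<in> Obj K" and gh: "g \<in> Hom K T X" "h \<in> Hom K T X"
      and eq: "Cmp K T X Y f g = Cmp K T X Y f h"
    have eq: "gr T X g O gr X Y f = gr T X h O gr X Y f"
      using arg_cong[OF eq, of "gr T Y"] T XY f gh by (simp add: gr_Cmp)
    hence "gr T X g O (gr X Y f O (gr X Y f)\<inverse>) = gr T X h O (gr X Y f O (gr X Y f)\<inverse>)"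
      by (metis O_assoc)
    hence "gr T X g O Id_on (E X) = gr T X h O Id_on (E X)"
      unfolding gr_converse_comp[OF XY f] d .
    hence "gr T X g = gr T X h"
      using gr_sub[OF T XY(1) gh(1)] gr_sub[OF T XY(1) gh(2)] by blast
    thus "g = h" using gr_faithful T XY gh by blast
  qed
qed

text \<open>The converse of an embedding is a quotient, so \<open>subobject_ex\<close> and
  \<open>converse_ex\<close> together give \<open>subobject_ex\<close> for the opposite category.
  The remaining axioms are symmetric under converse.\<close>

lemma dual: "partial_injection_category (opposite K) E (\<lambda>X Y f. (gr Y X f)\<inverse>)"
proof (unfold_locales, unfold opposite_simps)
  fix X J assume X: "X \<in> Obj K" and "J \<subseteq> E X"
  then obtain A f where A: "A \<in> Obj K" "f \<in> Hom K A X" "Domain (gr A X f) = E A" "Range (gr A X f) = J"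
    using subobject_ex by blast
  obtain f' where "f' \<in> Hom K X A" "gr X A f' = (gr A X f)\<inverse>"
    using converse_ex[OF A(1) X A(2)] by blast
  thus "\<exists>A\<in>Obj K. \<exists>f\<in>Hom K X A. Domain ((gr X A f)\<inverse>) = E A \<and> Range ((gr X A f)\<inverse>) = J"
    using A by (intro bexI[of _ A] bexI[of _ f']) auto
next
  fix X Y f assume "X \<in> Obj K" "Y \<in> Obj K" "f \<in> Hom K Y X"
  thus "\<exists>f'\<in>Hom K X Y. (gr X Y f')\<inverse> = ((gr Y X f)\<inverse>)\<inverse>" using converse_ex by metis
qed (use obj_ne gr_sub gr_sv gr_inj gr_faithful Idn_hom gr_Idn Cmp_hom gr_Cmp hom_ne in
  \<open>auto simp: converse_relcomp\<close>)

lemma epi_arrow_iff: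
  assumes "X \<in> Obj K" "Y \<in> Obj K" "f \<in> Hom K X Y"
  shows "epi_arrow K X Y f \<longleftrightarrow> Range (gr X Y f) = E Y"
  using partial_injection_category.mono_arrow_iff[OF dual, of Y X f] assms by simp

text \<open>Cutting down to the empty subset gives \<open>Z\<close> with \<open>E Z = {}\<close>.
  Only the empty relation leads to or from it, so faithfulness gives uniqueness and
  \<open>hom_ne\<close> existence.\<close>

lemma zero_object_ex: "\<exists>Z. zero_object K Z"
proof -
  obtain X where X: "X \<in> Obj K" using obj_ne by blast
  obtain Z f where Z: "Z \<in> Obj K" "f \<in> Hom K Z X" "Domain (gr Z X f) = E Z" "Range (gr Z X f) = {}"
    using subobject_ex[OF X empty_subsetI] by blast
  hence "E Z = {}" by auto
  hence "gr Y Z g = {}" "gr Z Y h = {}" if "Y \<in> Obj K" "g \<in> Hom K Y Z" "h \<in> Hom K Z Y" for Y g h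
    using gr_sub[OF that(1) Z(1) that(2)] gr_sub[OF Z(1) that(1,3)] by auto
  hence "zero_object K Z" unfolding zero_object_def
    using Z(1) hom_ne gr_faithful by (metis ex_in_conv)
  thus ?thesis ..
qed

section \<open>Squares and the covering condition\<close>

lemma square_iff:
  assumes "A \<in> Obj K" "B \<in> Obj K" "C \<in> Obj K" "D \<in> Obj K"
    and "i \<in> Hom K A B" "p \<in> Hom K A C" "j \<in> Hom K C D" "q \<in> Hom K B D"
  shows "commutative_square K A B C D i p j q \<longleftrightarrow>
    gr A B i O gr B D q = gr A C p O gr C D j"
  unfolding commutative_square_def using assms gr_faithful[of A D]
  by (auto simp: Cmp_hom simp flip: gr_Cmp)

text \<open>As \<open>q\<close> is surjective, the factorisation has to be \<open>f\<close> after
  the converse of \<open>q\<close>. It gives back \<open>f\<close> only if \<open>f\<close> is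
  undefined outside the domain of \<open>q\<close>, and this is what the covering condition
  ensures.\<close>

lemma covering_square_is_pushout:
  assumes sq: "commutative_square K A B C D i p j q"
    and p: "epi_arrow K A C p" and j: "mono_arrow K C D j" and q: "epi_arrow K B D q"
    and cov: "E B \<subseteq> Range (gr A B i) \<union> Domain (gr B D q)"
  shows "pushout_square K A B C D i p j q"
proof -
  have ob: "A \<in> Obj K" "B \<in> Obj K" "C \<in> Obj K" "D \<in> Obj K"
    and ar: "i \<in> Hom K A B" "p \<in> Hom K A C" "j \<in> Hom K C D" "q \<in> Hom K B D"
    using sq by (auto simp: commutative_square_def)
  have comm: "gr A B i O gr B D q = gr A C p O gr C D j"
    using sq square_iff[OF ob ar] by blast
  have dj: "Domain (gr C D j) = E C" using j ob ar mono_arrow_iff by blast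
  obtain q' where q': "q' \<in> Hom K D B" "gr D B q' = (gr B D q)\<inverse>"
    using converse_ex ob ar by meson
  have "\<exists>!u. u \<in> Hom K D T \<and> Cmp K B D T u q = f \<and> Cmp K C D T u j = g"
    if sqT: "commutative_square K A B C T i p g f" for T f g
  proof -
    have T: "T \<in> Obj K" and fg: "f \<in> Hom K B T" "g \<in> Hom K C T"
      using sqT by (auto simp: commutative_square_def)
    have commT: "gr A B i O gr B T f = gr A C p O gr C T g"
      using sqT square_iff[OF ob(1-3) T ar(1,2) fg(2,1)] by blast
    define u where "u = Cmp K D B T f q'"
    have u: "u \<in> Hom K D T" "gr D T u = (gr B D q)\<inverse> O gr B T f"
      using T fg q' ob by (auto simp: u_def Cmp_hom gr_Cmp)
    \<comment> \<open>A point \<open>b\<close> outside the domain of \<open>q\<close> would be the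
      image of some \<open>a\<close>. If \<open>f\<close> is defined at \<open>b\<close>,
      commutativity makes \<open>p\<close> defined at \<open>a\<close>; since \<open>j\<close> is
      total, the first square then puts \<open>b\<close> into the domain of
      \<open>q\<close>.\<close>
    have dom: "Domain (gr B T f) \<subseteq> Domain (gr B D q)"
    proof
      fix b assume "b \<in> Domain (gr B T f)"
      then obtain t where t: "(b, t) \<in> gr B T f" by blast
      hence "b \<in> E B" using gr_sub[OF ob(2) T fg(1)] by blast
      then consider "b \<in> Domain (gr B D q)" | a where "(a, b) \<in> gr A B i" using cov by blast
      thus "b \<in> Domain (gr B D q)"
      proof cases
        case 2
        hence "(a, t) \<in> gr A C p O gr C T g" using t commT by blast
        then obtain c where "(a, c) \<in> gr A C p" by blast
        moreover from this obtain d where "(c, d) \<in> gr C D j"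
          using dj gr_sub[OF ob(1,3) ar(2)] by blast
        ultimately have "(a, d) \<in> gr A B i O gr B D q" using comm by blast
        thus ?thesis using 2 gr_sv[OF ob(1,2) ar(1)] by (auto dest: single_valuedD)
      qed
    qed
    have uq: "Cmp K B D T u q = f"
    proof (rule gr_faithful[OF ob(2) T _ fg(1)])
      have "gr B T (Cmp K B D T u q) = (gr B D q O (gr B D q)\<inverse>) O gr B T f"
        using u T ob ar by (simp add: gr_Cmp O_assoc)
      also have "\<dots> = gr B T f" unfolding gr_converse_comp[OF ob(2,4) ar(4)] using dom by (auto simp: relcomp_unfold Id_on_iff)
      finally show "gr B T (Cmp K B D T u q) = gr B T f" .
    qed (use u T ob ar in \<open>auto intro: Cmp_hom\<close>)
    \<comment> \<open>The second triangle follows from the first one after composition with the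
      epimorphism \<open>p\<close>, which can be cancelled.\<close>
    have "Cmp K A C T (Cmp K C D T u j) p = Cmp K A C T g p"
    proof (rule gr_faithful[OF ob(1) T])
      have "gr B D q O gr D T u = gr B T f" using uq u T ob ar gr_Cmp by metis
      hence "gr A C p O gr C D j O gr D T u = gr A C p O gr C T g"
        using comm commT by (metis O_assoc)
      thus "gr A T (Cmp K A C T (Cmp K C D T u j) p) = gr A T (Cmp K A C T g p)"
        using u T ob ar fg by (simp add: gr_Cmp Cmp_hom)
    qed (use u T ob ar fg in \<open>auto intro!: Cmp_hom\<close>)
    hence uj: "Cmp K C D T u j = g"
      using p T u(1) ob ar fg(2) unfolding epi_arrow_def by (meson Cmp_hom)
    show ?thesis
      using u(1) uq uj q T unfolding epi_arrow_def by blast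
  qed
  thus ?thesis using sq by (auto simp: pushout_square_def)
qed

text \<open>
  The pushout is the subobject of \<open>B\<close> in which \<open>A\<close> is cut down to \<open>C\<close>.
\<close>

lemma covering_square_over_span:
  assumes ob: "A \<in> Obj K" "B \<in> Obj K" "C \<in> Obj K"
    and i: "mono_arrow K A B i" and p: "epi_arrow K A C p"
  shows "\<exists>D\<in>Obj K. \<exists>j q. commutative_square K A B C D i p j q \<and> mono_arrow K C D j \<and>
    epi_arrow K B D q \<and> E B \<subseteq> Range (gr A B i) \<union> Domain (gr B D q)"
proof -
  have ar: "i \<in> Hom K A B" "p \<in> Hom K A C" using i p by (auto simp: mono_arrow_def epi_arrow_def)
  note di = i[unfolded mono_arrow_iff[OF ob(1,2) ar(1)]]
  note rp = p[unfolded epi_arrow_iff[OF ob(1,3) ar(2)]]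
  note sub = gr_sub[OF ob(1,2) ar(1)] gr_sub[OF ob(1,3) ar(2)]
  define J where "J = (E B - Range (gr A B i)) \<union> gr A B i `` Domain (gr A C p)"
  have "J \<subseteq> E B" using sub by (auto simp: J_def)
  then obtain D e where D: "D \<in> Obj K" and e: "e \<in> Hom K D B"
    "Domain (gr D B e) = E D" "Range (gr D B e) = J" using subobject_ex ob(2) by meson
  obtain q where q: "q \<in> Hom K B D" "gr B D q = (gr D B e)\<inverse>"
    using converse_ex[OF D ob(2) e(1)] by blast
  obtain p' where p': "p' \<in> Hom K C A" "gr C A p' = (gr A C p)\<inverse>"
    using converse_ex[OF ob(1,3) ar(2)] by blast
  \<comment> \<open>Forced by commutativity, since \<open>p\<close> is surjective: back along
    \<open>p\<close>, then along \<open>i\<close> and \<open>q\<close>.\<close>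
  define j where "j = Cmp K C B D q (Cmp K C A B i p')"
  have j: "j \<in> Hom K C D" "gr C D j = (gr A C p)\<inverse> O gr A B i O gr B D q"
    using ob D ar p' q by (auto simp: j_def Cmp_hom gr_Cmp O_assoc)
  have dq: "Domain (gr B D q) = J" "Range (gr B D q) = E D" using e q by auto
  have "gr A C p O gr C D j = (gr A C p O (gr A C p)\<inverse>) O gr A B i O gr B D q"
    unfolding j by (simp add: O_assoc)
  also have "\<dots> = gr A B i O gr B D q"
  proof
    show "gr A B i O gr B D q \<subseteq> (gr A C p O (gr A C p)\<inverse>) O gr A B i O gr B D q"
    proof clarify
      fix a b d assume abd: "(a, b) \<in> gr A B i" "(b, d) \<in> gr B D q"
      hence "b \<in> J" using dq by blast
      hence "b \<in> gr A B i `` Domain (gr A C p)" using abd by (auto simp: J_def)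
      hence "a \<in> Domain (gr A C p)"
        using gr_inj[OF ob(1,2) ar(1)] abd by (auto dest: single_valuedD)
      thus "(a, d) \<in> (gr A C p O (gr A C p)\<inverse>) O gr A B i O gr B D q" using abd by blast
    qed
  qed (use gr_converse_comp[OF ob(1,3) ar(2)] in auto)
  finally have sq: "commutative_square K A B C D i p j q"
    using square_iff[OF ob D ar j(1) q(1)] by simp
  have "E C \<subseteq> Domain (gr C D j)"
  proof
    fix c assume "c \<in> E C"
    then obtain a where a: "(a, c) \<in> gr A C p" using rp by blast
    then obtain b where b: "(a, b) \<in> gr A B i" using di sub by blast
    hence "b \<in> J" using a by (auto simp: J_def)
    thus "c \<in> Domain (gr C D j)" using a b dq unfolding j by blast
  qed
  hence "mono_arrow K C D j"
    using mono_arrow_iff[OF ob(3) D j(1)] gr_sub[OF ob(3) D j(1)] by auto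
  moreover have "epi_arrow K B D q" using epi_arrow_iff[OF ob(2) D q(1)] dq by simp
  moreover have "E B \<subseteq> Range (gr A B i) \<union> Domain (gr B D q)" using dq by (auto simp: J_def)
  ultimately show ?thesis using sq D by blast
qed

text \<open>The covering cocone \<open>T\<close> over the same span factors through
  \<open>D\<close>, so its arrow out of \<open>B\<close> is defined at most where \<open>q\<close>
  is. Hence the covering property passes from \<open>T\<close> to \<open>D\<close>.\<close>

lemma pushout_square_covering:
  assumes po: "pushout_square K A B C D i p j q"
    and i: "mono_arrow K A B i" and p: "epi_arrow K A C p"
  shows "E B \<subseteq> Range (gr A B i) \<union> Domain (gr B D q)"
proof -
  have ob: "A \<in> Obj K" "B \<in> Obj K" "C \<in> Obj K" "D \<in> Obj K" and q: "q \<in> Hom K B D"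
    using po by (auto simp: pushout_square_def commutative_square_def)
  obtain T g f where T: "T \<in> Obj K" and f: "commutative_square K A B C T i p g f"
    and cov: "E B \<subseteq> Range (gr A B i) \<union> Domain (gr B T f)"
    using covering_square_over_span[OF ob(1-3) i p] by blast
  obtain u where "u \<in> Hom K D T" "Cmp K B D T u q = f"
    using po f unfolding pushout_square_def by blast
  hence "gr B T f = gr B D q O gr D T u" using gr_Cmp[OF ob(2,4) T q] by metis
  thus ?thesis using cov by auto
qed

text \<open>Reversing the arrows exchanges \<open>i\<close> with \<open>q\<close>, and with them the
  two sets of the union.\<close>

lemma covering_square_is_pullback:
  assumes "commutative_square K A B C D i p j q"
    and "mono_arrow K A B i" "epi_arrow K A C p" "mono_arrow K C D j"
    and "E B \<subseteq> Range (gr A B i) \<union> Domain (gr B D q)"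
  shows "pullback_square K A B C D i p j q"
  using partial_injection_category.covering_square_is_pushout[OF dual, of D B C A q j p i] assms by auto

lemma covering_square_over_cospan:
  assumes "B \<in> Obj K" "C \<in> Obj K" "D \<in> Obj K" "mono_arrow K C D j" "epi_arrow K B D q"
  shows "\<exists>A\<in>Obj K. \<exists>i p. commutative_square K A B C D i p j q \<and> mono_arrow K A B i \<and>
    epi_arrow K A C p \<and> E B \<subseteq> Range (gr A B i) \<union> Domain (gr B D q)"
  using partial_injection_category.covering_square_over_span[OF dual, of D B C q j] assms
  by (simp add: Un_commute) metis

lemma pullback_square_covering:
  assumes "pullback_square K A B C D i p j q" "mono_arrow K C D j" "epi_arrow K B D q"
  shows "E B \<subseteq> Range (gr A B i) \<union> Domain (gr B D q)"
  using partial_injection_category.pushout_square_covering[OF dual, of D B C A q j p i] assms by auto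

theorem proto_abelian: "proto_abelian K"
  unfolding proto_abelian_def
proof (intro conjI ballI allI impI category zero_object_ex; (elim conjE)?)
  fix A B C i p assume "A \<in> Obj K" "B \<in> Obj K" "C \<in> Obj K" "mono_arrow K A B i" "epi_arrow K A C p"
  thus "\<exists>D j q. pushout_square K A B C D i p j q \<and> mono_arrow K C D j \<and> epi_arrow K B D q"
    using covering_square_over_span covering_square_is_pushout by meson
next
  fix B C D j q assume "B \<in> Obj K" "C \<in> Obj K" "D \<in> Obj K" "mono_arrow K C D j" "epi_arrow K B D q"
  thus "\<exists>A i p. pullback_square K A B C D i p j q \<and> mono_arrow K A B i \<and> epi_arrow K A C p"
    using covering_square_over_cospan covering_square_is_pullback by meson
next
  fix A B C D i p j q
  assume "commutative_square K A B C D i p j q" "mono_arrow K A B i" "epi_arrow K A C p"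
    "mono_arrow K C D j" "epi_arrow K B D q"
  thus "pushout_square K A B C D i p j q \<longleftrightarrow> pullback_square K A B C D i p j q"
    by (meson covering_square_is_pushout covering_square_is_pullback
        pushout_square_covering pullback_square_covering)
qed

end

section \<open>The geometric representation\<close>

lemma lookup_scaleR [simp]: "Poly_Mapping.lookup (a *\<^sub>R v) x = a *\<^sub>R Poly_Mapping.lookup v x"
  by (simp add: scaleR_poly_mapping_def Poly_Mapping.map.rep_eq when_def)

lemma lookup_simple_root: "Poly_Mapping.lookup (simple_root s) x = (if s = x then 1 else 0)"
  by (simp add: simple_root_def lookup_single when_def)

lemma keys_simple_root [simp]: "Poly_Mapping.keys (simple_root s) = {s}"
  by (simp add: simple_root_def)

lemma simple_root_eq_iff [simp]: "simple_root s = simple_root t \<longleftrightarrow> s = t"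
  by (metis keys_simple_root singleton_inject)

lemma simple_root_ne_0 [simp]: "simple_root s \<noteq> 0"
  by (metis keys_simple_root keys_zero empty_not_insert)

lemma span_simple_roots: "span (simple_root ` S) = {v. Poly_Mapping.keys v \<subseteq> S}"
proof
  have "Poly_Mapping.keys (c *\<^sub>R v) \<subseteq> Poly_Mapping.keys v" for c and v :: "'a vec"
    by (auto simp: in_keys_iff)
  hence "subspace {v :: 'a vec. Poly_Mapping.keys v \<subseteq> S}"
    unfolding subspace_def by simp (meson Poly_Mapping.keys_add Un_least subset_trans)
  thus "span (simple_root ` S) \<subseteq> {v. Poly_Mapping.keys v \<subseteq> S}"
    by (rule span_minimal[rotated]) auto
  show "{v. Poly_Mapping.keys v \<subseteq> S} \<subseteq> span (simple_root ` S)"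
  proof clarify
    fix v :: "'a vec" assume v: "Poly_Mapping.keys v \<subseteq> S"
    have *: "v = (\<Sum>s\<in>Poly_Mapping.keys v. Poly_Mapping.lookup v s *\<^sub>R simple_root s)"
    proof (rule poly_mapping_eqI)
      fix x
      have "(\<Sum>s\<in>Poly_Mapping.keys v. Poly_Mapping.lookup v s * (if s = x then 1 else 0))
        = Poly_Mapping.lookup v x"
        by (simp add: in_keys_iff if_distrib cong: if_cong)
      thus "Poly_Mapping.lookup v x = Poly_Mapping.lookup
          (\<Sum>s\<in>Poly_Mapping.keys v. Poly_Mapping.lookup v s *\<^sub>R simple_root s) x"
        by (simp add: lookup_sum lookup_simple_root)
    qed
    show "v \<in> span (simple_root ` S)"
      by (subst *) (intro span_sum span_scale span_base, use v in auto)
  qed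
qed

lemma independent_simple_roots: "independent (simple_root ` S)"
proof -
  have "simple_root s \<notin> span (simple_root ` S - {simple_root s})" for s
  proof -
    have "simple_root ` S - {simple_root s} = simple_root ` (S - {s})" by auto
    thus ?thesis by (auto simp: span_simple_roots)
  qed
  thus ?thesis unfolding dependent_def by blast
qed

text \<open>\<open>coxeter_form\<close> sums over the supports, which change under addition. Fixed
  finite index sets containing the supports turn bilinearity into distributing sums.\<close>

lemma coxeter_form_expand:
  assumes "finite A" "finite B" "Poly_Mapping.keys u \<subseteq> A" "Poly_Mapping.keys v \<subseteq> B"
  shows "coxeter_form G u v = (\<Sum>s\<in>A. \<Sum>t\<in>B.
    Poly_Mapping.lookup u s * Poly_Mapping.lookup v t * (- cos (pi / real (group.ord G (s \<otimes>\<^bsub>G\<^esub> t)))))"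
proof -
  have "(\<Sum>t\<in>Poly_Mapping.keys v.
      Poly_Mapping.lookup u s * Poly_Mapping.lookup v t * (- cos (pi / real (group.ord G (s \<otimes>\<^bsub>G\<^esub> t)))))
    = (\<Sum>t\<in>B. Poly_Mapping.lookup u s * Poly_Mapping.lookup v t * (- cos (pi / real (group.ord G (s \<otimes>\<^bsub>G\<^esub> t)))))"
    for s by (rule sum.mono_neutral_left) (use assms in \<open>auto simp: in_keys_iff\<close>)
  thus ?thesis unfolding coxeter_form_def
    by (simp, intro sum.mono_neutral_left) (use assms in \<open>auto simp: in_keys_iff\<close>)
qed

lemma linear_coxeter_form: "linear (coxeter_form (G :: 'g monoid) u)"
proof (rule linearI)
  fix x y :: "'g vec"
  let ?B = "Poly_Mapping.keys x \<union> Poly_Mapping.keys y"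
  show "coxeter_form G u (x + y) = coxeter_form G u x + coxeter_form G u y"
    using Poly_Mapping.keys_add[of x y]
    by (simp add: coxeter_form_expand[of "Poly_Mapping.keys u" ?B] lookup_add algebra_simps
        sum.distrib sum_subtractf sum_negf)
next
  fix c :: real and x :: "'g vec"
  have "Poly_Mapping.keys (c *\<^sub>R x) \<subseteq> Poly_Mapping.keys x" by (auto simp: in_keys_iff)
  thus "coxeter_form G u (c *\<^sub>R x) = c *\<^sub>R coxeter_form G u x"
    by (simp add: coxeter_form_expand[of "Poly_Mapping.keys u" "Poly_Mapping.keys x"]
        sum_distrib_left algebra_simps sum_negf)
qed

lemma linear_coxeter_form_left: "linear (\<lambda>u. coxeter_form (G :: 'g monoid) u v)"
proof (rule linearI)
  fix x y :: "'g vec"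
  let ?B = "Poly_Mapping.keys x \<union> Poly_Mapping.keys y"
  show "coxeter_form G (x + y) v = coxeter_form G x v + coxeter_form G y v"
    using Poly_Mapping.keys_add[of x y]
    by (simp add: coxeter_form_expand[of ?B "Poly_Mapping.keys v"] lookup_add algebra_simps
        sum.distrib sum_subtractf sum_negf)
next
  fix c :: real and x :: "'g vec"
  have "Poly_Mapping.keys (c *\<^sub>R x) \<subseteq> Poly_Mapping.keys x" by (auto simp: in_keys_iff)
  thus "coxeter_form G (c *\<^sub>R x) v = c *\<^sub>R coxeter_form G x v"
    by (simp add: coxeter_form_expand[of "Poly_Mapping.keys x" "Poly_Mapping.keys v"]
        sum_distrib_left algebra_simps sum_negf)
qed

lemmas coxeter_form_simps =
  linear_add[OF linear_coxeter_form] linear_diff[OF linear_coxeter_form]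
  linear_scale[OF linear_coxeter_form] linear_0[OF linear_coxeter_form]
  linear_neg[OF linear_coxeter_form]
  linear_add[OF linear_coxeter_form_left] linear_diff[OF linear_coxeter_form_left]
  linear_scale[OF linear_coxeter_form_left] linear_0[OF linear_coxeter_form_left]
  linear_neg[OF linear_coxeter_form_left]

text \<open>Bilinearity reduces the comparison to generators, in the second argument and then in the
  first. It serves the maps that change the group: the embedding of an induced quadruple and the map
  of an isomorphism.\<close>

lemma coxeter_form_eq_on_span:
  assumes f: "linear f" and "\<And>x y. x \<in> A \<Longrightarrow> y \<in> A \<Longrightarrow> coxeter_form H (f x) (f y) = coxeter_form G x y"
    and u: "u \<in> span A" and v: "v \<in> span A"
  shows "coxeter_form H (f u) (f v) = coxeter_form G u v"
proof -
  have "coxeter_form H (f x) (f v) = coxeter_form G x v" if "x \<in> A" for x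
    by (rule linear_eq_on[OF linear_compose[OF f linear_coxeter_form, unfolded comp_def]
          linear_coxeter_form v]) (rule assms(2)[OF that])
  thus ?thesis
    by (rule linear_eq_on[OF linear_compose[OF f linear_coxeter_form_left, unfolded comp_def]
          linear_coxeter_form_left u])
qed

lemma coxeter_form_simple_roots:
  "coxeter_form G (simple_root s) (simple_root t) = - cos (pi / real (group.ord G (s \<otimes>\<^bsub>G\<^esub> t)))"
  by (simp add: coxeter_form_def lookup_simple_root)

lemma linear_simple_reflection: "linear (simple_reflection G s)"
  by (rule linearI) (auto simp: simple_reflection_def coxeter_form_simps algebra_simps)

lemma word_action_Nil [simp]: "word_action G [] v = v"
  and word_action_Cons [simp]: "word_action G (s # w) v = simple_reflection G s (word_action G w v)"
  and word_action_append [simp]: "word_action G (u @ w) v = word_action G u (word_action G w v)"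
  by (simp_all add: word_action_def)

lemma linear_word_action: "linear (word_action G w)"
proof (induction w)
  case Nil
  show ?case by (rule linearI) auto
next
  case (Cons s w)
  show ?case
    using linear_compose[OF Cons linear_simple_reflection[of G s]] by (simp add: comp_def)
qed

lemmas word_action_simps =
  linear_add[OF linear_word_action] linear_diff[OF linear_word_action]
  linear_scale[OF linear_word_action] linear_0[OF linear_word_action]
  linear_neg[OF linear_word_action]

definition nonneg :: "'g vec \<Rightarrow> bool" where
  "nonneg v \<longleftrightarrow> (\<forall>x. 0 \<le> Poly_Mapping.lookup v x)"

lemma nonneg_simple_root [simp]: "nonneg (simple_root s)"
  by (simp add: nonneg_def lookup_simple_root)

lemma nonneg_add: "nonneg u \<Longrightarrow> nonneg v \<Longrightarrow> nonneg (u + v)"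
  by (simp add: nonneg_def lookup_add)

lemma nonneg_scale: "0 \<le> c \<Longrightarrow> nonneg v \<Longrightarrow> nonneg (c *\<^sub>R v)"
  by (simp add: nonneg_def)

lemma nonneg_antisym: "nonneg v \<Longrightarrow> nonneg (- v) \<Longrightarrow> v = 0"
  by (auto simp: nonneg_def intro!: poly_mapping_eqI) (meson antisym neg_0_le_iff_le)

text \<open>
  The values \<open>sin (k \<theta>) / sin \<theta>\<close> for \<open>c = cos \<theta>\<close>, in a form that also covers \<open>\<theta> = 0\<close>.
  They are the coefficients of the roots of a dihedral subsystem.
\<close>

fun dihedral_coeff :: "real \<Rightarrow> nat \<Rightarrow> real" where
  "dihedral_coeff c 0 = 0"
| "dihedral_coeff c (Suc 0) = 1"
| "dihedral_coeff c (Suc (Suc k)) = 2 * c * dihedral_coeff c (Suc k) - dihedral_coeff c k"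

text \<open>Multiplied out instead of divided, the identity stays true when
  \<open>sin \<theta>\<close> vanishes. The recursion is the addition theorem applied to the angles
  \<open>(k + 2) \<theta>\<close> and \<open>k \<theta>\<close>.\<close>

lemma sin_mult_dihedral_coeff: "sin \<theta> * dihedral_coeff (cos \<theta>) k = sin (real k * \<theta>)"
proof (induction "cos \<theta>" k rule: dihedral_coeff.induct)
  case (3 k)
  have "sin (real (Suc (Suc k)) * \<theta>) + sin (real k * \<theta>) = 2 * cos \<theta> * sin (real (Suc k) * \<theta>)"
    using sin_add[of "real (Suc k) * \<theta>" \<theta>] sin_diff[of "real (Suc k) * \<theta>" \<theta>]
    by (simp add: algebra_simps)
  thus ?case using 3 by (simp add: algebra_simps)
qed auto

lemma dihedral_coeff_1: "dihedral_coeff 1 k = real k"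
  by (induction "1::real" k rule: dihedral_coeff.induct) auto

text \<open>Here \<open>m = 0\<close> stands for infinite order: then \<open>pi / 0 = 0\<close>, the
  cosine is 1 and the coefficient is \<open>k\<close>. For finite \<open>m\<close> the angle
  \<open>k pi / m\<close> is at most \<open>pi\<close>, and \<open>m \<noteq> 1\<close> makes
  \<open>sin (pi / m)\<close> positive, so that one may divide by it.\<close>

lemma dihedral_coeff_nonneg:
  assumes "m = 0 \<or> k \<le> m" "m \<noteq> 1"
  shows "0 \<le> dihedral_coeff (cos (pi / real m)) k"
proof (cases "m = 0")
  case False
  hence m: "m \<ge> 2" "k \<le> m" using assms by auto
  have "0 < sin (pi / real m)" using m by (intro sin_gt_zero) (auto simp: field_simps)
  moreover have "0 \<le> sin (real k * (pi / real m))"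
    using m by (intro sin_ge_zero) (auto simp: field_simps)
  ultimately show ?thesis
    unfolding sin_mult_dihedral_coeff[symmetric] by (simp add: zero_le_mult_iff)
qed (simp add: dihedral_coeff_1)

text \<open>The word grows at its right end, so a nonempty one ends in \<open>s\<close> whatever its
  length; the first letter depends on the parity.\<close>

fun alternating :: "nat \<Rightarrow> 'a \<Rightarrow> 'a \<Rightarrow> 'a list" where
  "alternating 0 s t = []"
| "alternating (Suc k) s t = alternating k t s @ [s]"

lemma length_alternating [simp]: "length (alternating k s t) = k"
  by (induction k arbitrary: s t) auto

lemma alternating_Suc: "alternating (Suc k) s t = (if even k then s else t) # alternating k s t"
proof (induction k arbitrary: s t)
  case (Suc k)
  show ?case by (subst alternating.simps(2), subst Suc) auto
qed simp

lemma alternating_add: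
  "\<exists>u. length u = j \<and> set u \<subseteq> {s, t} \<and> alternating (j + k) s t = u @ alternating k s t"
proof (induction j)
  case (Suc j)
  then obtain u where u: "length u = j" "set u \<subseteq> {s, t}" "alternating (j + k) s t = u @ alternating k s t"
    by blast
  show ?case
    by (rule exI[of _ "(if even (j + k) then s else t) # u"])
      (use u in \<open>simp add: alternating_Suc del: alternating.simps\<close>)
qed auto

lemma concat_replicate_alternating: "concat (replicate m [s, t]) = alternating (2 * m) t s"
proof (induction m)
  case (Suc m)
  have "concat (replicate (Suc m) [s, t]) = concat (replicate m [s, t]) @ [s, t]"
    by (simp only: replicate_Suc flip: replicate_append_same) simp
  thus ?case using Suc by simp
qed simp

lemma set_concat_replicate: "set (concat (replicate m [s, t])) \<subseteq> {s, t}"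
  by (induction m) auto

lemma rev_concat_replicate: "rev (concat (replicate m [s, t])) = concat (replicate m [t, s])"
  by (simp add: rev_concat)

section \<open>Groups with distinguished involutions\<close>

lemma word_prod_Nil [simp]: "word_prod G [] = \<one>\<^bsub>G\<^esub>"
  and word_prod_Cons [simp]: "word_prod G (s # w) = s \<otimes>\<^bsub>G\<^esub> word_prod G w"
  by (simp_all add: word_prod_def)

lemma word_prod_closed:
  assumes "group G" "set w \<subseteq> carrier G"
  shows "word_prod G w \<in> carrier G"
  using assms(2) by (induction w) (auto intro: monoid.m_closed[OF group.is_monoid[OF assms(1)]] monoid.one_closed[OF group.is_monoid[OF assms(1)]])

lemma word_prod_append:
  assumes "group G" "set u \<subseteq> carrier G" "set w \<subseteq> carrier G"
  shows "word_prod G (u @ w) = word_prod G u \<otimes>\<^bsub>G\<^esub> word_prod G w"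
proof -
  interpret group G by fact
  show ?thesis using assms(2,3)
    by (induction u) (auto simp: m_assoc word_prod_closed is_group)
qed

lemma (in group) ord_eq_2:
  assumes "x \<in> carrier G" "x \<otimes> x = \<one>" "x \<noteq> \<one>"
  shows "ord x = 2"
proof -
  have "ord x dvd 2" using assms pow_eq_id[of x 2] by (simp add: numeral_2_eq_2)
  hence "ord x \<le> 2" "ord x \<noteq> 0"
    by (simp add: dvd_imp_le, metis dvd_0_left_iff zero_neq_numeral)
  thus ?thesis using ord_eq_1 assms by (metis One_nat_def le_neq_implies_less less_2_cases)
qed

text \<open>A Coxeter system stripped of generation and presentation. The reflections of an induced
  quadruple form such a system from the outset, and the presentation of their group is derived from
  the theory developed here.\<close>

locale involution_system = group G for G :: "'g monoid" (structure) and S +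
  assumes S_carrier: "S \<subseteq> carrier G"
    and S_involution: "s \<in> S \<Longrightarrow> s \<otimes> s = \<one>"
    and S_ne_one: "s \<in> S \<Longrightarrow> s \<noteq> \<one>"
begin

lemmas [simp] = word_prod_closed[OF is_group] word_prod_append[OF is_group]

abbreviation V where "V \<equiv> span (simple_root ` S)"

lemma in_carrier [intro]: "s \<in> S \<Longrightarrow> s \<in> carrier G"
  using S_carrier by blast

lemma lists_carrier: "w \<in> lists S \<Longrightarrow> set w \<subseteq> carrier G"
  using S_carrier by auto

lemma inv_S: "s \<in> S \<Longrightarrow> inv s = s"
  using S_involution in_carrier inv_equality by blast

lemma ord_commute:
  assumes "s \<in> S" "t \<in> S"
  shows "ord (s \<otimes> t) = ord (t \<otimes> s)"
proof -
  have "inv (s \<otimes> t) = t \<otimes> s" using assms by (simp add: inv_mult_group in_carrier inv_S)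
  thus ?thesis using ord_inv[of "s \<otimes> t"] assms in_carrier by simp
qed

lemma ord_ne_1:
  assumes "s \<in> S" "t \<in> S" "s \<noteq> t"
  shows "ord (s \<otimes> t) \<noteq> 1"
  using assms ord_eq_1[of "s \<otimes> t"] inv_equality[of s t] inv_S in_carrier by (metis m_closed)

lemma form_self: "s \<in> S \<Longrightarrow> coxeter_form G (simple_root s) (simple_root s) = 1"
  by (simp add: coxeter_form_simple_roots S_involution)

text \<open>For generators, \<open>t \<otimes> s\<close> is the inverse of
  \<open>s \<otimes> t\<close> and so has the same order; vectors of \<open>V\<close> have their
  supports among the generators.\<close>

lemma form_commute:
  assumes "u \<in> V" "v \<in> V"
  shows "coxeter_form G u v = coxeter_form G v u"
proof -
  have "coxeter_form G u v = (\<Sum>s\<in>Poly_Mapping.keys u. \<Sum>t\<in>Poly_Mapping.keys v.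
      Poly_Mapping.lookup v t * Poly_Mapping.lookup u s * (- cos (pi / real (ord (t \<otimes> s)))))"
    unfolding coxeter_form_def
    by (intro sum.cong refl) (use assms ord_commute in \<open>auto simp: span_simple_roots subset_iff\<close>)
  thus ?thesis unfolding coxeter_form_def by (subst sum.swap)
qed

lemma simple_root_in_V: "s \<in> S \<Longrightarrow> simple_root s \<in> V"
  by (simp add: span_base)

lemma reflection_in_V: "s \<in> S \<Longrightarrow> v \<in> V \<Longrightarrow> simple_reflection G s v \<in> V"
  by (auto simp: simple_reflection_def intro!: span_diff span_scale simple_root_in_V)

lemma word_action_in_V: "w \<in> lists S \<Longrightarrow> v \<in> V \<Longrightarrow> word_action G w v \<in> V"
  by (induction w) (auto intro: reflection_in_V)

lemma reflection_involutive: "s \<in> S \<Longrightarrow> simple_reflection G s (simple_reflection G s v) = v"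
  by (rule poly_mapping_eqI)
    (simp add: simple_reflection_def coxeter_form_simps form_self lookup_minus algebra_simps)

lemma reflection_simple_root: "s \<in> S \<Longrightarrow> simple_reflection G s (simple_root s) = - simple_root s"
  by (simp add: simple_reflection_def form_self scaleR_2)

lemma reflection_isometry:
  assumes "s \<in> S" "u \<in> V" "v \<in> V"
  shows "coxeter_form G (simple_reflection G s u) (simple_reflection G s v) = coxeter_form G u v"
  using form_commute[OF assms(2) simple_root_in_V[OF assms(1)]]
  by (simp add: simple_reflection_def coxeter_form_simps form_self assms(1) algebra_simps)

lemma word_action_isometry:
  "w \<in> lists S \<Longrightarrow> u \<in> V \<Longrightarrow> v \<in> V \<Longrightarrow>
    coxeter_form G (word_action G w u) (word_action G w v) = coxeter_form G u v"
  by (induction w) (auto simp: reflection_isometry word_action_in_V)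

lemma word_action_rev: "w \<in> lists S \<Longrightarrow> word_action G (rev w) (word_action G w v) = v"
  by (induction w arbitrary: v) (auto simp: reflection_involutive)

subsection \<open>Dihedral subsystems\<close>

text \<open>Reflecting \<open>p x + q y\<close> in \<open>x\<close> replaces \<open>p\<close> by
  \<open>2 cos(pi / m) q - p\<close>, which is the recursion of \<open>dihedral_coeff\<close>. The
  parity of \<open>k\<close> tells which of the two coefficients was changed last.\<close>

lemma alternating_action:
  fixes s t
  defines "c \<equiv> dihedral_coeff (cos (pi / real (ord (s \<otimes> t))))"
  assumes "s \<in> S" "t \<in> S"
  shows "word_action G (alternating k t s) (simple_root s) =
    (if even k then c (Suc k) *\<^sub>R simple_root s + c k *\<^sub>R simple_root t
     else c k *\<^sub>R simple_root s + c (Suc k) *\<^sub>R simple_root t)"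
proof (induction k)
  case (Suc k)
  have st: "simple_reflection G x (p *\<^sub>R simple_root x + q *\<^sub>R simple_root y) =
      (2 * cos (pi / real (ord (s \<otimes> t))) * q - p) *\<^sub>R simple_root x + q *\<^sub>R simple_root y"
    if "x = s \<and> y = t \<or> x = t \<and> y = s" for x y p q
  proof (rule poly_mapping_eqI)
    fix z
    have "x \<in> S" "coxeter_form G (simple_root x) (simple_root y) = - cos (pi / real (ord (s \<otimes> t)))"
      using that assms ord_commute[of s t] by (auto simp: coxeter_form_simple_roots)
    thus "Poly_Mapping.lookup (simple_reflection G x (p *\<^sub>R simple_root x + q *\<^sub>R simple_root y)) z =
        Poly_Mapping.lookup ((2 * cos (pi / real (ord (s \<otimes> t))) * q - p) *\<^sub>R simple_root x
          + q *\<^sub>R simple_root y) z"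
      by (simp add: simple_reflection_def coxeter_form_simps form_self lookup_add lookup_minus algebra_simps)
  qed
  show ?case
    using Suc st[of s t "c k" "c (Suc k)"] st[of t s "c k" "c (Suc k)"]
    by (simp add: alternating_Suc c_def add.commute del: alternating.simps)
qed (auto simp: c_def)

text \<open>For \<open>\<theta> = pi / m\<close> the two coefficients are
  \<open>sin (2 pi) / sin \<theta> = 0\<close> and
  \<open>sin (2 pi + \<theta>) / sin \<theta> = 1\<close>.\<close>

lemma dihedral_relation_on_root:
  assumes st: "s \<in> S" "t \<in> S" "s \<noteq> t" and m: "ord (s \<otimes> t) \<noteq> 0"
  shows "word_action G (alternating (2 * ord (s \<otimes> t)) t s) (simple_root s) = simple_root s"
proof -
  define m where "m = ord (s \<otimes> t)"
  define \<theta> where "\<theta> = pi / real m"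
  have m: "m \<ge> 2" using m ord_ne_1[OF st] by (simp add: m_def)
  have pos: "sin \<theta> > 0" unfolding \<theta>_def using m by (intro sin_gt_zero) (auto simp: field_simps)
  have 1: "real (2 * m) * \<theta> = 2 * pi" using m by (simp add: \<theta>_def)
  have "sin \<theta> * dihedral_coeff (cos \<theta>) (2 * m) = 0"
    unfolding sin_mult_dihedral_coeff 1 by simp
  moreover have "real (Suc (2 * m)) * \<theta> = \<theta> + 2 * pi" using 1 by (simp add: algebra_simps)
  hence "sin \<theta> * dihedral_coeff (cos \<theta>) (Suc (2 * m)) = sin \<theta>"
    unfolding sin_mult_dihedral_coeff by simp
  ultimately show ?thesis
    using pos alternating_action[OF st(1,2), of "2 * m"] unfolding m_def[symmetric] \<theta>_def[symmetric]
    by simp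
qed

text \<open>In the essential case, distinct letters with a product of finite order, the form is
  nondegenerate on the plane of the two simple roots. So \<open>v\<close> splits into a vector of
  this plane and one orthogonal to both roots, and the latter is fixed by each letter.\<close>

lemma dihedral_relation:
  assumes st: "s \<in> S" "t \<in> S"
  shows "word_action G (concat (replicate (ord (s \<otimes> t)) [s, t])) v = v"
proof -
  define m where "m = ord (s \<otimes> t)"
  consider "s = t" | "m = 0" | "s \<noteq> t" "m \<noteq> 0" by blast
  thus ?thesis
  proof cases
    case 1
    thus ?thesis using st by (simp add: S_involution reflection_involutive)
  next
    case 3
    define w where "w = concat (replicate m [s, t])"
    have wst: "set w \<subseteq> {s, t}" unfolding w_def by (rule set_concat_replicate)
    hence w: "w \<in> lists S" using st by auto
    have fix_s: "word_action G w (simple_root s) = simple_root s"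
      using dihedral_relation_on_root[OF st 3(1)] 3(2)
      by (simp add: w_def m_def concat_replicate_alternating)
    \<comment> \<open>The computation for \<open>simple_root s\<close> applies to
      \<open>simple_root t\<close> and the reversed word, in which the letters change roles.\<close>
    have "rev w = alternating (2 * m) s t"
      by (metis w_def rev_concat_replicate concat_replicate_alternating)
    hence "word_action G (rev w) (simple_root t) = simple_root t"
      using dihedral_relation_on_root[OF st(2,1)] 3 ord_commute[OF st] by (simp add: m_def)
    hence fix_t: "word_action G w (simple_root t) = simple_root t"
      using word_action_rev[of "rev w" "simple_root t"] w
      by (metis in_lists_conv_set rev_rev_ident set_rev)
    have fix_orth: "word_action G w u = u"
      if "coxeter_form G (simple_root s) u = 0" "coxeter_form G (simple_root t) u = 0" for u
      using wst by (induction w) (auto simp: simple_reflection_def that)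
    define c where "c = cos (pi / real m)"
    have m: "m \<ge> 2" using 3 ord_ne_1[OF st] by (simp add: m_def)
    have "sin (pi / real m) > 0" using m by (intro sin_gt_zero) (auto simp: field_simps)
    hence d: "1 - c\<^sup>2 \<noteq> 0" using sin_squared_eq[of "pi / real m"] by (auto simp: c_def)
    have cst: "coxeter_form G (simple_root s) (simple_root t) = - c"
      "coxeter_form G (simple_root t) (simple_root s) = - c"
      using ord_commute[OF st] by (simp_all add: coxeter_form_simple_roots c_def m_def)
    define a where "a = coxeter_form G (simple_root s) v"
    define b where "b = coxeter_form G (simple_root t) v"
    \<comment> \<open>\<open>p\<close> and \<open>q\<close> are the coordinates of the component of
      \<open>v\<close> in the plane. They solve the linear system whose matrix has rows
      \<open>1, -c\<close> and \<open>-c, 1\<close>, with determinant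
      \<open>1 - c^2\<close>.\<close>
    define p where "p = (a + c * b) / (1 - c\<^sup>2)"
    define q where "q = (b + c * a) / (1 - c\<^sup>2)"
    have "p - c * q = ((a + c * b) - c * (b + c * a)) / (1 - c\<^sup>2)"
      "q - c * p = ((b + c * a) - c * (a + c * b)) / (1 - c\<^sup>2)"
      by (simp_all add: p_def q_def diff_divide_distrib)
    hence pq: "a = p - c * q" "b = q - c * p"
      using d nonzero_mult_div_cancel_right[OF d, of a] nonzero_mult_div_cancel_right[OF d, of b]
      by (simp_all add: power2_eq_square right_diff_distrib distrib_left mult_ac)
    define u where "u = v - (p *\<^sub>R simple_root s + q *\<^sub>R simple_root t)"
    have "word_action G w u = u"
      by (rule fix_orth)
        (use pq in \<open>simp_all add: u_def coxeter_form_simps form_self st cst flip: a_def b_def\<close>)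
    moreover have "v = u + (p *\<^sub>R simple_root s + q *\<^sub>R simple_root t)" by (simp add: u_def)
    ultimately show ?thesis
      using fix_s fix_t by (simp add: w_def m_def word_action_simps)
  qed (simp add: m_def)
qed

section \<open>Words modulo the Coxeter relations\<close>

abbreviation cong (infix "\<doteq>" 50) where "u \<doteq> v \<equiv> coxeter_congruent G S u v"

lemma cong_lists: "u \<doteq> v \<Longrightarrow> u \<in> lists S \<and> v \<in> lists S"
proof (induction rule: coxeter_congruent.induct)
  case (relation s t u v)
  thus ?case using set_concat_replicate[of "ord (s \<otimes> t)" s t] by auto
qed auto

lemma cong_context:
  assumes "u \<doteq> v" "a \<in> lists S" "b \<in> lists S"
  shows "a @ u @ b \<doteq> a @ v @ b"
  using assms(1)
proof (induction rule: coxeter_congruent.induct)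
  case (relation s t u v)
  thus ?case
    using coxeter_congruent.relation[of s S t "a @ u" "v @ b" G] assms(2,3) by simp
next
  case (refl u)
  thus ?case by (intro coxeter_congruent.refl) (use assms(2,3) in auto)
next
  case (sym u v)
  show ?case by (rule coxeter_congruent.sym[OF sym.IH])
next
  case (trans u v w)
  show ?case by (rule coxeter_congruent.trans[OF trans.IH])
qed

lemma cong_append: "u \<doteq> u' \<Longrightarrow> v \<doteq> v' \<Longrightarrow> u @ v \<doteq> u' @ v'"
  using cong_context[of u u' "[]" v] cong_context[of v v' u' "[]"]
  by (metis append.left_neutral append.right_neutral cong_lists coxeter_congruent.trans lists.Nil)

lemma cong_square: "s \<in> S \<Longrightarrow> [s, s] \<doteq> []"
  using coxeter_congruent.relation[of s S s "[]" "[]" G] by (simp add: S_involution)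

lemma cong_rev: "w \<in> lists S \<Longrightarrow> rev w @ w \<doteq> []"
proof (induction w)
  case (Cons s w)
  hence "rev w @ [s, s] @ w \<doteq> rev w @ [] @ w"
    by (intro cong_context cong_square) auto
  from coxeter_congruent.trans[OF this] show ?case using Cons by simp
qed (auto intro: coxeter_congruent.refl)

text \<open>Each relator is a power of \<open>[s, t]\<close>, hence of even length. Parity is the
  sign character of the abstract Coxeter group.\<close>

lemma cong_parity: "u \<doteq> v \<Longrightarrow> even (length u) \<longleftrightarrow> even (length v)"
proof (induction rule: coxeter_congruent.induct)
  case (relation s t u v)
  show ?case by (simp add: concat_replicate_alternating)
qed auto

text \<open>Here the dihedral relations enter: the abstract Coxeter group acts, whatever the
  relations in \<open>G\<close> itself are.\<close>

lemma cong_action: "u \<doteq> v \<Longrightarrow> word_action G u = word_action G v"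
proof (induction rule: coxeter_congruent.induct)
  case (relation s t u v)
  thus ?case by (auto simp: dihedral_relation fun_eq_iff)
qed auto

lemma cong_word_prod: "u \<doteq> v \<Longrightarrow> word_prod G u = word_prod G v"
proof (induction rule: coxeter_congruent.induct)
  case (relation s t u v)
  hence st: "s \<in> carrier G" "t \<in> carrier G" by auto
  have "word_prod G (concat (replicate n [s, t])) = (s \<otimes> t) [^] n" for n
  proof (induction n)
    case (Suc n)
    have "(s \<otimes> t) [^] Suc n = (s \<otimes> t) \<otimes> (s \<otimes> t) [^] n" using st by (intro nat_pow_Suc2) simp
    thus ?case using Suc st by (simp add: m_assoc)
  qed simp
  hence "word_prod G (concat (replicate (ord (s \<otimes> t)) [s, t])) = \<one>" using st by simp
  moreover have "set (concat (replicate (ord (s \<otimes> t)) [s, t])) \<subseteq> carrier G" using st by auto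
  ultimately show ?case using relation(3,4)[THEN lists_carrier] by simp
qed auto

text \<open>Length is minimised over the congruence class, that is, in the abstract Coxeter group,
  and not over all words with the same product in \<open>G\<close>. The two notions agree once
  \<open>G\<close> is known to be presented by the relations.\<close>

definition reduced where
  "reduced w \<longleftrightarrow> w \<in> lists S \<and> (\<forall>v. w \<doteq> v \<longrightarrow> length w \<le> length v)"

lemma reduced_lists: "reduced w \<Longrightarrow> w \<in> lists S"
  by (simp add: reduced_def)

lemma reduced_le: "reduced w \<Longrightarrow> w \<doteq> v \<Longrightarrow> length w \<le> length v"
  by (simp add: reduced_def)

lemma reduced_ex: "w \<in> lists S \<Longrightarrow> \<exists>v. w \<doteq> v \<and> reduced v"
proof -
  assume w: "w \<in> lists S"
  then obtain v where "w \<doteq> v" "\<forall>u. w \<doteq> u \<longrightarrow> length v \<le> length u"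
    using ex_has_least_nat[of "\<lambda>v. w \<doteq> v" w length] coxeter_congruent.refl by metis
  thus ?thesis unfolding reduced_def using cong_lists by (meson coxeter_congruent.trans)
qed

lemma reduced_cong: "reduced u \<Longrightarrow> u \<doteq> v \<Longrightarrow> length v \<le> length u \<Longrightarrow> reduced v"
  unfolding reduced_def using cong_lists by (meson coxeter_congruent.trans le_trans)

lemma reduced_middle:
  assumes "reduced (a @ w @ b)"
  shows "reduced w"
proof -
  have l: "a \<in> lists S" "w \<in> lists S" "b \<in> lists S" using reduced_lists[OF assms] by auto
  have "length w \<le> length v" if "w \<doteq> v" for v
    using reduced_le[OF assms cong_context[OF that l(1,3)]] by simp
  thus ?thesis using l by (simp add: reduced_def)
qed

lemma reduced_prefix: "reduced (w @ b) \<Longrightarrow> reduced w"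
  using reduced_middle[of "[]" w b] by simp

lemma reduced_suffix: "reduced (a @ w) \<Longrightarrow> reduced w"
  using reduced_middle[of a w "[]"] by simp

lemma reduced_no_square: "\<not> reduced (a @ [s, s] @ b)"
proof
  assume r: "reduced (a @ [s, s] @ b)"
  hence "reduced [s, s]" by (rule reduced_middle)
  thus False using reduced_le[of "[s, s]" "[]"] cong_square[of s] reduced_lists[of "[s, s]"] by simp
qed

text \<open>\<open>w @ [s]\<close> is congruent to a shorter \<open>v\<close>, and parity excludes
  that \<open>v\<close> is as long as \<open>w\<close>. So \<open>v\<close> is shorter than
  \<open>w\<close>, and appending \<open>s\<close> again leads back to \<open>w\<close>.\<close>

lemma descent:
  assumes w: "reduced w" and s: "s \<in> S" and n: "\<not> reduced (w @ [s])"
  shows "\<exists>v. w \<doteq> v @ [s] \<and> Suc (length v) = length w \<and> reduced (v @ [s])"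
proof -
  have "w \<in> lists S" using w by (rule reduced_lists)
  then obtain v where v: "w @ [s] \<doteq> v" "length v < Suc (length w)"
    using n s unfolding reduced_def by (auto simp: not_le)
  have "length v \<noteq> length w" using cong_parity[OF v(1)] by auto
  hence lv: "length v < length w" using v(2) by simp
  have "w @ [s, s] \<doteq> w @ []"
    using \<open>w \<in> lists S\<close> s by (intro cong_append cong_square) (auto intro: coxeter_congruent.refl)
  moreover have "(w @ [s]) @ [s] \<doteq> v @ [s]"
    using v s by (intro cong_append) (auto intro: coxeter_congruent.refl)
  ultimately have *: "w \<doteq> v @ [s]"
    by (simp, meson coxeter_congruent.sym coxeter_congruent.trans)
  show ?thesis
    using * reduced_le[OF w *] lv reduced_cong[OF w *] by auto
qed

text \<open>Two equal adjacent letters would cancel, so the letters of a reduced word in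
  \<open>s\<close> and \<open>t\<close> must alternate.\<close>

lemma reduced_alternating:
  "\<lbrakk>reduced (b @ [s]); set b \<subseteq> {s, t}\<rbrakk> \<Longrightarrow> b @ [s] = alternating (Suc (length b)) s t"
proof (induction b arbitrary: s t rule: rev_induct)
  case (snoc x b)
  have "x \<noteq> s" using snoc.prems(1) reduced_no_square[of b s "[]"] by auto
  hence x: "x = t" using snoc.prems(2) by auto
  have "reduced (b @ [t])" using snoc.prems(1) reduced_prefix x by blast
  hence "b @ [t] = alternating (Suc (length b)) t s"
    using snoc.IH[of t s] snoc.prems(2) by auto
  thus ?case using x by simp
qed simp

text \<open>A part of a relator is congruent to the inverse of the rest. In the relator of length
  \<open>2 m\<close>, the suffix of length \<open>m + 1\<close> is thus congruent to the reverse of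
  the other \<open>m - 1\<close> letters, which is shorter; and every longer alternating word has
  such a suffix.\<close>

lemma alternating_not_reduced:
  assumes st: "s \<in> S" "t \<in> S" and m: "ord (s \<otimes> t) \<noteq> 0" "ord (s \<otimes> t) < k"
  shows "\<not> reduced (alternating k s t)"
proof
  assume r: "reduced (alternating k s t)"
  define m where "m = ord (s \<otimes> t)"
  have m1: "m \<ge> 1" using m by (simp add: m_def)
  obtain u where "alternating ((k - Suc m) + Suc m) s t = u @ alternating (Suc m) s t"
    using alternating_add[of "k - Suc m" s t "Suc m"] by metis
  hence r: "reduced (alternating (Suc m) s t)" using r m reduced_suffix by (simp add: m_def)
  obtain x where x: "length x = m - 1" "set x \<subseteq> {s, t}"
    "alternating ((m - 1) + Suc m) s t = x @ alternating (Suc m) s t"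
    using alternating_add[of "m - 1" s t "Suc m"] by metis
  have "(m - 1) + Suc m = 2 * m" using m1 by simp
  hence eq: "x @ alternating (Suc m) s t = concat (replicate m [t, s])"
    using x(3) by (simp only: concat_replicate_alternating)
  have l: "x \<in> lists S" "alternating (Suc m) s t \<in> lists S"
    using x(2) st reduced_lists[OF r] by auto
  have "x @ alternating (Suc m) s t \<doteq> []"
    using coxeter_congruent.relation[of t S s "[]" "[]" G] st ord_commute[OF st] eq by (simp add: m_def)
  hence "rev x @ (x @ alternating (Suc m) s t) \<doteq> rev x @ []"
    using l by (intro cong_append) (auto intro: coxeter_congruent.refl)
  moreover have "(rev x @ x) @ alternating (Suc m) s t \<doteq> [] @ alternating (Suc m) s t"
    using l by (intro cong_append cong_rev coxeter_congruent.refl)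
  ultimately have "alternating (Suc m) s t \<doteq> rev x"
    by (metis append.left_neutral append.right_neutral append_assoc coxeter_congruent.sym coxeter_congruent.trans)
  from reduced_le[OF r this] show False using x(1) by simp
qed

text \<open>
  The theorem of Tits. Splitting off from \<open>w\<close> a maximal suffix in the two letters \<open>s\<close>, \<open>t\<close>, where \<open>t\<close> is
  the last letter of \<open>w\<close>, reduces it to a dihedral computation.
\<close>

theorem reduced_root_nonneg:
  assumes "reduced (w @ [s])"
  shows "nonneg (word_action G w (simple_root s))"
  using assms
proof (induction "length w" arbitrary: w s rule: less_induct)
  case less
  note red = less.prems
  show ?case
  proof (cases w rule: rev_cases)
    case (snoc w' t)
    have wl: "w \<in> lists S" and s: "s \<in> S" and t: "t \<in> S"
      using reduced_lists[OF red] snoc by auto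
    have rw: "reduced w" using red reduced_prefix by blast
    have ts: "t \<noteq> s" using reduced_no_square[of w' s "[]"] red snoc by auto
    \<comment> \<open>A shortest \<open>v\<close> with \<open>P v\<close> plays the role of the
      minimal representative of the coset of \<open>w\<close> modulo the subgroup of
      \<open>s\<close> and \<open>t\<close>. The choice \<open>w'\<close> with
      \<open>a = [t]\<close> shows that there is one shorter than \<open>w\<close>.\<close>
    define P where "P v \<longleftrightarrow> (\<exists>a. w \<doteq> v @ a \<and> length v + length a = length w \<and> set a \<subseteq> {s, t})" for v
    have "P w'" unfolding P_def using snoc coxeter_congruent.refl[OF wl] by (intro exI[of _ "[t]"]) auto
    then obtain v where v: "P v" "\<And>v'. P v' \<Longrightarrow> length v \<le> length v'"
      using ex_has_least_nat[of P w' length] by blast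
    obtain a where a: "w \<doteq> v @ a" "length v + length a = length w" "set a \<subseteq> {s, t}"
      using v(1) by (auto simp: P_def)
    have va: "reduced (v @ a)" using reduced_cong[OF rw a(1)] a(2) by simp
    have rv: "reduced v" and al: "a \<in> lists S" using reduced_prefix[OF va] reduced_lists[OF va] by auto
    have lv: "length v < length w" using v(2)[OF \<open>P w'\<close>] snoc by simp
    \<comment> \<open>Otherwise \<open>v\<close> could be rewritten with last letter
      \<open>x\<close>, and moving \<open>x\<close> over to \<open>a\<close> would contradict
      minimality. So the induction hypothesis applies to \<open>v\<close> followed by either
      letter.\<close>
    have ext: "reduced (v @ [x])" if x: "x \<in> {s, t}" for x
    proof (rule ccontr)
      assume "\<not> reduced (v @ [x])"
      then obtain u where u: "v \<doteq> u @ [x]" "Suc (length u) = length v"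
        using descent[OF rv] x s t by blast
      have "v @ a \<doteq> (u @ [x]) @ a" using u al by (intro cong_append) (auto intro: coxeter_congruent.refl)
      hence "w \<doteq> u @ (x # a)" using a(1) coxeter_congruent.trans by fastforce
      hence "P u" unfolding P_def using u(2) a x by (intro exI[of _ "x # a"]) auto
      thus False using v(2)[of u] u(2) by simp
    qed
    have nn: "nonneg (word_action G v (simple_root x))" if "x \<in> {s, t}" for x
      using less.hyps[OF lv ext[OF that]] .
    have "w @ [s] \<doteq> (v @ a) @ [s]"
      using a(1) s by (intro cong_append) (auto intro: coxeter_congruent.refl)
    from reduced_cong[OF red this] have "reduced (v @ (a @ [s]))" using a(2) by simp
    hence ras: "reduced (a @ [s])" using reduced_suffix by blast
    have as: "a @ [s] = alternating (Suc (length a)) s t"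
      by (rule reduced_alternating[OF ras a(3)])
    hence a_alt: "a = alternating (length a) t s" by simp
    \<comment> \<open>A reduced alternating word has at most \<open>ord (s \<otimes> t)\<close>
      letters if this order is finite; that is exactly the range in which the dihedral coefficients
      are known to be nonnegative.\<close>
    have "ord (s \<otimes> t) = 0 \<or> Suc (length a) \<le> ord (s \<otimes> t)"
      using alternating_not_reduced[OF s t] ras as by (metis not_le)
    hence nc: "0 \<le> dihedral_coeff (cos (pi / real (ord (s \<otimes> t)))) (length a)"
      "0 \<le> dihedral_coeff (cos (pi / real (ord (s \<otimes> t)))) (Suc (length a))"
      by (auto intro!: dihedral_coeff_nonneg[OF _ ord_ne_1[OF s t ts[symmetric]]])
    have "\<exists>p q. 0 \<le> p \<and> 0 \<le> q \<and>
        word_action G (alternating (length a) t s) (simple_root s) = p *\<^sub>R simple_root s + q *\<^sub>R simple_root t"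
      using alternating_action[OF s t, of "length a"] nc by metis
    then obtain p q where pq: "0 \<le> p" "0 \<le> q"
      "word_action G a (simple_root s) = p *\<^sub>R simple_root s + q *\<^sub>R simple_root t"
      using a_alt by metis
    have "word_action G w (simple_root s) =
        p *\<^sub>R word_action G v (simple_root s) + q *\<^sub>R word_action G v (simple_root t)"
      using cong_action[OF a(1)] pq(3) by (simp add: word_action_simps)
    thus ?thesis using pq nn by (auto intro!: nonneg_add nonneg_scale)
  qed simp
qed

text \<open>By \<open>descent\<close> the last letter of \<open>w\<close> can be taken to be
  \<open>s\<close>, which negates its own simple root. What remains is the root of a reduced
  word.\<close>

lemma not_reduced_root_nonpos:
  assumes w: "reduced w" and s: "s \<in> S" and n: "\<not> reduced (w @ [s])"
  shows "nonneg (- word_action G w (simple_root s))"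
proof -
  obtain v where v: "w \<doteq> v @ [s]" "reduced (v @ [s])" using descent[OF assms] by blast
  have "word_action G w (simple_root s) = - word_action G v (simple_root s)"
    using cong_action[OF v(1)] by (simp add: reflection_simple_root s word_action_simps)
  thus ?thesis using reduced_root_nonneg[OF v(2)] by simp
qed

lemma word_action_root_ne_0:
  assumes "w \<in> lists S"
  shows "word_action G w (simple_root s) \<noteq> 0"
  by (metis assms linear_0 linear_word_action simple_root_ne_0 word_action_rev)

lemma root_nonneg_or_nonpos:
  assumes "w \<in> lists S" "s \<in> S"
  shows "nonneg (word_action G w (simple_root s)) \<or> nonneg (- word_action G w (simple_root s))"
proof -
  obtain v where v: "w \<doteq> v" "reduced v" using reduced_ex assms by blast
  show ?thesis
    using reduced_root_nonneg[of v s] not_reduced_root_nonpos[OF v(2) assms(2)] cong_action[OF v(1)]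
    by metis
qed

lemma reduced_snoc:
  assumes "reduced w" "s \<in> S" "nonneg (word_action G w (simple_root s))"
  shows "reduced (w @ [s])"
  using assms not_reduced_root_nonpos nonneg_antisym word_action_root_ne_0 reduced_lists by blast

text \<open>Inversion criterion: a letter whose root is nonnegative lengthens a reduced word. This
  is how reducedness is established for induced quadruples.\<close>

lemma reduced_if_roots_nonneg:
  assumes "w \<in> lists S"
    and "\<And>k. k < length w \<Longrightarrow> nonneg (word_action G (take k w) (simple_root (w ! k)))"
  shows "reduced w"
  using assms
proof (induction w rule: rev_induct)
  case Nil
  thus ?case by (simp add: reduced_def)
next
  case (snoc s w)
  have "reduced w"
  proof (rule snoc.IH)
    fix k assume "k < length w"
    thus "nonneg (word_action G (take k w) (simple_root (w ! k)))"
      using snoc.prems(2)[of k] by (simp add: nth_append)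
  qed (use snoc.prems in auto)
  thus ?case using snoc.prems(2)[of "length w"] snoc.prems(1) by (intro reduced_snoc) auto
qed

lemma roots_nonneg_if_reduced:
  assumes "reduced w" "k < length w"
  shows "nonneg (word_action G (take k w) (simple_root (w ! k)))"
proof (rule reduced_root_nonneg)
  have "w = (take k w @ [w ! k]) @ drop (Suc k) w" using assms(2) by (simp add: id_take_nth_drop)
  thus "reduced (take k w @ [w ! k])" using assms(1) reduced_prefix by metis
qed

text \<open>A nonempty reduced word sends the simple root of its last letter to a nonpositive
  vector, so it cannot act trivially. The conclusion is a congruence and not an equation in
  \<open>G\<close>, which is what a presentation asks for.\<close>

lemma faithful:
  assumes w: "w \<in> lists S" and triv: "\<And>s. s \<in> S \<Longrightarrow> word_action G w (simple_root s) = simple_root s"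
  shows "w \<doteq> []"
proof -
  obtain v where v: "w \<doteq> v" "reduced v" using reduced_ex w by blast
  have "v = []"
  proof (cases v rule: rev_cases)
    case (snoc u s)
    have s: "s \<in> S" using reduced_lists[OF v(2)] snoc by simp
    have "simple_root s = - word_action G u (simple_root s)"
      using triv[OF s] cong_action[OF v(1)] snoc by (simp add: reflection_simple_root s word_action_simps)
    moreover have "nonneg (word_action G u (simple_root s))"
      using reduced_root_nonneg v(2) snoc by simp
    ultimately have "nonneg (- simple_root s)" by (metis minus_minus)
    thus ?thesis using nonneg_antisym[OF nonneg_simple_root, of s] by (metis simple_root_ne_0)
  qed simp
  thus ?thesis using v by simp
qed

end

section \<open>Lists of positions\<close>

text \<open>Subwords given by sets of positions become maps over sorted lists, the form in which
  flats are renumbered.\<close>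

lemma nths_eq_map_nth: "nths xs A = map ((!) xs) (sorted_list_of_set (A \<inter> {..<length xs}))"
proof -
  have "zip xs [0..<length xs] = map (\<lambda>i. (xs ! i, i)) [0..<length xs]"
    by (rule nth_equalityI) auto
  hence "nths xs A = map ((!) xs) (filter (\<lambda>i. i \<in> A) [0..<length xs])"
    by (simp add: nths_def filter_map comp_def)
  moreover have "filter (\<lambda>i. i \<in> A) [0..<length xs] = sorted_list_of_set (A \<inter> {..<length xs})"
    by (rule sorted_distinct_set_unique) (auto intro!: sorted_wrt_filter)
  ultimately show ?thesis by simp
qed

lemma sorted_list_of_set_image:
  assumes "strict_mono_on A f" "finite A"
  shows "sorted_list_of_set (f ` A) = map f (sorted_list_of_set A)"
proof (rule sorted_distinct_set_unique)
  have "mono_on A f" using assms(1) by (rule strict_mono_on_imp_mono_on)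
  hence "sorted_wrt (\<lambda>x y. f x \<le> f y) (sorted_list_of_set A)"
    by (intro sorted_wrt_mono_rel[OF _ sorted_sorted_list_of_set]) (use assms in \<open>auto dest: mono_onD\<close>)
  thus "sorted (map f (sorted_list_of_set A))" by (simp add: sorted_map)
  show "distinct (map f (sorted_list_of_set A))"
    using assms strict_mono_on_imp_inj_on by (auto simp: distinct_map)
qed (use assms in auto)

lemma sorted_list_of_set_insert_last:
  fixes l :: nat
  assumes "A \<subseteq> {..<l}"
  shows "sorted_list_of_set (insert l A) = sorted_list_of_set A @ [l]"
proof -
  have "finite A" using assms finite_subset by blast
  thus ?thesis using assms
    by (intro sorted_distinct_set_unique)
      (auto simp: sorted_append subset_iff intro: less_imp_le simp del: sorted_list_of_set_insert_remove)
qed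

lemma take_sorted_list_of_set:
  fixes C :: "nat set"
  assumes "k < card C"
  shows "take k (sorted_list_of_set C) = sorted_list_of_set (C \<inter> {..<sorted_list_of_set C ! k})"
proof (rule sorted_distinct_set_unique)
  let ?L = "sorted_list_of_set C"
  have fin: "finite C" using assms by (metis card.infinite not_less0)
  have strict: "?L ! i < ?L ! j \<longleftrightarrow> i < j" if "i < card C" "j < card C" for i j
    using that sorted_wrt_nth_less[OF strict_sorted_list_of_set[of C], of i j]
      sorted_wrt_nth_less[OF strict_sorted_list_of_set[of C], of j i] by (cases i j rule: linorder_cases) auto
  have "set (take k ?L) = {?L ! i | i. i < k}" using assms nth_image[of k ?L] by (fastforce simp: image_iff)
  also have "\<dots> = {x \<in> set ?L. x < ?L ! k}"
  proof (intro equalityI subsetI)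
    fix x assume "x \<in> {?L ! i | i. i < k}"
    thus "x \<in> {x \<in> set ?L. x < ?L ! k}"
      using strict assms fin by (auto simp del: set_sorted_list_of_set)
  next
    fix x assume "x \<in> {x \<in> set ?L. x < ?L ! k}"
    then obtain i where "i < card C" "x = ?L ! i" "x < ?L ! k"
      by (auto simp: in_set_conv_nth simp del: set_sorted_list_of_set)
    thus "x \<in> {?L ! i | i. i < k}" using strict assms by auto
  qed
  finally show "set (take k ?L) = set (sorted_list_of_set (C \<inter> {..<?L ! k}))" using fin by auto
qed (auto intro: sorted_wrt_take)

lemma nth_sorted_list_of_set_in: "k < card C \<Longrightarrow> sorted_list_of_set C ! k \<in> C" for C :: "nat set"
  by (metis card.infinite length_sorted_list_of_set not_less0 nth_mem set_sorted_list_of_set)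

lemma nth_sorted_list_of_set_less_iff:
  fixes C :: "nat set"
  assumes "i < card C" "j < card C"
  shows "sorted_list_of_set C ! i < sorted_list_of_set C ! j \<longleftrightarrow> i < j"
  using assms sorted_wrt_nth_less[OF strict_sorted_list_of_set[of C], of i j]
    sorted_wrt_nth_less[OF strict_sorted_list_of_set[of C], of j i] by (cases i j rule: linorder_cases) auto

lemma flat_index_nth:
  assumes "k < card F"
  shows "flat_index F (sorted_list_of_set F ! k) = k"
proof -
  have "finite F" using assms by (metis card.infinite not_less0)
  hence "{i \<in> F. i < sorted_list_of_set F ! k} = set (take k (sorted_list_of_set F))"
    unfolding take_sorted_list_of_set[OF assms] by auto
  thus ?thesis using assms by (simp add: flat_index_def distinct_card)
qed

lemma nth_flat_index:
  assumes "finite F" "j \<in> F"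
  shows "sorted_list_of_set F ! flat_index F j = j" "flat_index F j < card F"
proof -
  obtain k where "k < card F" "j = sorted_list_of_set F ! k"
    using assms by (metis in_set_conv_nth length_sorted_list_of_set set_sorted_list_of_set)
  thus "sorted_list_of_set F ! flat_index F j = j" "flat_index F j < card F"
    using flat_index_nth by auto
qed

lemma flat_index_less_iff:
  assumes "finite F" "i \<in> F" "j \<in> F"
  shows "flat_index F i < flat_index F j \<longleftrightarrow> i < j"
  using nth_sorted_list_of_set_less_iff[of "flat_index F i" F "flat_index F j"] nth_flat_index[OF assms(1)] assms
  by simp

lemma strict_mono_on_flat_index: "finite F \<Longrightarrow> A \<subseteq> F \<Longrightarrow> strict_mono_on A (flat_index F)"
  using flat_index_less_iff by (fastforce simp: strict_mono_on_def)

lemma inj_on_flat_index: "finite F \<Longrightarrow> A \<subseteq> F \<Longrightarrow> inj_on (flat_index F) A"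
  using strict_mono_on_flat_index strict_mono_on_imp_inj_on by blast

lemma bij_betw_flat_index: "finite F \<Longrightarrow> bij_betw (flat_index F) F {..<card F}"
  by (rule bij_betw_byWitness[where f' = "(!) (sorted_list_of_set F)"])
    (auto simp: nth_flat_index flat_index_nth nth_sorted_list_of_set_in)

lemma flat_index_image: "finite F \<Longrightarrow> flat_index F ` F = {..<card F}"
  using bij_betw_flat_index bij_betw_imp_surj_on by blast

text \<open>Ranks depend only on the order, which \<open>flat_index F\<close> preserves. Needed for
  flats of induced quadruples, whose positions are renumbered twice.\<close>

lemma flat_index_flat_index:
  assumes "finite F" "F' \<subseteq> F" "j \<in> F"
  shows "flat_index (flat_index F ` F') (flat_index F j) = flat_index F' j"
proof -
  have "{i \<in> flat_index F ` F'. i < flat_index F j} = flat_index F ` {i \<in> F'. i < j}"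
    using assms flat_index_less_iff[OF assms(1)] by auto
  moreover have "inj_on (flat_index F) {i \<in> F'. i < j}"
    by (rule inj_on_flat_index) (use assms in auto)
  ultimately show ?thesis
    unfolding flat_index_def[of "flat_index F ` F'"] flat_index_def[of F' j] by (simp add: card_image)
qed

section \<open>Coxeter groups\<close>

locale coxeter =
  fixes G :: "'g monoid" (structure) and S
  assumes coxeter_system: "coxeter_system G S"

sublocale coxeter \<subseteq> involution_system
proof -
  interpret group G using coxeter_system by (simp add: coxeter_system_def)
  have S: "S \<subseteq> carrier G" "\<And>s. s \<in> S \<Longrightarrow> ord s = 2"
    using coxeter_system by (auto simp: coxeter_system_def)
  show "involution_system G S"
  proof
    fix s assume s: "s \<in> S"
    have c: "s \<in> carrier G" using S s by auto
    have "s [^] (2::nat) = \<one>" using pow_ord_eq_1[OF c] S(2)[OF s] by simp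
    thus "s \<otimes> s = \<one>" using c by (simp add: numeral_2_eq_2)
    show "s \<noteq> \<one>" using S(2)[OF s] by auto
  qed (use S in auto)
qed

context coxeter
begin

lemma finite_S: "finite S" and generate_S: "generate G S = carrier G"
  using coxeter_system by (auto simp: coxeter_system_def)

lemma word_ex:
  assumes "g \<in> carrier G"
  obtains w where "w \<in> lists S" "word_prod G w = g"
proof -
  have "g \<in> generate G S" using assms generate_S by simp
  hence "\<exists>w\<in>lists S. word_prod G w = g"
  proof induction
    case one
    show ?case by (rule bexI[of _ "[]"]) auto
  next
    case (incl h)
    thus ?case using in_carrier by (intro bexI[of _ "[h]"]) auto
  next
    case (inv h)
    thus ?case using in_carrier inv_S by (intro bexI[of _ "[h]"]) auto
  next
    case (eng g h)
    then obtain u w where "u \<in> lists S" "w \<in> lists S" "word_prod G u = g" "word_prod G w = h" by auto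
    thus ?case using lists_carrier by (intro bexI[of _ "u @ w"]) auto
  qed
  thus thesis using that by blast
qed

text \<open>The presentation speaks of words with product one. An equation between two products is
  brought to this form by multiplying with the reverse of \<open>v\<close>, which represents the
  inverse.\<close>

lemma word_prod_eq_iff:
  assumes "u \<in> lists S" "v \<in> lists S"
  shows "word_prod G u = word_prod G v \<longleftrightarrow> u \<doteq> v"
proof
  assume eq: "word_prod G u = word_prod G v"
  have rv: "rev v \<in> lists S" using assms by auto
  have "word_prod G (rev v @ v) = \<one>" using cong_word_prod[OF cong_rev[OF assms(2)]] by simp
  hence "word_prod G (rev v @ u) = \<one>"
    using eq lists_carrier[OF assms(1)] lists_carrier[OF assms(2)] lists_carrier[OF rv] by simp
  hence "rev v @ u \<doteq> []" using coxeter_system assms rv by (auto simp: coxeter_system_def)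
  hence "v @ (rev v @ u) \<doteq> v @ []" using assms by (intro cong_append coxeter_congruent.refl)
  moreover have "(v @ rev v) @ u \<doteq> [] @ u"
    using cong_rev[OF rv] assms(1) by (intro cong_append coxeter_congruent.refl) auto
  ultimately show "u \<doteq> v"
    by (metis append.left_neutral append.right_neutral append_assoc coxeter_congruent.sym coxeter_congruent.trans)
qed (rule cong_word_prod)

lemma reduced_expression_iff: "reduced_expression G S w g \<longleftrightarrow> reduced w \<and> word_prod G w = g"
  unfolding reduced_expression_def reduced_def
  using word_prod_eq_iff cong_lists cong_word_prod by (metis (no_types, lifting))

text \<open>On the carrier the choice of the word is immaterial by \<open>word_prod_eq_iff\<close>
  and \<open>cong_action\<close>. Elsewhere the value is arbitrary but still linear, so
  \<open>linear_act\<close> has no side condition.\<close>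

definition act where "act g = word_action G (SOME w. w \<in> lists S \<and> word_prod G w = g)"

lemma act_word_prod: "w \<in> lists S \<Longrightarrow> act (word_prod G w) = word_action G w"
proof -
  assume w: "w \<in> lists S"
  define v where "v = (SOME v. v \<in> lists S \<and> word_prod G v = word_prod G w)"
  have "v \<in> lists S \<and> word_prod G v = word_prod G w"
    unfolding v_def by (rule someI[of _ w]) (use w in simp)
  hence "v \<doteq> w" using word_prod_eq_iff w by blast
  thus ?thesis using cong_action by (simp add: act_def v_def)
qed

lemma act_mult: "g \<in> carrier G \<Longrightarrow> h \<in> carrier G \<Longrightarrow> act (g \<otimes> h) v = act g (act h v)"
proof -
  assume "g \<in> carrier G" "h \<in> carrier G"
  then obtain u w where uw: "u \<in> lists S" "w \<in> lists S" "word_prod G u = g" "word_prod G w = h"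
    using word_ex by metis
  hence "act (word_prod G (u @ w)) v = act g (act h v)"
    using act_word_prod[of "u @ w"] act_word_prod[of u] act_word_prod[of w] by auto
  thus ?thesis using uw lists_carrier by auto
qed

lemma act_one [simp]: "act \<one> v = v"
  using act_word_prod[of "[]"] by simp

lemma act_generator: "s \<in> S \<Longrightarrow> act s = simple_reflection G s"
  using act_word_prod[of "[s]"] in_carrier by (auto simp: fun_eq_iff)

lemma linear_act: "linear (act g)"
  unfolding act_def by (rule linear_word_action)

lemmas act_simps =
  linear_add[OF linear_act] linear_diff[OF linear_act] linear_scale[OF linear_act]
  linear_0[OF linear_act] linear_neg[OF linear_act]

lemma act_inv [simp]: "g \<in> carrier G \<Longrightarrow> act (inv g) (act g v) = v"
  and act_inv' [simp]: "g \<in> carrier G \<Longrightarrow> act g (act (inv g) v) = v"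
  by (simp_all flip: act_mult)

lemma act_in_V: "g \<in> carrier G \<Longrightarrow> v \<in> V \<Longrightarrow> act g v \<in> V"
  using word_ex act_word_prod word_action_in_V by metis

lemma act_isometry:
  "g \<in> carrier G \<Longrightarrow> u \<in> V \<Longrightarrow> v \<in> V \<Longrightarrow> coxeter_form G (act g u) (act g v) = coxeter_form G u v"
  using word_ex act_word_prod word_action_isometry by metis

lemma act_faithful:
  assumes "g \<in> carrier G" "\<And>v. v \<in> V \<Longrightarrow> act g v = v"
  shows "g = \<one>"
proof -
  obtain w where w: "w \<in> lists S" "word_prod G w = g" using word_ex assms(1) by blast
  have "w \<doteq> []"
    by (rule faithful[OF w(1)]) (use w assms(2) act_word_prod simple_root_in_V in metis)
  thus ?thesis using cong_word_prod w by fastforce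
qed

lemma act_root_sign:
  "g \<in> carrier G \<Longrightarrow> s \<in> S \<Longrightarrow> nonneg (act g (simple_root s)) \<or> nonneg (- act g (simple_root s))"
  using word_ex act_word_prod root_nonneg_or_nonpos by metis

lemma act_eq_0_iff [simp]: "g \<in> carrier G \<Longrightarrow> act g v = 0 \<longleftrightarrow> v = 0"
  by (metis act_inv act_simps(4))

text \<open>Since \<open>g\<close> acts by isometries, conjugation by \<open>g\<close> turns the
  reflection \<open>s\<close> into the reflection in the image root. Hence
  \<open>flat_letter\<close> acts as the reflection in \<open>flat_root\<close>.\<close>

lemma act_reflection:
  assumes "g \<in> carrier G" "s \<in> S" "v \<in> V"
  shows "act (g \<otimes> s \<otimes> inv g) v =
    v - (2 * coxeter_form G (act g (simple_root s)) v) *\<^sub>R act g (simple_root s)"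
proof -
  define x where "x = act (inv g) v"
  have x: "x \<in> V" "v = act g x" using assms by (auto simp: x_def act_in_V)
  have "act (g \<otimes> s \<otimes> inv g) v = act g (simple_reflection G s x)"
    using assms in_carrier by (simp add: act_mult x_def act_generator)
  also have "\<dots> = v - (2 * coxeter_form G (simple_root s) x) *\<^sub>R act g (simple_root s)"
    by (simp add: simple_reflection_def act_simps x(2))
  also have "coxeter_form G (simple_root s) x = coxeter_form G (act g (simple_root s)) v"
    using x assms simple_root_in_V act_isometry by simp
  finally show ?thesis .
qed

end

section \<open>Quadruples and their flats\<close>

lemma finite_positions [simp]: "finite (positions X)"
  by (simp add: positions_def)

lemma root_function_eq_flat_root: "root_function X = flat_root X {}"
  by (simp add: root_function_def flat_root_def flat_prefix_def fun_eq_iff)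

text \<open>Maximality of the face forces a reduced subword off the face to use every position
  there. Conversely, a larger face would leave fewer positions than the length of the
  element.\<close>

lemma quadruple_iff:
  "quadruple X \<longleftrightarrow> coxeter_system (grp X) (gens X) \<and> word X \<in> lists (gens X) \<and>
     face X \<subseteq> positions X \<and>
     reduced_expression (grp X) (gens X) (nths (word X) (positions X - face X)) (elt X)"
  (is "?L \<longleftrightarrow> ?R")
proof
  assume L: ?L
  then obtain J where J: "J \<subseteq> positions X - face X" "face X \<subseteq> positions X"
    "reduced_expression (grp X) (gens X) (nths (word X) J) (elt X)"
    by (auto simp: quadruple_def subword_complex_def positions_def)
  have "positions X - J \<in> subword_complex (grp X) (gens X) (word X) (elt X)"
    unfolding subword_complex_def using J by (auto simp: positions_def intro!: exI[of _ J])
  hence "positions X - J = face X" using L J by (auto simp: quadruple_def)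
  hence "J = positions X - face X" using J by auto
  thus ?R using L J by (simp add: quadruple_def)
next
  assume R: ?R
  interpret coxeter "grp X" "gens X" using R by unfold_locales simp
  let ?C = "positions X - face X"
  have wl: "nths (word X) ?C \<in> lists (gens X)" and "word_prod (grp X) (nths (word X) ?C) = elt X"
    using R by (auto simp: reduced_expression_def)
  hence elt: "elt X \<in> carrier (grp X)" using word_prod_closed[OF is_group lists_carrier[OF wl]] by simp
  have "face X \<in> subword_complex (grp X) (gens X) (word X) (elt X)"
    using R unfolding subword_complex_def by (auto simp: positions_def intro!: exI[of _ ?C])
  moreover have "K = face X"
    if K: "K \<in> subword_complex (grp X) (gens X) (word X) (elt X)" "face X \<subseteq> K" for K
  proof -
    obtain J where J: "J \<subseteq> positions X - K" "K \<subseteq> positions X"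
      "reduced_expression (grp X) (gens X) (nths (word X) J) (elt X)"
      using K by (auto simp: subword_complex_def positions_def)
    have len: "length (nths (word X) A) = card A" if "A \<subseteq> positions X" for A
      using that by (auto simp: length_nths positions_def intro!: arg_cong[where f = card])
    have "length (nths (word X) ?C) \<le> length (nths (word X) J)"
      using R J(3) by (auto simp: reduced_expression_def)
    hence "card ?C \<le> card J" using len[of ?C] len[of J] J(1) by (metis Diff_subset order_trans)
    hence "J = ?C" using J K by (intro card_seteq) (auto simp: positions_def)
    thus ?thesis using J K R by blast
  qed
  ultimately show ?L using R elt by (auto simp: quadruple_def)
qed

text \<open>\<open>root_function\<close> skips the face, so at a position off the face the word it
  applies is a prefix of the complement word.\<close>

lemma take_complement_word:
  fixes X :: "'g quadruple"
  defines "C \<equiv> positions X - face X"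
  assumes "k < card C"
  shows "word_action (grp X) (take k (nths (word X) C)) (simple_root (nths (word X) C ! k))
    = root_function X (sorted_list_of_set C ! k)"
proof -
  define j where "j = sorted_list_of_set C ! k"
  have C: "C \<inter> {..<length (word X)} = C" by (auto simp: C_def positions_def)
  have j: "j < length (word X)"
    using nth_sorted_list_of_set_in[OF assms(2)] by (auto simp: j_def C_def positions_def)
  have "take k (nths (word X) C) = map ((!) (word X)) (sorted_list_of_set (C \<inter> {..<j}))"
    using assms(2) by (simp add: nths_eq_map_nth C take_map take_sorted_list_of_set j_def)
  also have "C \<inter> {..<j} = ({..<j} - face X) \<inter> {..<length (word X)}"
    using j by (auto simp: C_def positions_def)
  also have "map ((!) (word X)) (sorted_list_of_set \<dots>) = nths (word X) ({..<j} - face X)"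
    by (simp add: nths_eq_map_nth)
  finally show ?thesis
    using assms(2) by (simp add: root_function_def nths_eq_map_nth C j_def)
qed

text \<open>By \<open>take_complement_word\<close> the values of the root function off the face are
  the roots attached to the letters of the complement word, so the inversion criterion and its
  converse apply.\<close>

lemma reduced_complement_iff:
  assumes "involution_system (grp X) (gens X)" "word X \<in> lists (gens X)"
  shows "involution_system.reduced (grp X) (gens X) (nths (word X) (positions X - face X)) \<longleftrightarrow>
    (\<forall>j\<in>positions X - face X. nonneg (root_function X j))"
proof -
  interpret involution_system "grp X" "gens X" by fact
  let ?C = "positions X - face X"
  have len: "length (nths (word X) ?C) = card ?C"
    by (auto simp: length_nths positions_def intro!: arg_cong[where f = card])
  have wl: "nths (word X) ?C \<in> lists (gens X)" using assms(2) set_nths_subset by fastforce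
  have idx: "\<exists>k<card ?C. j = sorted_list_of_set ?C ! k" if "j \<in> ?C" for j
    using nth_flat_index[of ?C j] that by (metis finite_Diff finite_positions)
  show ?thesis
  proof
    assume r: "reduced (nths (word X) ?C)"
    show "\<forall>j\<in>?C. nonneg (root_function X j)"
      using idx roots_nonneg_if_reduced[OF r] take_complement_word[of _ X] len by metis
  next
    assume *: "\<forall>j\<in>?C. nonneg (root_function X j)"
    show "reduced (nths (word X) ?C)"
      by (rule reduced_if_roots_nonneg[OF wl])
        (use * take_complement_word[of _ X] len nth_sorted_list_of_set_in[of _ ?C] in auto)
  qed
qed

locale quad =
  fixes X :: "'g quadruple"
  assumes quadruple: "quadruple X"

sublocale quad \<subseteq> coxeter "grp X" "gens X"
  by unfold_locales (use quadruple quadruple_iff in blast)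

context quad
begin

abbreviation mult (infixl "\<bullet>" 70) where "g \<bullet> h \<equiv> g \<otimes>\<^bsub>grp X\<^esub> h"

abbreviation inverse_elt where "inverse_elt g \<equiv> inv\<^bsub>grp X\<^esub> g"

lemma word_lists: "word X \<in> lists (gens X)" and face_sub: "face X \<subseteq> positions X"
  and reduced_complement: "reduced (nths (word X) (positions X - face X))"
  using quadruple by (auto simp: quadruple_iff reduced_expression_iff)

lemma nth_word: "j \<in> positions X \<Longrightarrow> word X ! j \<in> gens X"
  using word_lists by (auto simp: positions_def)

lemma nth_word_carrier: "j \<in> positions X \<Longrightarrow> word X ! j \<in> carrier (grp X)"
  using nth_word in_carrier by blast

lemma root_nonneg: "j \<in> positions X \<Longrightarrow> j \<notin> face X \<Longrightarrow> nonneg (root_function X j)"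
  using reduced_complement reduced_complement_iff involution_system_axioms word_lists by blast

section \<open>Letters and roots of a flat\<close>

definition prefix_elt where "prefix_elt F j = word_prod (grp X) (flat_prefix X F j)"

lemma flat_prefix_lists: "flat_prefix X F j \<in> lists (gens X)"
  unfolding flat_prefix_def using word_lists set_nths_subset by fastforce

lemma prefix_elt_carrier [simp]: "prefix_elt F j \<in> carrier (grp X)"
  unfolding prefix_elt_def using flat_prefix_lists lists_carrier by simp

lemma prefix_elt_0 [simp]: "prefix_elt F 0 = \<one>\<^bsub>grp X\<^esub>"
  by (simp add: prefix_elt_def flat_prefix_def)

lemma prefix_elt_Suc:
  assumes "j \<in> positions X"
  shows "prefix_elt F (Suc j) =
    (if j \<in> face X \<or> j \<in> F then prefix_elt F j else prefix_elt F j \<bullet> word X ! j)"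
proof (cases "j \<in> face X \<or> j \<in> F")
  case True
  hence "{..<Suc j} - face X - F = {..<j} - face X - F" by (auto simp: lessThan_Suc)
  thus ?thesis using True by (simp add: prefix_elt_def flat_prefix_def)
next
  case False
  have "({..<Suc j} - face X - F) \<inter> {..<length (word X)} =
      insert j (({..<j} - face X - F) \<inter> {..<length (word X)})"
    using False assms by (auto simp: lessThan_Suc positions_def)
  hence "flat_prefix X F (Suc j) = flat_prefix X F j @ [word X ! j]"
    unfolding flat_prefix_def nths_eq_map_nth
    by (simp only:) (subst sorted_list_of_set_insert_last, auto)
  thus ?thesis
    using False assms lists_carrier[OF flat_prefix_lists] nth_word_carrier
    by (simp add: prefix_elt_def)
qed

lemma flat_letter_eq: "flat_letter X F j = prefix_elt F j \<bullet> word X ! j \<bullet> inverse_elt (prefix_elt F j)"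
  by (simp add: flat_letter_def prefix_elt_def Let_def)

lemma flat_root_eq: "flat_root X F j = act (prefix_elt F j) (simple_root (word X ! j))"
  by (simp add: flat_root_def prefix_elt_def act_word_prod flat_prefix_lists)

lemma flat_letter_carrier [simp]: "j \<in> positions X \<Longrightarrow> flat_letter X F j \<in> carrier (grp X)"
  by (simp add: flat_letter_eq nth_word_carrier)

lemma flat_letter_square: "j \<in> positions X \<Longrightarrow> flat_letter X F j \<bullet> flat_letter X F j = \<one>\<^bsub>grp X\<^esub>"
proof -
  assume j: "j \<in> positions X"
  let ?u = "prefix_elt F j" and ?q = "word X ! j"
  have c: "?u \<in> carrier (grp X)" "?q \<in> carrier (grp X)" using j nth_word_carrier by auto
  have "inverse_elt ?u \<bullet> (?u \<bullet> x) = x" if "x \<in> carrier (grp X)" for x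
    using that c by (simp flip: m_assoc)
  moreover have "?q \<bullet> (?q \<bullet> inverse_elt ?u) = inverse_elt ?u"
    using c S_involution[OF nth_word[OF j]] by (simp flip: m_assoc)
  ultimately show ?thesis using c by (simp add: flat_letter_eq m_assoc)
qed

lemma inv_flat_letter: "j \<in> positions X \<Longrightarrow> inverse_elt (flat_letter X F j) = flat_letter X F j"
  using inv_equality flat_letter_square flat_letter_carrier by blast

lemma flat_root_in_V: "j \<in> positions X \<Longrightarrow> flat_root X F j \<in> V"
  by (simp add: flat_root_eq act_in_V simple_root_in_V nth_word)

lemma flat_root_ne_0 [simp]: "flat_root X F j \<noteq> 0"
  by (simp add: flat_root_eq)

lemma flat_root_form_self: "j \<in> positions X \<Longrightarrow> coxeter_form (grp X) (flat_root X F j) (flat_root X F j) = 1"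
  by (simp add: flat_root_eq act_isometry simple_root_in_V nth_word form_self)

lemma act_flat_letter:
  "j \<in> positions X \<Longrightarrow> v \<in> V \<Longrightarrow> act (flat_letter X F j) v =
    v - (2 * coxeter_form (grp X) (flat_root X F j) v) *\<^sub>R flat_root X F j"
  by (simp add: flat_letter_eq flat_root_eq act_reflection nth_word)

lemma flat_letter_ne_one: "j \<in> positions X \<Longrightarrow> flat_letter X F j \<noteq> \<one>\<^bsub>grp X\<^esub>"
proof
  assume j: "j \<in> positions X" and "flat_letter X F j = \<one>\<^bsub>grp X\<^esub>"
  hence "act (flat_letter X F j) (flat_root X F j) = flat_root X F j" by simp
  thus False using act_flat_letter[OF j flat_root_in_V[OF j]] flat_root_form_self[OF j] by simp
qed

definition flat_product where
  "flat_product F A = word_prod (grp X) (map (flat_letter X F) (sorted_list_of_set A))"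

lemma map_flat_letter_carrier: "set ks \<subseteq> positions X \<Longrightarrow> set (map (flat_letter X F) ks) \<subseteq> carrier (grp X)"
  by auto

lemma flat_product_carrier [simp]: "A \<subseteq> positions X \<Longrightarrow> flat_product F A \<in> carrier (grp X)"
  unfolding flat_product_def
  by (intro word_prod_closed is_group map_flat_letter_carrier)
    (metis finite_positions infinite_super set_sorted_list_of_set)

lemma flat_product_insert:
  assumes "A \<subseteq> {..<j}" "j \<in> positions X"
  shows "flat_product F (insert j A) = flat_product F A \<bullet> flat_letter X F j"
proof -
  have "A \<subseteq> positions X" "finite A" using assms finite_subset by (auto simp: positions_def)
  thus ?thesis unfolding flat_product_def sorted_list_of_set_insert_last[OF assms(1)]
    using assms(2) map_flat_letter_carrier[of "sorted_list_of_set A" F] by simp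
qed

text \<open>
  Pulling the letters outside \<open>F\<close> to the right turns those in \<open>F\<close> into the letters of \<open>X\<^sub>F\<close>.
\<close>

lemma prefix_elt_decomp:
  assumes "F' \<subseteq> F" "j \<le> length (word X)"
  shows "prefix_elt F' j = flat_product F (F \<inter> ({..<j} - face X - F')) \<bullet> prefix_elt F j"
  using assms(2)
proof (induction j)
  case 0
  show ?case by (simp add: flat_product_def)
next
  case (Suc j)
  have j: "j \<in> positions X" using Suc.prems by (simp add: positions_def)
  let ?A = "F \<inter> ({..<j} - face X - F')"
  have A: "?A \<subseteq> positions X" "?A \<subseteq> {..<j}" using j by (auto simp: positions_def)
  note IH = Suc.IH[OF Suc_leD[OF Suc.prems]]
  note c = flat_product_carrier[OF A(1), of F] prefix_elt_carrier[of F j] nth_word_carrier[OF j]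
  consider "j \<in> face X \<or> j \<in> F'" | "j \<notin> face X" "j \<notin> F" | "j \<notin> face X" "j \<notin> F'" "j \<in> F" by blast
  thus ?case
  proof cases
    case 1
    hence "F \<inter> ({..<Suc j} - face X - F') = ?A" by (auto simp: lessThan_Suc)
    thus ?thesis using 1 assms(1) IH by (auto simp: prefix_elt_Suc[OF j])
  next
    case 2
    hence "F \<inter> ({..<Suc j} - face X - F') = ?A" by (auto simp: lessThan_Suc)
    thus ?thesis using 2 assms(1) IH c by (auto simp: prefix_elt_Suc[OF j] m_assoc)
  next
    case 3
    hence "F \<inter> ({..<Suc j} - face X - F') = insert j ?A" by (auto simp: lessThan_Suc)
    thus ?thesis using 3 IH c
      by (simp add: prefix_elt_Suc[OF j] flat_product_insert[OF A(2) j] flat_letter_eq m_assoc)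
  qed
qed

text \<open>The factor \<open>prefix_elt F j\<close> is absorbed into the letter for
  \<open>F\<close>, so the remaining conjugator is a product of letters of the larger flat. With
  \<open>F' = {}\<close> this describes the reflections in the roots of \<open>X\<close>
  itself.\<close>

lemma flat_letter_decomp:
  assumes "F' \<subseteq> F" "j \<in> positions X"
  shows "flat_letter X F' j = flat_product F (F \<inter> ({..<j} - face X - F')) \<bullet> flat_letter X F j \<bullet>
    inverse_elt (flat_product F (F \<inter> ({..<j} - face X - F')))"
proof -
  have j: "j \<le> length (word X)" using assms by (simp add: positions_def)
  have A: "F \<inter> ({..<j} - face X - F') \<subseteq> positions X" using j by (auto simp: positions_def)
  show ?thesis unfolding flat_letter_eq prefix_elt_decomp[OF assms(1) j]
    using flat_product_carrier[OF A, of F] prefix_elt_carrier[of F j] nth_word_carrier[OF assms(2)]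
    by (simp add: m_assoc inv_mult_group)
qed

lemma flat_root_decomp:
  assumes "F' \<subseteq> F" "j \<in> positions X"
  shows "flat_root X F' j = act (flat_product F (F \<inter> ({..<j} - face X - F'))) (flat_root X F j)"
proof -
  have j: "j \<le> length (word X)" using assms by (simp add: positions_def)
  have A: "F \<inter> ({..<j} - face X - F') \<subseteq> positions X" using j by (auto simp: positions_def)
  show ?thesis unfolding flat_root_eq prefix_elt_decomp[OF assms(1) j]
    using flat_product_carrier[OF A, of F] by (simp add: act_mult)
qed

text \<open>A reflection in a root of \<open>U\<close> changes a vector by a multiple of that root,
  so it maps \<open>U\<close> to itself.\<close>

lemma flat_letters_preserve:
  assumes "subspace U" "U \<subseteq> V" "set ks \<subseteq> positions X" "\<And>k. k \<in> set ks \<Longrightarrow> flat_root X F k \<in> U" "v \<in> U"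
  shows "act (word_prod (grp X) (map (flat_letter X F) ks)) v \<in> U"
  using assms(3,4)
proof (induction ks)
  case (Cons k ks)
  let ?x = "act (word_prod (grp X) (map (flat_letter X F) ks)) v"
  have x: "?x \<in> U" using Cons by simp
  have "set (map (flat_letter X F) ks) \<subseteq> carrier (grp X)" using Cons.prems by auto
  hence "act (word_prod (grp X) (map (flat_letter X F) (k # ks))) v = act (flat_letter X F k) ?x"
    using Cons.prems by (simp add: act_mult)
  also have "\<dots> = ?x - (2 * coxeter_form (grp X) (flat_root X F k) ?x) *\<^sub>R flat_root X F k"
    using x assms(2) Cons.prems by (intro act_flat_letter) auto
  finally show ?case using x Cons.prems assms(1) by (simp add: subspace_diff subspace_scale)
qed (use assms(5) in simp)

lemma flat_product_preserves:
  assumes "subspace U" "U \<subseteq> V" "A \<subseteq> positions X" "\<And>k. k \<in> A \<Longrightarrow> flat_root X F k \<in> U" "v \<in> U"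
  shows "act (flat_product F A) v \<in> U" and "act (inverse_elt (flat_product F A)) v \<in> U"
proof -
  have fin: "finite A" using assms(3) finite_subset finite_positions by blast
  show "act (flat_product F A) v \<in> U"
    unfolding flat_product_def using fin assms by (intro flat_letters_preserve) auto
  have "inverse_elt (word_prod (grp X) (map (flat_letter X F) ks)) =
      word_prod (grp X) (map (flat_letter X F) (rev ks))" if "set ks \<subseteq> positions X" for ks
    using that
  proof (induction ks)
    case (Cons k ks)
    have *: "set (map (flat_letter X F) ks) \<subseteq> carrier (grp X)"
      "set (map (flat_letter X F) (rev ks)) \<subseteq> carrier (grp X)" using Cons.prems by auto
    show ?case using Cons * word_prod_append[OF is_group *(2), of "[flat_letter X F k]"]
      by (simp add: inv_mult_group inv_flat_letter rev_map)
  qed simp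
  thus "act (inverse_elt (flat_product F A)) v \<in> U"
    unfolding flat_product_def using fin assms by (simp, intro flat_letters_preserve) auto
qed

end

section \<open>The root space of an induced quadruple\<close>

lemma ord_carrier_update:
  assumes "group G" "group (G\<lparr>carrier := H\<rparr>)"
  shows "group.ord (G\<lparr>carrier := H\<rparr>) x = group.ord G x"
  unfolding group.ord_def[OF assms(1)] group.ord_def[OF assms(2)]
  by (simp add: nat_pow_def)

lemma word_prod_carrier_update [simp]: "word_prod (G\<lparr>carrier := H\<rparr>) w = word_prod G w"
  by (simp add: word_prod_def)

text \<open>The identification of the abstract root space with \<open>V(F)\<close>, extended to all
  vectors by dropping the coordinates that are not letters of \<open>F\<close>.
  \<open>inv_into\<close> picks one of possibly several positions with the same letter; for a
  realized flat their roots agree by \<open>flat_letter_eq_iff\<close>.\<close>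

definition flat_embedding :: "'g quadruple \<Rightarrow> nat set \<Rightarrow> 'g vec \<Rightarrow> 'g vec" where
  "flat_embedding X F v = (\<Sum>t\<in>flat_letter X F ` F.
     Poly_Mapping.lookup v t *\<^sub>R flat_root X F (inv_into F (flat_letter X F) t))"

lemma linear_flat_embedding: "linear (flat_embedding X F)"
  by (rule linearI)
    (auto simp: flat_embedding_def lookup_add scaleR_add_left sum.distrib scaleR_sum_right)

lemmas flat_embedding_simps =
  linear_add[OF linear_flat_embedding] linear_diff[OF linear_flat_embedding]
  linear_scale[OF linear_flat_embedding] linear_0[OF linear_flat_embedding]
  linear_neg[OF linear_flat_embedding]

lemma
  shows grp_induced: "grp (induced_quadruple X F) =
      (grp X)\<lparr>carrier := generate (grp X) (set (map (flat_letter X F) (sorted_list_of_set F)))\<rparr>"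
    and word_induced: "word (induced_quadruple X F) = map (flat_letter X F) (sorted_list_of_set F)"
    and face_induced: "face (induced_quadruple X F) = flat_index F ` (F \<inter> face X)"
    and positions_induced [simp]: "positions (induced_quadruple X F) = {..<card F}"
  by (simp_all add: induced_quadruple_def Let_def positions_def)

lemma gens_induced: "finite F \<Longrightarrow> gens (induced_quadruple X F) = flat_letter X F ` F"
  by (simp add: induced_quadruple_def Let_def)

locale realized_flat = quad +
  fixes F
  assumes flat: "flat X F" and realized: "realized_on_flat X F"
begin

abbreviation XF where "XF \<equiv> induced_quadruple X F"
abbreviation W where "W \<equiv> root_span X F"

lemma F_sub: "F \<subseteq> positions X"
  using flat by (auto simp: flat_def flat_of_def)

lemma finite_F [simp]: "finite F"
  using F_sub finite_subset finite_positions by blast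

lemma in_positions: "j \<in> F \<Longrightarrow> j \<in> positions X"
  using F_sub by blast

lemma root_in_W: "j \<in> F \<Longrightarrow> root_function X j \<in> W"
  by (auto simp: root_span_def intro: span_base)

text \<open>The subspace that defines \<open>F\<close> may be larger than \<open>W\<close>. But
  \<open>W\<close> lies in it, so \<open>W\<close> defines the same flat.\<close>

lemma root_in_W_iff:
  assumes "j \<in> positions X"
  shows "root_function X j \<in> W \<longleftrightarrow> j \<in> F"
proof -
  obtain U where U: "subspace U" "F = flat_of X U" using flat by (auto simp: flat_def)
  have "W \<subseteq> U" unfolding root_span_def by (rule span_minimal) (use U in \<open>auto simp: flat_of_def\<close>)
  thus ?thesis using assms U root_in_W by (auto simp: flat_of_def)
qed

lemma subspace_W: "subspace W"
  by (simp add: root_span_def)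

lemma W_sub_V: "W \<subseteq> V"
  unfolding root_span_def
  by (rule span_minimal) (auto simp: root_function_eq_flat_root flat_root_in_V in_positions)

lemma root_decomp:
  assumes "j \<in> positions X"
  shows "root_function X j = act (flat_product F (F \<inter> ({..<j} - face X))) (flat_root X F j)"
  using flat_root_decomp[of "{}" F j] assms by (simp add: root_function_eq_flat_root)

text \<open>Solve \<open>root_decomp\<close> for the flat root. The letters in between are
  reflections in flat roots at smaller positions, which lie in \<open>W\<close> by induction, so
  their product and its inverse preserve \<open>W\<close>.\<close>

lemma flat_root_in_W: "j \<in> F \<Longrightarrow> flat_root X F j \<in> W"
proof (induction j rule: less_induct)
  case (less j)
  let ?A = "F \<inter> ({..<j} - face X)"
  have A: "?A \<subseteq> positions X" using F_sub by auto
  have "flat_root X F j = act (inverse_elt (flat_product F ?A)) (root_function X j)"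
    using A by (simp add: root_decomp in_positions[OF less.prems])
  also have "\<dots> \<in> W"
    by (rule flat_product_preserves[OF subspace_W W_sub_V A]) (use less root_in_W in auto)
  finally show ?case .
qed

lemma W_eq_span: "W = span (flat_root X F ` F)"
proof
  show "span (flat_root X F ` F) \<subseteq> W"
    by (rule span_minimal[OF _ subspace_W]) (use flat_root_in_W in auto)
  have "span (flat_root X F ` F) \<subseteq> V"
    by (rule span_minimal) (auto simp: flat_root_in_V in_positions)
  thus "W \<subseteq> span (flat_root X F ` F)"
    unfolding root_span_def[of X F]
    by (intro span_minimal subspace_span image_subsetI)
      (subst root_decomp[OF in_positions], assumption,
        rule flat_product_preserves(1), use F_sub in \<open>auto intro: span_base\<close>)
qed

text \<open>
  The element \<open>u = \<close>\<^term>\<open>prefix_elt F l\<close> has no inversion in \<open>W\<close>: its inversions are the roots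
  \<open>u' \<alpha>\<close> for shorter prefixes \<open>u'\<close>, and these lie outside \<open>W\<close>.
\<close>

lemma prefix_elt_inverse_nonneg:
  assumes "l \<le> length (word X)"
    and g: "g \<in> carrier (grp X)" "s \<in> gens X"
    and root: "act g (simple_root s) \<in> W" "nonneg (act g (simple_root s))"
  shows "nonneg (act (inverse_elt (prefix_elt F l)) (act g (simple_root s)))"
  using assms(1)
proof (induction l)
  case (Suc l)
  define \<gamma> where "\<gamma> = act g (simple_root s)"
  have l: "l \<in> positions X" using Suc.prems by (simp add: positions_def)
  let ?u = "prefix_elt F l" and ?q = "word X ! l"
  define \<delta> where "\<delta> = act (inverse_elt ?u) \<gamma>"
  have IH: "nonneg \<delta>" using Suc by (simp add: \<delta>_def \<gamma>_def)
  show ?case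
  proof (cases "l \<in> face X \<or> l \<in> F")
    case True
    thus ?thesis using Suc by (simp add: prefix_elt_Suc[OF l])
  next
    case False
    note q = nth_word[OF l] nth_word_carrier[OF l]
    have eq: "act (inverse_elt (prefix_elt F (Suc l))) \<gamma> = simple_reflection (grp X) ?q \<delta>"
      using False q by (simp add: prefix_elt_Suc[OF l] inv_mult_group act_mult inv_S act_generator \<delta>_def)
    have "act (inverse_elt (prefix_elt F (Suc l))) \<gamma> =
        act (inverse_elt (prefix_elt F (Suc l)) \<bullet> g) (simple_root s)"
      using g by (simp add: act_mult \<gamma>_def)
    hence "nonneg (simple_reflection (grp X) ?q \<delta>) \<or> nonneg (- simple_reflection (grp X) ?q \<delta>)"
      using act_root_sign[of "inverse_elt (prefix_elt F (Suc l)) \<bullet> g" s] g eq by simp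
    moreover have False if neg: "nonneg (- simple_reflection (grp X) ?q \<delta>)"
    proof -
      \<comment> \<open>A simple reflection changes only the coefficient of its own root. A
        nonnegative vector that it makes nonpositive has no other nonzero coefficient.\<close>
      have "Poly_Mapping.lookup \<delta> x = 0" if "x \<noteq> ?q" for x
      proof -
        have "Poly_Mapping.lookup (simple_reflection (grp X) ?q \<delta>) x = Poly_Mapping.lookup \<delta> x"
          using that by (simp add: simple_reflection_def lookup_minus lookup_simple_root)
        moreover have "0 \<le> Poly_Mapping.lookup (- simple_reflection (grp X) ?q \<delta>) x"
          using neg unfolding nonneg_def by blast
        moreover have "0 \<le> Poly_Mapping.lookup \<delta> x" using IH unfolding nonneg_def by blast
        ultimately show ?thesis by simp
      qed
      hence d: "\<delta> = Poly_Mapping.lookup \<delta> ?q *\<^sub>R simple_root ?q"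
        by (intro poly_mapping_eqI) (auto simp: lookup_simple_root)
      define c where "c = Poly_Mapping.lookup \<delta> ?q"
      have "\<gamma> = act ?u \<delta>" by (simp add: \<delta>_def)
      hence \<gamma>: "\<gamma> = c *\<^sub>R flat_root X F l"
        using d by (simp add: c_def[symmetric] flat_root_eq) (metis act_simps(3))
      have "\<gamma> \<noteq> 0" using g by (simp add: \<gamma>_def)
      hence "c \<noteq> 0" using \<gamma> by auto
      hence "flat_root X F l = (1 / c) *\<^sub>R \<gamma>" using \<gamma> by simp
      hence "flat_root X F l \<in> W" using root(1) subspace_W by (simp add: \<gamma>_def subspace_scale)
      \<comment> \<open>The letters of \<open>F\<close> occurring in \<open>root_decomp\<close> keep
        the vector in \<open>W\<close>, so \<open>l\<close> would be a position of the flat,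
        contrary to the present case.\<close>
      hence "root_function X l \<in> W" unfolding root_decomp[OF l]
        by (intro flat_product_preserves[OF subspace_W W_sub_V]) (use F_sub flat_root_in_W in auto)
      thus False using False root_in_W_iff[OF l] by simp
    qed
    ultimately show ?thesis using eq by (auto simp: \<gamma>_def)
  qed
qed (use root in simp)

text \<open>Otherwise \<open>- flat_root X F j\<close> is a positive root in \<open>W\<close>, which
  the inverse of the prefix sends to the negative of a simple root. This contradicts
  \<open>prefix_elt_inverse_nonneg\<close>.\<close>

lemma flat_root_nonneg:
  assumes "j \<in> F"
  shows "nonneg (flat_root X F j)"
proof (rule ccontr)
  have j: "j \<in> positions X" "j \<le> length (word X)"
    using in_positions[OF assms] by (auto simp: positions_def)
  let ?u = "prefix_elt F j" and ?q = "word X ! j"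
  note q = nth_word[OF j(1)] nth_word_carrier[OF j(1)]
  assume "\<not> nonneg (flat_root X F j)"
  hence n: "nonneg (- flat_root X F j)"
    using act_root_sign[of ?u ?q] q by (simp add: flat_root_eq)
  \<comment> \<open>The lemma on prefixes asks for a group element applied to a simple root; the
    additional letter \<open>?q\<close> supplies the sign.\<close>
  have eq: "- flat_root X F j = act (?u \<bullet> ?q) (simple_root ?q)"
    using q by (simp add: act_mult act_generator reflection_simple_root act_simps flat_root_eq)
  have "nonneg (act (inverse_elt ?u) (- flat_root X F j))"
    using prefix_elt_inverse_nonneg[OF j(2), of "?u \<bullet> ?q" ?q] n q flat_root_in_W[OF assms] subspace_W
    by (simp add: eq[symmetric] subspace_neg)
  hence "nonneg (- simple_root ?q)" by (simp add: flat_root_eq act_simps)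
  thus False using nonneg_antisym[of "simple_root ?q"] by simp
qed

text \<open>Equal reflections have proportional roots. Both roots have norm one, so the factor is 1
  or -1, and positivity excludes -1. The converse holds because \<open>act\<close> is
  faithful.\<close>

lemma flat_letter_eq_iff:
  assumes "i \<in> F" "j \<in> F"
  shows "flat_letter X F i = flat_letter X F j \<longleftrightarrow> flat_root X F i = flat_root X F j"
proof
  note ij = in_positions[OF assms(1)] in_positions[OF assms(2)]
  let ?a = "flat_root X F i" and ?b = "flat_root X F j"
  {
    assume eq: "flat_letter X F i = flat_letter X F j"
    define c where "c = coxeter_form (grp X) ?b ?a"
    have "- ?a = ?a - (2 * c) *\<^sub>R ?b"
      using act_flat_letter[OF ij(1) flat_root_in_V[OF ij(1)], of F F] eq
        act_flat_letter[OF ij(2) flat_root_in_V[OF ij(1)], of F F]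
        flat_root_form_self[OF ij(1)] by (simp add: c_def scaleR_2)
    hence "2 *\<^sub>R ?a = 2 *\<^sub>R (c *\<^sub>R ?b)" by (simp add: scaleR_2 algebra_simps)
    hence ab: "?a = c *\<^sub>R ?b" by (metis scaleR_cancel_left zero_neq_numeral)
    have "c * c = 1"
      using flat_root_form_self[OF ij(1), of F] flat_root_form_self[OF ij(2), of F]
      unfolding ab by (simp add: coxeter_form_simps)
    hence "c = 1 \<or> c = -1" by (simp add: square_eq_1_iff)
    moreover have "c \<noteq> -1"
      using ab nonneg_antisym[OF flat_root_nonneg[OF assms(2)]] flat_root_nonneg[OF assms(1)]
      by auto
    ultimately show "?a = ?b" using ab by simp
  }
  {
    assume eq: "?a = ?b"
    have "act (flat_letter X F i \<bullet> flat_letter X F j) v = v" if "v \<in> V" for v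
    proof -
      have "act (flat_letter X F j) v = act (flat_letter X F i) v"
        using act_flat_letter ij that eq by simp
      hence "act (flat_letter X F i \<bullet> flat_letter X F j) v = act (flat_letter X F i \<bullet> flat_letter X F i) v"
        using ij by (simp add: act_mult)
      thus ?thesis using ij by (simp add: flat_letter_square)
    qed
    hence "flat_letter X F i \<bullet> flat_letter X F j = \<one>\<^bsub>grp X\<^esub>" using ij by (intro act_faithful) auto
    thus "flat_letter X F i = flat_letter X F j"
      using inv_equality[of "flat_letter X F i" "flat_letter X F j"] inv_flat_letter ij by simp
  }
qed

abbreviation \<Lambda> where "\<Lambda> \<equiv> flat_embedding X F"

lemma embedding_simple_root:
  assumes "j \<in> F"
  shows "\<Lambda> (simple_root (flat_letter X F j)) = flat_root X F j"
proof -
  let ?t = "flat_letter X F j"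
  have "\<Lambda> (simple_root ?t) = (\<Sum>t\<in>flat_letter X F ` F.
      if t = ?t then flat_root X F (inv_into F (flat_letter X F) t) else 0)"
    unfolding flat_embedding_def by (intro sum.cong) (auto simp: lookup_simple_root)
  also have "\<dots> = flat_root X F (inv_into F (flat_letter X F) ?t)" using assms by simp
  also have "\<dots> = flat_root X F j"
    using flat_letter_eq_iff[of "inv_into F (flat_letter X F) ?t" j] assms
    by (simp add: f_inv_into_f inv_into_into)
  finally show ?thesis .
qed

lemma letters_sub: "flat_letter X F ` F \<subseteq> carrier (grp X)"
  using F_sub by auto

lemma grp_XF: "grp XF = (grp X)\<lparr>carrier := generate (grp X) (flat_letter X F ` F)\<rparr>"
  by (simp add: grp_induced)

lemma gens_XF: "gens XF = flat_letter X F ` F"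
  by (simp add: gens_induced)

lemma subgroup_XF: "subgroup (carrier (grp XF)) (grp X)"
  using generate_is_subgroup[OF letters_sub] by (simp add: grp_XF)

lemma group_XF: "group (grp XF)"
  using subgroup_imp_group[OF subgroup_XF] by (simp add: grp_XF)

lemma ord_XF: "group.ord (grp XF) x = group.ord (grp X) x"
  using ord_carrier_update[OF is_group] group_XF by (simp add: grp_XF)

lemma mult_XF [simp]: "x \<otimes>\<^bsub>grp XF\<^esub> y = x \<bullet> y" and one_XF [simp]: "\<one>\<^bsub>grp XF\<^esub> = \<one>\<^bsub>grp X\<^esub>"
  and word_prod_XF [simp]: "word_prod (grp XF) w = word_prod (grp X) w"
  by (simp_all add: grp_XF)

lemma word_lists_XF: "word XF \<in> lists (gens XF)"
  by (auto simp: word_induced gens_XF)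

sublocale ind: involution_system "grp XF" "gens XF"
proof -
  interpret H: group "grp XF" by (rule group_XF)
  show "involution_system (grp XF) (gens XF)"
  proof
    show "gens XF \<subseteq> carrier (grp XF)" by (auto simp: gens_XF grp_XF intro: generate.incl)
  qed (use F_sub flat_letter_square flat_letter_ne_one in \<open>auto simp: gens_XF subset_iff\<close>)
qed

text \<open>On basis vectors this is the condition on the form in \<open>realized_on_flat\<close>,
  because orders in the subgroup are orders in \<open>grp X\<close>.\<close>

lemma embedding_isometry:
  assumes "u \<in> ind.V" "v \<in> ind.V"
  shows "coxeter_form (grp X) (\<Lambda> u) (\<Lambda> v) = coxeter_form (grp XF) u v"
  by (rule coxeter_form_eq_on_span[OF linear_flat_embedding _ assms])
    (use realized in \<open>auto simp: gens_XF embedding_simple_root coxeter_form_simple_roots ord_XF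
      realized_on_flat_def\<close>)

lemma embedding_image_roots: "\<Lambda> ` simple_root ` gens XF = flat_root X F ` F"
  by (auto simp: gens_XF embedding_simple_root image_image)

lemma inj_on_embedding: "inj_on \<Lambda> ind.V"
proof (rule linear_inj_on_span_independent_image[OF linear_flat_embedding])
  show "independent (\<Lambda> ` simple_root ` gens XF)"
    using realized by (simp add: embedding_image_roots realized_on_flat_def)
  show "inj_on \<Lambda> (simple_root ` gens XF)"
    by (rule inj_onI) (auto simp: gens_XF embedding_simple_root flat_letter_eq_iff)
qed

lemma embedding_V: "\<Lambda> ` ind.V = W"
  by (simp add: linear_span_image[OF linear_flat_embedding, symmetric] embedding_image_roots W_eq_span)

lemma embedding_in_W: "v \<in> ind.V \<Longrightarrow> \<Lambda> v \<in> W"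
  using embedding_V by blast

text \<open>The embedding intertwines the geometric representation of the induced system with the
  action of \<open>grp X\<close> on \<open>W\<close>: letter by letter, both sides are reflections
  in the same root for the same form.\<close>

lemma embedding_action:
  assumes "w \<in> lists (gens XF)" "v \<in> ind.V"
  shows "\<Lambda> (word_action (grp XF) w v) = act (word_prod (grp X) w) (\<Lambda> v)"
  using assms(1)
proof (induction w)
  case (Cons t w)
  then obtain j where j: "j \<in> F" "t = flat_letter X F j" by (auto simp: gens_XF)
  have w: "w \<in> lists (gens XF)" using Cons.hyps by simp
  define x where "x = word_action (grp XF) w v"
  have x: "x \<in> ind.V" using ind.word_action_in_V[OF w assms(2)] by (simp add: x_def)
  have wc: "set w \<subseteq> carrier (grp X)" using w letters_sub by (auto simp: gens_XF)
  have "\<Lambda> (word_action (grp XF) (t # w) v) =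
      \<Lambda> x - (2 * coxeter_form (grp XF) (simple_root t) x) *\<^sub>R flat_root X F j"
    using j by (simp add: simple_reflection_def flat_embedding_simps embedding_simple_root x_def)
  also have "coxeter_form (grp XF) (simple_root t) x = coxeter_form (grp X) (flat_root X F j) (\<Lambda> x)"
    using embedding_isometry[OF _ x, of "simple_root t"] ind.simple_root_in_V j
    by (simp add: gens_XF embedding_simple_root)
  also have "\<Lambda> x - (2 * coxeter_form (grp X) (flat_root X F j) (\<Lambda> x)) *\<^sub>R flat_root X F j = act t (\<Lambda> x)"
    using act_flat_letter[OF in_positions[OF j(1)], of "\<Lambda> x" F] embedding_in_W[OF x] W_sub_V j by auto
  also have "\<dots> = act (word_prod (grp X) (t # w)) (\<Lambda> v)"
    using Cons wc in_positions[OF j(1)] j by (simp add: act_mult x_def)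
  finally show ?case .
qed simp

lemma embedding_nonneg: "nonneg v \<Longrightarrow> nonneg (\<Lambda> v)"
proof -
  assume v: "nonneg v"
  have "inv_into F (flat_letter X F) t \<in> F" if "t \<in> flat_letter X F ` F" for t
    using that by (rule inv_into_into)
  hence *: "nonneg (flat_root X F (inv_into F (flat_letter X F) t))" if "t \<in> flat_letter X F ` F" for t
    using flat_root_nonneg that by blast
  show ?thesis unfolding flat_embedding_def nonneg_def lookup_sum
    using v * by (intro allI sum_nonneg) (simp add: nonneg_def)
qed

lemma coxeter_XF: "coxeter_system (grp XF) (gens XF)"
proof -
  have "finite (gens XF)" by (simp add: gens_XF)
  moreover have "generate (grp XF) (gens XF) = carrier (grp XF)"
    using generate_consistent[OF _ subgroup_XF, of "gens XF"] ind.S_carrier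
    by (simp add: grp_XF gens_XF)
  moreover have "group.ord (grp XF) s = 2" if "s \<in> gens XF" for s
    using ind.ord_eq_2 ind.S_carrier ind.S_involution[OF that] ind.S_ne_one[OF that] that by blast
  moreover have "coxeter_congruent (grp XF) (gens XF) w []"
    if w: "w \<in> lists (gens XF)" "word_prod (grp XF) w = \<one>\<^bsub>grp XF\<^esub>" for w
  proof (rule ind.faithful[OF w(1)])
    fix s assume "s \<in> gens XF"
    hence s: "simple_root s \<in> ind.V" by (rule ind.simple_root_in_V)
    \<comment> \<open>A word with product one fixes every vector of \<open>W\<close>; injectivity of
      the embedding carries this back to the abstract root space.\<close>
    have "\<Lambda> (word_action (grp XF) w (simple_root s)) = \<Lambda> (simple_root s)"
      using embedding_action[OF w(1) s] w(2) by simp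
    thus "word_action (grp XF) w (simple_root s) = simple_root s"
      using inj_on_embedding s ind.word_action_in_V[OF w(1) s] by (auto dest: inj_onD)
  qed
  ultimately show ?thesis
    using ind.S_carrier group_XF by (auto simp: coxeter_system_def)
qed

section \<open>Flats of an induced quadruple\<close>

lemma flat_prefix_XF:
  assumes "F' \<subseteq> F" "j \<in> F"
  shows "flat_prefix XF (flat_index F ` F') (flat_index F j) =
    map (flat_letter X F) (sorted_list_of_set (F \<inter> ({..<j} - face X - F')))"
proof -
  let ?b = "flat_index F" and ?A = "F \<inter> ({..<j} - face X - F')"
  have mem: "?b i \<in> ?b ` B \<longleftrightarrow> i \<in> B" if "i \<in> F" "B \<subseteq> F" for i B
    using inj_on_flat_index[of F F] that by (auto dest: inj_onD)
  have "({..<?b j} - ?b ` (F \<inter> face X) - ?b ` F') \<inter> {..<card F} = ?b ` ?A"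
  proof (intro equalityI subsetI)
    fix x assume x: "x \<in> ({..<?b j} - ?b ` (F \<inter> face X) - ?b ` F') \<inter> {..<card F}"
    hence "x \<in> ?b ` F" using flat_index_image[OF finite_F] by simp
    then obtain i where i: "i \<in> F" "x = ?b i" by blast
    thus "x \<in> ?b ` ?A"
      using x mem[OF i(1), of "F \<inter> face X"] mem[OF i(1) assms(1)] flat_index_less_iff[of F i j] assms by auto
  next
    fix x assume "x \<in> ?b ` ?A"
    then obtain i where i: "i \<in> ?A" "x = ?b i" by blast
    thus "x \<in> ({..<?b j} - ?b ` (F \<inter> face X) - ?b ` F') \<inter> {..<card F}"
      using mem[of i "F \<inter> face X"] mem[of i F'] assms nth_flat_index[of F i] flat_index_less_iff[of F i j]
      by auto
  qed
  hence "flat_prefix XF (?b ` F') (?b j) =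
      map ((!) (map (flat_letter X F) (sorted_list_of_set F))) (map ?b (sorted_list_of_set ?A))"
    using sorted_list_of_set_image[OF strict_mono_on_flat_index[of F ?A]]
    by (simp add: flat_prefix_def nths_eq_map_nth word_induced face_induced)
  also have "\<dots> = map (flat_letter X F) (sorted_list_of_set ?A)"
    by (simp add: nth_flat_index)
  finally show ?thesis .
qed

lemma inv_XF: "x \<in> carrier (grp XF) \<Longrightarrow> inv\<^bsub>grp XF\<^esub> x = inverse_elt x"
  using m_inv_consistent[OF subgroup_XF] by (simp add: grp_XF)

text \<open>Conjugators formed inside the induced quadruple are products of its letters, and by
  \<open>flat_letter_decomp\<close> they produce the letters formed in \<open>X\<close>. Both sides
  are elements of \<open>grp X\<close>, so this is an equality and not merely an
  isomorphism.\<close>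

lemma flat_letter_XF:
  assumes "F' \<subseteq> F" "j \<in> F"
  shows "flat_letter XF (flat_index F ` F') (flat_index F j) = flat_letter X F' j"
proof -
  let ?w = "flat_prefix XF (flat_index F ` F') (flat_index F j)"
  have "set ?w \<subseteq> gens XF" unfolding flat_prefix_XF[OF assms] by (auto simp: gens_XF)
  hence "word_prod (grp XF) ?w \<in> carrier (grp XF)"
    using ind.S_carrier by (intro word_prod_closed[OF group_XF]) blast
  moreover have "word_prod (grp X) ?w = flat_product F (F \<inter> ({..<j} - face X - F'))"
    unfolding flat_prefix_XF[OF assms] by (simp add: flat_product_def)
  moreover have "word XF ! flat_index F j = flat_letter X F j"
    using nth_flat_index[OF finite_F assms(2)] by (simp add: word_induced)
  ultimately show ?thesis
    unfolding flat_letter_def[of XF] Let_def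
    using flat_letter_decomp[OF assms(1) in_positions[OF assms(2)]] by (simp add: inv_XF)
qed

lemma flat_root_XF:
  assumes "F' \<subseteq> F" "j \<in> F"
  shows "\<Lambda> (flat_root XF (flat_index F ` F') (flat_index F j)) = flat_root X F' j"
    and "flat_root XF (flat_index F ` F') (flat_index F j) \<in> ind.V"
proof -
  let ?w = "flat_prefix XF (flat_index F ` F') (flat_index F j)"
  have w: "?w \<in> lists (gens XF)" unfolding flat_prefix_XF[OF assms] by (auto simp: gens_XF)
  have word: "word XF ! flat_index F j = flat_letter X F j"
    using nth_flat_index[OF finite_F assms(2)] by (simp add: word_induced)
  have v: "simple_root (flat_letter X F j) \<in> ind.V"
    using assms by (intro ind.simple_root_in_V) (simp add: gens_XF)
  have "\<Lambda> (flat_root XF (flat_index F ` F') (flat_index F j)) =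
      act (word_prod (grp X) ?w) (flat_root X F j)"
    unfolding flat_root_def[of XF] using embedding_action[OF w v] word assms
    by (simp add: embedding_simple_root)
  also have "word_prod (grp X) ?w = flat_product F (F \<inter> ({..<j} - face X - F'))"
    unfolding flat_prefix_XF[OF assms] by (simp add: flat_product_def)
  finally show "\<Lambda> (flat_root XF (flat_index F ` F') (flat_index F j)) = flat_root X F' j"
    using flat_root_decomp[OF assms(1) in_positions[OF assms(2)]] by simp
  show "flat_root XF (flat_index F ` F') (flat_index F j) \<in> ind.V"
    unfolding flat_root_def[of XF] using ind.word_action_in_V[OF w v] word by simp
qed

lemma root_function_XF:
  assumes "j \<in> F"
  shows "\<Lambda> (root_function XF (flat_index F j)) = root_function X j"
    and "root_function XF (flat_index F j) \<in> ind.V"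
  using flat_root_XF[of "{}" j] assms by (simp_all add: root_function_eq_flat_root)

lemma quadruple_XF: "quadruple XF"
proof -
  interpret XF: coxeter "grp XF" "gens XF" by unfold_locales (rule coxeter_XF)
  let ?C = "positions XF - face XF"
  have "nonneg (root_function XF k)" if "k \<in> ?C" for k
  proof -
    have "k \<in> flat_index F ` F" using that flat_index_image[OF finite_F] by simp
    then obtain j where j: "j \<in> F" "k = flat_index F j" by blast
    have jI: "j \<notin> face X" using that j by (auto simp: face_induced)
    have "word XF ! k \<in> gens XF" using that word_lists_XF by (auto simp: positions_def)
    moreover have "nths (word XF) ({..<k} - face XF) \<in> lists (gens XF)"
      using word_lists_XF set_nths_subset by fastforce
    ultimately have "nonneg (root_function XF k) \<or> nonneg (- root_function XF k)"
      unfolding root_function_def by (rule ind.root_nonneg_or_nonpos[rotated])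
    \<comment> \<open>The embedding transports positivity in one direction only, so the sign is
      found by excluding the other case: a nonpositive root would embed to a nonpositive root at a
      position off the face of \<open>X\<close>.\<close>
    moreover have False if "nonneg (- root_function XF k)"
    proof -
      have "nonneg (- root_function X j)"
        using embedding_nonneg[OF that] root_function_XF(1)[OF j(1)] j(2) by (simp add: flat_embedding_simps)
      thus False using nonneg_antisym[OF root_nonneg[OF in_positions[OF j(1)] jI]]
        by (simp add: root_function_eq_flat_root)
    qed
    ultimately show ?thesis by blast
  qed
  hence "ind.reduced (nths (word XF) ?C)"
    using reduced_complement_iff[OF ind.involution_system_axioms word_lists_XF] by blast
  moreover have "elt XF = word_prod (grp XF) (nths (word XF) ?C)"
    by (simp add: induced_quadruple_def Let_def positions_def)
  moreover have "face XF \<subseteq> positions XF"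
    using flat_index_image[of F] by (auto simp: face_induced)
  ultimately show ?thesis
    using coxeter_XF word_lists_XF by (auto simp: quadruple_iff XF.reduced_expression_iff)
qed

text \<open>An equality of records: the letters agree by \<open>flat_letter_XF\<close>, and a
  subgroup generated inside the induced group is the one generated in \<open>grp X\<close>.\<close>

lemma induced_XF:
  assumes "F' \<subseteq> F"
  shows "induced_quadruple XF (flat_index F ` F') = induced_quadruple X F'"
proof -
  let ?b = "flat_index F"
  have fin: "finite F'" using assms finite_subset finite_F by blast
  have word: "word (induced_quadruple XF (?b ` F')) = word (induced_quadruple X F')"
    using assms fin flat_letter_XF[OF assms]
    by (auto simp: word_induced sorted_list_of_set_image[OF strict_mono_on_flat_index[OF finite_F assms]])
  have "?b ` F' \<inter> ?b ` (F \<inter> face X) = ?b ` (F' \<inter> face X)"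
    using assms inj_on_flat_index[of F F] by (auto dest: inj_onD)
  hence "face (induced_quadruple XF (?b ` F')) = (\<lambda>j. flat_index (?b ` F') (?b j)) ` (F' \<inter> face X)"
    by (simp add: face_induced image_image)
  also have "\<dots> = face (induced_quadruple X F')"
    using flat_index_flat_index[OF finite_F assms] assms by (auto simp: face_induced intro!: image_cong)
  finally have face: "face (induced_quadruple XF (?b ` F')) = face (induced_quadruple X F')" .
  have gens: "gens Y = set (word Y)" "elt Y = word_prod (grp Z) (nths (word Y) ({..<length (word Y)} - face Y))"
    if "Y = induced_quadruple Z H" for Y Z :: "'a quadruple" and H
    by (simp_all add: that induced_quadruple_def Let_def)
  have "flat_letter X F' ` F' \<subseteq> carrier (grp XF)"
  proof -
    interpret XF: quad XF by unfold_locales (rule quadruple_XF)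
    have "flat_letter XF (?b ` F') (?b j) \<in> carrier (grp XF)" if "j \<in> F'" for j
      using that assms nth_flat_index[OF finite_F, of j] by (intro XF.flat_letter_carrier) auto
    hence "flat_letter X F' j \<in> carrier (grp XF)" if "j \<in> F'" for j
      using flat_letter_XF[OF assms subsetD[OF assms that]] that by metis
    thus ?thesis by blast
  qed
  hence "generate (grp XF) (flat_letter X F' ` F') = generate (grp X) (flat_letter X F' ` F')"
    using generate_consistent[OF _ subgroup_XF] by (simp add: grp_XF)
  moreover have "set (word (induced_quadruple XF (?b ` F'))) = flat_letter X F' ` F'"
    using fin unfolding word by (simp add: word_induced)
  ultimately have grp: "grp (induced_quadruple XF (?b ` F')) = grp (induced_quadruple X F')"
    using fin unfolding grp_induced[of XF] grp_induced[of X F'] word_induced[symmetric] word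
    by (simp add: grp_XF word_induced)
  show ?thesis
    using word face grp gens(1)[OF HOL.refl] gens(2)[OF HOL.refl, of XF "?b ` F'"] gens(2)[OF HOL.refl, of X F']
    by (intro quadruple.equality) auto
qed

end

section \<open>Commutations\<close>

lemma nth_swap:
  assumes "Suc i < length v" "k < length v"
  shows "v[i := v ! Suc i, Suc i := v ! i] ! k = v ! transpose i (Suc i) k"
  using assms by (auto simp: nth_list_update transpose_def)

lemma swap_swap:
  assumes "Suc i < length v"
  defines "v' \<equiv> v[i := v ! Suc i, Suc i := v ! i]"
  shows "v'[i := v' ! Suc i, Suc i := v' ! i] = v"
proof (rule nth_equalityI)
  fix k assume "k < length (v'[i := v' ! Suc i, Suc i := v' ! i])"
  thus "v'[i := v' ! Suc i, Suc i := v' ! i] ! k = v ! k"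
    using assms(1) by (auto simp: v'_def nth_list_update)
qed (simp add: v'_def)

lemma transpose_Suc_less_iff: "Suc i < n \<Longrightarrow> transpose i (Suc i) k < n \<longleftrightarrow> k < n"
  by (auto simp: transpose_def)

lemma commutes_to_length: "commutes_to G u v p \<Longrightarrow> length v = length u"
  by (induction rule: commutes_to.induct) auto

lemma commutes_to_bij: "commutes_to G u v p \<Longrightarrow> bij p"
proof (induction rule: commutes_to.induct)
  case (swap v p i)
  show ?case by (rule bij_comp[OF swap.IH bij_transpose])
qed (rule bij_id)

lemma commutes_to_less_iff: "commutes_to G u v p \<Longrightarrow> p k < length u \<longleftrightarrow> k < length u"
proof (induction rule: commutes_to.induct)
  case (swap v p i)
  thus ?case using commutes_to_length[OF swap.hyps(1)] by (simp add: transpose_Suc_less_iff)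
qed simp

lemma commutes_to_nth: "commutes_to G u v p \<Longrightarrow> k < length u \<Longrightarrow> v ! p k = u ! k"
proof (induction rule: commutes_to.induct)
  case (swap v p i)
  thus ?case using commutes_to_length[OF swap.hyps(1)] commutes_to_less_iff[OF swap.hyps(1), of k]
    by (simp add: nth_swap transpose_Suc_less_iff)
qed simp

lemma commutes_to_positions:
  assumes "commutes_to G u v p"
  shows "p ` {..<length u} = {..<length u}"
proof (intro equalityI subsetI)
  fix x assume x: "x \<in> {..<length u}"
  obtain k where "x = p k" using commutes_to_bij[OF assms] by (metis bij_pointE)
  thus "x \<in> p ` {..<length u}" using x commutes_to_less_iff[OF assms] by auto
qed (use commutes_to_less_iff[OF assms] in auto)

lemma commutes_to_set:
  assumes "commutes_to G u v p"
  shows "set v = set u"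
proof -
  have "set v = (!) v ` p ` {..<length u}"
    unfolding commutes_to_positions[OF assms] using commutes_to_length[OF assms]
    by (metis atLeast0LessThan nth_image order_refl take_all_iff)
  also have "\<dots> = (!) u ` {..<length u}"
    unfolding image_image using commutes_to_nth[OF assms] by (intro image_cong) auto
  also have "\<dots> = set u"
    by (metis atLeast0LessThan nth_image order_refl take_all_iff)
  finally show ?thesis .
qed

lemma commutes_to_trans:
  "commutes_to G v w q \<Longrightarrow> commutes_to G u v p \<Longrightarrow> commutes_to G u w (q \<circ> p)"
  by (induction rule: commutes_to.induct) (auto simp: comp_assoc intro: commutes_to.swap)

lemma commutes_to_swap:
  "Suc i < length v \<Longrightarrow> v ! i \<noteq> v ! Suc i \<Longrightarrow> v ! i \<otimes>\<^bsub>G\<^esub> v ! Suc i = v ! Suc i \<otimes>\<^bsub>G\<^esub> v ! i \<Longrightarrow>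
    commutes_to G v (v[i := v ! Suc i, Suc i := v ! i]) (transpose i (Suc i))"
  using commutes_to.swap[OF commutes_to.refl, of i v G] by simp

lemma commutes_to_sym: "commutes_to G u v p \<Longrightarrow> commutes_to G v u (inv_into UNIV p)"
proof (induction rule: commutes_to.induct)
  case refl
  show ?case unfolding inv_id by (rule commutes_to.refl)
next
  case (swap v p i)
  define v' where "v' = v[i := v ! Suc i, Suc i := v ! i]"
  have "v' ! i = v ! Suc i" "v' ! Suc i = v ! i" "length v' = length v"
    using swap.hyps(2) by (auto simp: v'_def nth_list_update)
  hence "commutes_to G v' (v'[i := v' ! Suc i, Suc i := v' ! i]) (transpose i (Suc i))"
    using swap.hyps by (intro commutes_to_swap) auto
  hence "commutes_to G v' v (transpose i (Suc i))"
    using swap_swap[OF swap.hyps(2)] by (simp add: v'_def)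
  hence "commutes_to G v' u (inv_into UNIV p \<circ> transpose i (Suc i))" using swap.IH by (rule commutes_to_trans[rotated])
  moreover have "inv_into UNIV (transpose i (Suc i) \<circ> p) = inv_into UNIV p \<circ> transpose i (Suc i)"
    using commutes_to_bij[OF swap.hyps(1)] by (simp add: o_inv_distrib)
  ultimately show ?case by (simp only: v'_def)
qed

lemma commutes_to_map:
  assumes "commutes_to G u v p" "inj_on f (set u)"
    and "\<And>a b. a \<in> set u \<Longrightarrow> b \<in> set u \<Longrightarrow> a \<otimes>\<^bsub>G\<^esub> b = b \<otimes>\<^bsub>G\<^esub> a \<Longrightarrow> f a \<otimes>\<^bsub>H\<^esub> f b = f b \<otimes>\<^bsub>H\<^esub> f a"
  shows "commutes_to H (map f u) (map f v) p"
  using assms(1)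
proof (induction rule: commutes_to.induct)
  case (swap v p i)
  have "v ! i \<in> set u" "v ! Suc i \<in> set u"
    using commutes_to_set[OF swap.hyps(1)] swap.hyps(2) nth_mem by (metis Suc_lessD, metis)
  hence "f (v ! i) \<noteq> f (v ! Suc i)" "f (v ! i) \<otimes>\<^bsub>H\<^esub> f (v ! Suc i) = f (v ! Suc i) \<otimes>\<^bsub>H\<^esub> f (v ! i)"
    using swap.hyps assms(2,3) by (auto dest: inj_onD)
  hence "commutes_to H (map f u) ((map f v)[i := map f v ! Suc i, Suc i := map f v ! i]) (transpose i (Suc i) \<circ> p)"
    by (intro commutes_to.swap[OF swap.IH]) (use swap.hyps(2) in auto)
  thus ?case using swap.hyps(2) by (simp only: map_update nth_map Suc_lessD)
qed (rule commutes_to.refl)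

lemma commutes_to_cong_mult:
  "commutes_to G u v p \<Longrightarrow> (\<otimes>\<^bsub>H\<^esub>) = (\<otimes>\<^bsub>G\<^esub>) \<Longrightarrow> commutes_to H u v p"
  using commutes_to_map[of G u v p id H] by simp

text \<open>If both swapped positions belong to \<open>K\<close>, the two letters commute in the
  product; otherwise the selected subword stays the same.\<close>

lemma word_prod_nths_swap:
  assumes "group G" "set v \<subseteq> carrier G" "Suc i < length v"
    and comm: "v ! i \<otimes>\<^bsub>G\<^esub> v ! Suc i = v ! Suc i \<otimes>\<^bsub>G\<^esub> v ! i"
  shows "word_prod G (nths (v[i := v ! Suc i, Suc i := v ! i]) (transpose i (Suc i) ` K)) = word_prod G (nths v K)"
proof -
  interpret group G by fact
  define a b s t where "a = take i v" and "b = drop (Suc (Suc i)) v" and "s = v ! i" and "t = v ! Suc i"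
  have v: "v = a @ [s, t] @ b" and len: "length a = i"
    using assms(3) by (auto simp: a_def b_def s_def t_def Cons_nth_drop_Suc)
  have v': "v[i := v ! Suc i, Suc i := v ! i] = a @ [t, s] @ b"
    using len unfolding v by (simp add: nth_append list_update_append)
  have mem: "x \<in> transpose i (Suc i) ` K \<longleftrightarrow> transpose i (Suc i) x \<in> K" for x
    by (metis imageE image_eqI transpose_involutory)
  have 1: "nths a (transpose i (Suc i) ` K) = nths a K"
    unfolding nths_eq_map_nth using len
    by (intro arg_cong2[where f = map] refl arg_cong[where f = sorted_list_of_set])
      (auto simp: mem transpose_def)
  have 2: "{j. Suc (Suc (j + length a)) \<in> transpose i (Suc i) ` K} = {j. Suc (Suc (j + length a)) \<in> K}"
    using len by (auto simp: mem)
  have c: "set (nths a K) \<subseteq> carrier G" "set (nths b {j. Suc (Suc (j + length a)) \<in> K}) \<subseteq> carrier G"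
    "s \<in> carrier G" "t \<in> carrier G" "s \<otimes>\<^bsub>G\<^esub> t = t \<otimes>\<^bsub>G\<^esub> s"
    using assms(2) comm set_nths_subset[of a K] set_nths_subset[of b "{j. Suc (Suc (j + length a)) \<in> K}"]
    unfolding v by (auto simp: nth_append len)
  have "word_prod G (nths (a @ [t, s] @ b) (transpose i (Suc i) ` K)) = word_prod G (nths (a @ [s, t] @ b) K)"
    using c by (simp add: nths_append nths_Cons 1 2 mem len word_prod_append[OF is_group] word_prod_closed[OF is_group])
      (simp add: m_assoc[symmetric] word_prod_closed[OF is_group])
  thus ?thesis unfolding v' by (simp only: v[symmetric])
qed

lemma word_prod_commutes_to:
  assumes "commutes_to G u v p" "group G" "set u \<subseteq> carrier G"
  shows "word_prod G (nths v (p ` K)) = word_prod G (nths u K)"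
  using assms(1)
proof (induction rule: commutes_to.induct)
  case (swap v p i)
  have "set v \<subseteq> carrier G" using assms(3) commutes_to_set[OF swap.hyps(1)] by simp
  thus ?case
    using word_prod_nths_swap[OF assms(2) _ swap.hyps(2,4), of "p ` K"] swap.IH by (simp add: image_comp)
qed simp

subsection \<open>Invariance of the flats under a commutation\<close>

locale quad_swap = quad +
  fixes i
  assumes i: "Suc i < length (word X)"
    and ne: "word X ! i \<noteq> word X ! Suc i"
    and comm: "word X ! i \<otimes>\<^bsub>grp X\<^esub> word X ! Suc i = word X ! Suc i \<otimes>\<^bsub>grp X\<^esub> word X ! i"
begin

abbreviation \<tau> where "\<tau> \<equiv> transpose i (Suc i)"

definition Y where
  "Y = X\<lparr>word := (word X)[i := word X ! Suc i, Suc i := word X ! i], face := \<tau> ` face X\<rparr>"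

lemma Y_simps [simp]: "grp Y = grp X" "gens Y = gens X" "elt Y = elt X" "face Y = \<tau> ` face X"
  "word Y = (word X)[i := word X ! Suc i, Suc i := word X ! i]" "positions Y = positions X"
  by (simp_all add: Y_def positions_def)

lemma mem_transpose_image: "x \<in> \<tau> ` K \<longleftrightarrow> \<tau> x \<in> K"
  by (metis imageE image_eqI transpose_involutory)

lemma i_positions: "i \<in> positions X" "Suc i \<in> positions X"
  using i by (auto simp: positions_def)

lemma transpose_positions [simp]: "\<tau> ` positions X = positions X"
  using i by (auto simp: positions_def mem_transpose_image transpose_Suc_less_iff)

lemma word_carrier: "set (word X) \<subseteq> carrier (grp X)"
  using word_lists lists_carrier by blast

lemma quadruple_Y: "quadruple Y"
proof -
  let ?C = "positions X - face X"
  have inj: "inj \<tau>" by simp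
  have C: "positions Y - face Y = \<tau> ` ?C"
    using image_set_diff[OF inj, of "positions X" "face X"] by simp
  have prod: "word_prod (grp X) (nths (word Y) (\<tau> ` ?C)) = word_prod (grp X) (nths (word X) ?C)"
    using word_prod_nths_swap[OF is_group word_carrier i comm] by simp
  have "length (nths (word Y) (positions Y - face Y)) = card (positions Y - face Y)"
    by (auto simp: length_nths positions_def intro!: arg_cong[where f = card])
  also have "\<dots> = card ?C" unfolding C by (simp add: card_image)
  also have "\<dots> = length (nths (word X) ?C)"
    by (auto simp: length_nths positions_def intro!: arg_cong[where f = card])
  finally have len: "length (nths (word Y) (positions Y - face Y)) = length (nths (word X) ?C)" .
  have "set (word Y) = set (word X)"
    using commutes_to_set[OF commutes_to_swap[OF i ne comm]] by simp
  hence wl: "word Y \<in> lists (gens X)" using word_lists by auto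
  hence "nths (word Y) (positions Y - face Y) \<in> lists (gens X)" using set_nths_subset by fastforce
  moreover have "face Y \<subseteq> positions X" using face_sub image_mono[of "face X" "positions X" \<tau>] by simp
  ultimately show ?thesis
    using quadruple C prod len wl unfolding quadruple_iff reduced_expression_def by simp
qed

sublocale Y: quad Y
  by unfold_locales (rule quadruple_Y)

text \<open>For \<open>j \<noteq> Suc i\<close> the initial segment before \<open>j\<close> contains
  both swapped positions or neither, so the swap permutes it.\<close>

lemma prefix_elt_Y:
  assumes "j \<noteq> Suc i"
  shows "Y.prefix_elt (\<tau> ` F) j = prefix_elt F j"
proof -
  have "{..<j} - \<tau> ` face X - \<tau> ` F = \<tau> ` ({..<j} - face X - F)"
    using assms by (auto simp: mem_transpose_image) (auto simp: transpose_def split: if_splits)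
  thus ?thesis unfolding Y.prefix_elt_def prefix_elt_def flat_prefix_def
    using word_prod_nths_swap[OF is_group word_carrier i comm] by simp
qed

text \<open>Distinct commuting involutions have a product of order 2, and
  \<open>cos (pi / 2) = 0\<close>.\<close>

lemma form_0: "coxeter_form (grp X) (simple_root (word X ! i)) (simple_root (word X ! Suc i)) = 0"
  "coxeter_form (grp X) (simple_root (word X ! Suc i)) (simple_root (word X ! i)) = 0"
proof -
  let ?s = "word X ! i" and ?t = "word X ! Suc i"
  note st = i_positions[THEN nth_word] i_positions[THEN nth_word_carrier]
  have "(?s \<bullet> ?t) \<bullet> (?s \<bullet> ?t) = (?s \<bullet> ?t) \<bullet> (?t \<bullet> ?s)" using comm by simp
  also have "\<dots> = ?s \<bullet> (?t \<bullet> ?t) \<bullet> ?s" using st by (simp add: m_assoc)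
  also have "\<dots> = \<one>\<^bsub>grp X\<^esub>" using st S_involution by simp
  finally have "(?s \<bullet> ?t) \<bullet> (?s \<bullet> ?t) = \<one>\<^bsub>grp X\<^esub>" .
  moreover have "?s \<bullet> ?t \<noteq> \<one>\<^bsub>grp X\<^esub>" using ord_ne_1 ord_eq_1 st ne m_closed by metis
  ultimately have "ord (?s \<bullet> ?t) = 2" using ord_eq_2 st by blast
  thus "coxeter_form (grp X) (simple_root ?s) (simple_root ?t) = 0"
    "coxeter_form (grp X) (simple_root ?t) (simple_root ?s) = 0"
    using ord_commute[of ?s ?t] st by (simp_all add: coxeter_form_simple_roots)
qed

text \<open>The prefixes differ at most by one of the two commuting letters, and only for the
  letters at \<open>i\<close> and \<open>Suc i\<close>. Such a letter commutes with the other one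
  and fixes its simple root, since the two roots are orthogonal.\<close>

lemma flat_data_Y:
  assumes "j \<in> positions X"
  shows "flat_letter Y (\<tau> ` F) (\<tau> j) = flat_letter X F j"
    and "flat_root Y (\<tau> ` F) (\<tau> j) = flat_root X F j"
proof -
  let ?s = "word X ! i" and ?t = "word X ! Suc i" and ?u = "prefix_elt F i"
  note st = i_positions[THEN nth_word] i_positions[THEN nth_word_carrier]
  have word: "word Y ! \<tau> j = word X ! j"
    using assms i by (simp add: nth_swap transpose_Suc_less_iff positions_def)
  have conj: "(?u \<bullet> x) \<bullet> y \<bullet> inverse_elt (?u \<bullet> x) = ?u \<bullet> y \<bullet> inverse_elt ?u"
    if "x = ?s \<and> y = ?t \<or> x = ?t \<and> y = ?s" for x y
  proof -
    have c: "x \<in> carrier (grp X)" "y \<in> carrier (grp X)" "x \<bullet> y = y \<bullet> x" using that st comm by auto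
    hence "x \<bullet> (y \<bullet> inverse_elt x) = y" by (simp flip: m_assoc) (simp add: m_assoc)
    thus ?thesis using c by (simp add: inv_mult_group m_assoc) (simp flip: m_assoc)
  qed
  have root: "act (?u \<bullet> x) (simple_root y) = act ?u (simple_root y)"
    if "x = ?s \<and> y = ?t \<or> x = ?t \<and> y = ?s" for x y
    using that st form_0 by (auto simp: act_mult act_generator simple_reflection_def)
  have mem: "i \<in> \<tau> ` K \<longleftrightarrow> Suc i \<in> K" for K by (simp add: mem_transpose_image)
  have "Y.prefix_elt (\<tau> ` F) (Suc i) = (if Suc i \<in> face X \<or> Suc i \<in> F then ?u else ?u \<bullet> ?t)"
    using Y.prefix_elt_Suc[of i "\<tau> ` F"] i_positions i prefix_elt_Y[of i F] by (simp add: mem)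
  moreover have "prefix_elt F (Suc i) = (if i \<in> face X \<or> i \<in> F then ?u else ?u \<bullet> ?s)"
    using prefix_elt_Suc i_positions by simp
  moreover have "Y.prefix_elt (\<tau> ` F) i = ?u" using prefix_elt_Y[of i] by simp
  moreover have "Y.prefix_elt (\<tau> ` F) j = prefix_elt F j" if "j \<noteq> Suc i" using prefix_elt_Y that by simp
  ultimately show "flat_letter Y (\<tau> ` F) (\<tau> j) = flat_letter X F j"
    "flat_root Y (\<tau> ` F) (\<tau> j) = flat_root X F j"
    using word conj[of ?s ?t] conj[of ?t ?s] root[of ?s ?t] root[of ?t ?s] i
    unfolding Y.flat_letter_eq Y.flat_root_eq flat_letter_eq flat_root_eq Y_simps(1,2)
    by (cases "j = i"; cases "j = Suc i"; simp del: Y_simps(5))+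
qed

text \<open>If both swapped positions lie in \<open>F\<close>, they are neighbours in
  \<open>F\<close> and their letters are conjugated by the same prefix, so the induced letters
  commute too. Otherwise the swap is monotone on \<open>F\<close> and the induced word does not
  change.\<close>

lemma commutes_induced:
  assumes F: "F \<subseteq> positions X"
  shows "\<exists>q. commutes_to (grp X) (word (induced_quadruple X F)) (word (induced_quadruple Y (\<tau> ` F))) q \<and>
    (\<forall>k<card F. sorted_list_of_set (\<tau> ` F) ! q k = \<tau> (sorted_list_of_set F ! k))"
proof -
  have fin: "finite F" using F finite_subset finite_positions by blast
  let ?L = "sorted_list_of_set F"
  have L: "?L ! k \<in> F" "?L ! k \<in> positions X" if "k < card F" for k
    using nth_sorted_list_of_set_in[OF that] F by auto
  show ?thesis
  proof (cases "i \<in> F \<and> Suc i \<in> F")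
    case True
    define k where "k = flat_index F i"
    have "{x \<in> F. x < Suc i} = insert i {x \<in> F. x < i}" using True by auto
    hence "flat_index F (Suc i) = Suc k" by (simp add: flat_index_def k_def fin)
    hence k: "?L ! k = i" "?L ! Suc k = Suc i" "Suc k < card F"
      using nth_flat_index[OF fin, of i] nth_flat_index[OF fin, of "Suc i"] True by (auto simp: k_def)
    have inj: "?L ! a = ?L ! b \<longleftrightarrow> a = b" if "a < card F" "b < card F" for a b
      using that by (metis distinct_sorted_list_of_set length_sorted_list_of_set nth_eq_iff_index_eq)
    have tr: "?L ! transpose k (Suc k) m = \<tau> (?L ! m)" if "m < card F" for m
    proof (cases "m = k \<or> m = Suc k")
      case False
      hence "?L ! m \<noteq> i" "?L ! m \<noteq> Suc i" using inj[OF that, of k] inj[OF that, of "Suc k"] k by auto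
      thus ?thesis using False by simp
    qed (use k in auto)
    have \<tau>F: "\<tau> ` F = F" using True by (auto simp: mem_transpose_image transpose_def split: if_splits)
    let ?w = "word (induced_quadruple X F)"
    have len: "length ?w = card F" by (simp add: word_induced)
    have w: "?w ! m = flat_letter X F (?L ! m)" if "m < card F" for m
      using that by (simp add: word_induced)
    have pre: "prefix_elt F (Suc i) = prefix_elt F i" using prefix_elt_Suc[of i F] i_positions True by simp
    define u where "u = prefix_elt F i"
    have u: "u \<in> carrier (grp X)" by (simp add: u_def)
    note st = i_positions[THEN nth_word_carrier]
    have ab: "flat_letter X F i = u \<bullet> word X ! i \<bullet> inverse_elt u"
      "flat_letter X F (Suc i) = u \<bullet> word X ! Suc i \<bullet> inverse_elt u"
      by (simp_all add: flat_letter_eq pre u_def)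
    have mult: "(u \<bullet> x \<bullet> inverse_elt u) \<bullet> (u \<bullet> y \<bullet> inverse_elt u) = u \<bullet> (x \<bullet> y) \<bullet> inverse_elt u"
      if "x \<in> carrier (grp X)" "y \<in> carrier (grp X)" for x y
    proof -
      have "inverse_elt u \<bullet> (u \<bullet> z) = z" if "z \<in> carrier (grp X)" for z
        using that u by (simp flip: m_assoc)
      thus ?thesis using that u by (simp add: m_assoc)
    qed
    have "flat_letter X F i \<noteq> flat_letter X F (Suc i)"
      using ne st u by (simp add: ab)
    moreover have "flat_letter X F i \<bullet> flat_letter X F (Suc i) = flat_letter X F (Suc i) \<bullet> flat_letter X F i"
      using st comm by (simp add: ab mult)
    ultimately have "commutes_to (grp X) ?w (?w[k := ?w ! Suc k, Suc k := ?w ! k]) (transpose k (Suc k))"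
      using k len w[of k] w[of "Suc k"] by (intro commutes_to_swap) auto
    moreover have "word (induced_quadruple Y (\<tau> ` F)) = ?w[k := ?w ! Suc k, Suc k := ?w ! k]"
    proof (rule nth_equalityI)
      fix m assume "m < length (word (induced_quadruple Y (\<tau> ` F)))"
      hence m: "m < card F" by (simp add: word_induced \<tau>F)
      have "word (induced_quadruple Y (\<tau> ` F)) ! m = flat_letter Y (\<tau> ` F) (\<tau> (\<tau> (?L ! m)))"
        using m by (simp add: word_induced \<tau>F)
      also have "\<dots> = flat_letter X F (\<tau> (?L ! m))"
        using L(2)[OF m] transpose_positions by (intro flat_data_Y) blast
      also have "\<dots> = ?w ! transpose k (Suc k) m"
        using m k(3) tr[OF m] by (simp add: w transpose_Suc_less_iff)
      also have "\<dots> = ?w[k := ?w ! Suc k, Suc k := ?w ! k] ! m"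
        using m k(3) len by (simp add: nth_swap)
      finally show "word (induced_quadruple Y (\<tau> ` F)) ! m = ?w[k := ?w ! Suc k, Suc k := ?w ! k] ! m" .
    qed (simp add: word_induced \<tau>F)
    ultimately show ?thesis using tr unfolding \<tau>F by metis
  next
    case False
    have "strict_mono_on F \<tau>"
      by (rule strict_mono_onI) (use False in \<open>auto simp: transpose_def not_less_eq less_Suc_eq\<close>)
    hence sorted: "sorted_list_of_set (\<tau> ` F) = map \<tau> ?L" using fin by (rule sorted_list_of_set_image)
    have "word (induced_quadruple Y (\<tau> ` F)) = word (induced_quadruple X F)"
      using F fin by (auto simp: word_induced sorted flat_data_Y)
    thus ?thesis using commutes_to.refl[of "grp X" "word (induced_quadruple X F)"]
      by (intro exI[of _ id]) (simp add: sorted)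
  qed
qed

end

text \<open>The claims go through the induction together, because the next commutation is applied to
  the quadruple reached so far, which must be known to be one. In the last claim \<open>q\<close> is
  \<open>p\<close> read in the numberings of the two sets of positions.\<close>

lemma (in quad) commutes_to_flat_data:
  assumes "commutes_to (grp X) (word X) v p"
  defines "Y \<equiv> X\<lparr>word := v, face := p ` face X\<rparr>"
  shows "quadruple Y \<and>
    (\<forall>F. \<forall>j\<in>positions X. flat_letter Y (p ` F) (p j) = flat_letter X F j \<and>
      flat_root Y (p ` F) (p j) = flat_root X F j) \<and>
    (\<forall>F\<subseteq>positions X. \<exists>q. commutes_to (grp X) (word (induced_quadruple X F)) (word (induced_quadruple Y (p ` F))) q \<and>
      (\<forall>k<card F. sorted_list_of_set (p ` F) ! q k = p (sorted_list_of_set F ! k)))"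
  unfolding Y_def using assms(1)
proof (induction rule: commutes_to.induct)
  case refl
  show ?case using quadruple commutes_to.refl by fastforce
next
  case (swap v p i)
  define Z where "Z = X\<lparr>word := v, face := p ` face X\<rparr>"
  note IH = swap.IH[folded Z_def]
  have Z: "quadruple Z" using IH by blast
  have len: "length v = length (word X)" using commutes_to_length[OF swap.hyps(1)] .
  interpret Z: quad_swap Z i
    by unfold_locales (use Z swap.hyps in \<open>auto simp: Z_def\<close>)
  have pos: "positions Z = positions X" by (simp add: Z_def positions_def len)
  have pj: "p j \<in> positions Z \<longleftrightarrow> j \<in> positions X" for j
    unfolding pos using commutes_to_less_iff[OF swap.hyps(1)] by (simp add: positions_def)
  have ZY: "Z.Y = X\<lparr>word := v[i := v ! Suc i, Suc i := v ! i], face := (transpose i (Suc i) \<circ> p) ` face X\<rparr>"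
    by (simp add: Z.Y_def) (simp add: Z_def image_comp)
  show ?case unfolding ZY[symmetric]
  proof (intro conjI allI ballI impI)
    show "quadruple Z.Y" by (rule Z.quadruple_Y)
    fix F j assume j: "j \<in> positions X"
    show "flat_letter Z.Y ((transpose i (Suc i) \<circ> p) ` F) ((transpose i (Suc i) \<circ> p) j) = flat_letter X F j"
      "flat_root Z.Y ((transpose i (Suc i) \<circ> p) ` F) ((transpose i (Suc i) \<circ> p) j) = flat_root X F j"
      using IH Z.flat_data_Y[of "p j" "p ` F"] pj[of j] j by (simp_all add: image_comp)
  next
    fix F assume F: "F \<subseteq> positions X"
    obtain q where q: "commutes_to (grp X) (word (induced_quadruple X F)) (word (induced_quadruple Z (p ` F))) q"
      "\<And>k. k < card F \<Longrightarrow> sorted_list_of_set (p ` F) ! q k = p (sorted_list_of_set F ! k)"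
      using IH F by blast
    have "p ` F \<subseteq> positions Z" using F pj by auto
    from Z.commutes_induced[OF this] obtain q' where
      q': "commutes_to (grp Z) (word (induced_quadruple Z (p ` F))) (word (induced_quadruple Z.Y (transpose i (Suc i) ` p ` F))) q'"
      "\<And>k. k < card (p ` F) \<Longrightarrow> sorted_list_of_set (transpose i (Suc i) ` p ` F) ! q' k
        = transpose i (Suc i) (sorted_list_of_set (p ` F) ! k)" by blast
    have grp: "grp Z = grp X" by (simp add: Z_def)
    have card: "card (p ` F) = card F"
      using commutes_to_bij[OF swap.hyps(1)] by (metis bij_is_inj card_image inj_on_subset subset_UNIV)
    have "q k < card F" if "k < card F" for k
      using commutes_to_less_iff[OF q(1), of k] that by (simp add: word_induced)
    thus "\<exists>q. commutes_to (grp X) (word (induced_quadruple X F))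
          (word (induced_quadruple Z.Y ((transpose i (Suc i) \<circ> p) ` F))) q \<and>
        (\<forall>k<card F. sorted_list_of_set ((transpose i (Suc i) \<circ> p) ` F) ! q k
          = (transpose i (Suc i) \<circ> p) (sorted_list_of_set F ! k))"
      using commutes_to_trans[OF q'(1)[unfolded grp] q(1)] q(2) q'(2)
      by (intro exI[of _ "q' \<circ> q"]) (auto simp: image_comp card)
  qed
qed

section \<open>Equivalences of quadruples\<close>

locale coxeter_iso = A: coxeter G S + B: coxeter H T
  for G :: "'g monoid" and S and H :: "'g monoid" and T +
  fixes \<phi> :: "'g \<Rightarrow> 'g"
  assumes iso: "\<phi> \<in> iso G H" and gens: "\<phi> ` S = T"
begin

lemma inj: "inj_on \<phi> (carrier G)"
  using iso by (auto simp: iso_def bij_betw_def)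

sublocale hom: group_hom G H \<phi>
  by (intro group_hom.intro group_hom_axioms.intro A.is_group B.is_group) (use iso in \<open>simp add: iso_def\<close>)

lemma word_prod_map:
  assumes "set w \<subseteq> carrier G"
  shows "word_prod H (map \<phi> w) = \<phi> (word_prod G w)"
  using assms by (induction w) auto

lemma ord_image:
  assumes "x \<in> carrier G"
  shows "group.ord H (\<phi> x) = group.ord G x"
proof -
  have "\<phi> x [^]\<^bsub>H\<^esub> n = \<one>\<^bsub>H\<^esub> \<longleftrightarrow> x [^]\<^bsub>G\<^esub> n = \<one>\<^bsub>G\<^esub>" for n :: nat
    using assms inj hom.hom_nat_pow[OF assms, of n] hom.hom_one
    by (metis A.nat_pow_closed A.one_closed inj_onD)
  thus ?thesis using A.pow_eq_id[OF assms] B.ord_unique[OF hom.hom_closed[OF assms]] by simp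
qed

definition L where "L v = (\<Sum>s\<in>S. Poly_Mapping.lookup v s *\<^sub>R simple_root (\<phi> s))"

lemma linear_L: "linear L"
  by (rule linearI) (auto simp: L_def lookup_add scaleR_add_left sum.distrib scaleR_sum_right)

lemma L_simple_root: "s \<in> S \<Longrightarrow> L (simple_root s) = simple_root (\<phi> s)"
proof -
  assume s: "s \<in> S"
  have "L (simple_root s) = (\<Sum>x\<in>S. if x = s then simple_root (\<phi> x) else 0)"
    unfolding L_def by (intro sum.cong) (auto simp: lookup_simple_root)
  thus ?thesis using s A.finite_S by simp
qed

lemma L_isometry:
  assumes "u \<in> A.V" "v \<in> A.V"
  shows "coxeter_form H (L u) (L v) = coxeter_form G u v"
  by (rule coxeter_form_eq_on_span[OF linear_L _ assms])
    (use A.in_carrier in \<open>auto simp: L_simple_root coxeter_form_simple_roots ord_image simp flip: hom.hom_mult\<close>)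

lemma L_word_action:
  assumes "set w \<subseteq> S" "v \<in> A.V"
  shows "L (word_action G w v) = word_action H (map \<phi> w) (L v)"
  using assms(1)
proof (induction w)
  case (Cons s w)
  define x where "x = word_action G w v"
  have x: "x \<in> A.V" unfolding x_def using Cons.prems by (intro A.word_action_in_V assms(2)) auto
  have "L (simple_reflection G s x) = simple_reflection H (\<phi> s) (L x)"
    using Cons.prems L_isometry[OF A.simple_root_in_V x, of s]
    by (simp add: simple_reflection_def linear_diff[OF linear_L] linear_scale[OF linear_L] L_simple_root)
  thus ?case using Cons by (simp add: x_def)
qed simp

end

locale quad_equiv = A: quad A + B: quad B for A B :: "'g quadruple" +
  fixes \<phi> :: "'g \<Rightarrow> 'g" and p
  assumes equiv: "equivalence_via A B \<phi> p"

sublocale quad_equiv \<subseteq> coxeter_iso "grp A" "gens A" "grp B" "gens B" \<phi>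
  by unfold_locales (use equiv in \<open>simp_all add: equivalence_via_def\<close>)

context quad_equiv
begin

text \<open>An equivalence splits into a relabelling by \<open>\<phi>\<close>, which leaves all
  positions in place, and commutations in the group of \<open>B\<close>. \<open>A'\<close> is the
  quadruple in between.\<close>

definition A' where
  "A' = \<lparr>grp = grp B, gens = gens B, word = map \<phi> (word A), elt = \<phi> (elt A), face = face A\<rparr>"

lemma A'_simps [simp]: "grp A' = grp B" "gens A' = gens B" "word A' = map \<phi> (word A)"
  "elt A' = \<phi> (elt A)" "face A' = face A" "positions A' = positions A"
  by (simp_all add: A'_def positions_def)

lemma word_prod_image: "set w \<subseteq> gens A \<Longrightarrow> word_prod (grp B) (map \<phi> w) = \<phi> (word_prod (grp A) w)"
  using A.S_carrier by (intro word_prod_map) auto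

lemma quadruple_A': "quadruple A'"
proof -
  let ?w = "nths (word A) (positions A - face A)"
  have w: "reduced_expression (grp A) (gens A) ?w (elt A)" using A.quadruple by (simp add: quadruple_iff)
  have ws: "set ?w \<subseteq> gens A" using w by (auto simp: reduced_expression_def)
  have elt: "elt A \<in> carrier (grp A)" using A.quadruple by (simp add: quadruple_def)
  have "length ?w \<le> length v"
    if v: "v \<in> lists (gens B)" "word_prod (grp B) v = \<phi> (elt A)" for v
  proof -
    have "v \<in> map \<phi> ` lists (gens A)" using v gens by (metis lists_image)
    then obtain u where u: "set u \<subseteq> gens A" "v = map \<phi> u" by auto
    have "word_prod (grp A) u \<in> carrier (grp A)" using u A.S_carrier by (intro word_prod_closed[OF A.is_group]) auto
    hence "word_prod (grp A) u = elt A"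
      using v(2) word_prod_image[OF u(1)] elt inj unfolding u(2) by (auto dest: inj_onD)
    thus ?thesis using w u by (auto simp: reduced_expression_def)
  qed
  moreover have "set (nths (map \<phi> (word A)) (positions A - face A)) \<subseteq> gens B"
    using ws gens by (auto simp: nths_map)
  moreover have "set (map \<phi> (word A)) \<subseteq> gens B" using A.word_lists gens by auto
  ultimately show ?thesis
    using w word_prod_image[OF ws] A.face_sub B.coxeter_system
    by (auto simp: quadruple_iff reduced_expression_def nths_map)
qed

sublocale A': quad A'
  by unfold_locales (rule quadruple_A')

lemma commutes: "commutes_to (grp B) (map \<phi> (word A)) (word B) p"
  and elt_B: "elt B = \<phi> (elt A)" and face_B: "face B = p ` face A"
  using equiv by (auto simp: equivalence_via_def)

lemma bij_p: "bij p"
  using commutes by (rule commutes_to_bij)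

lemma image_positions: "p ` positions A = positions B"
  using commutes_to_positions[OF commutes] commutes_to_length[OF commutes] by (simp add: positions_def)

lemma nth_word_B: "k \<in> positions A \<Longrightarrow> word B ! p k = \<phi> (word A ! k)"
  using commutes_to_nth[OF commutes] by (simp add: positions_def)

lemma flat_data_A':
  assumes "j \<in> positions A"
  shows "flat_letter A' F j = \<phi> (flat_letter A F j)" and "flat_root A' F j = L (flat_root A F j)"
proof -
  have prefix: "flat_prefix A' F j = map \<phi> (flat_prefix A F j)" by (simp add: flat_prefix_def nths_map)
  have ps: "set (flat_prefix A F j) \<subseteq> gens A" using A.flat_prefix_lists by auto
  have word: "word A' ! j = \<phi> (word A ! j)" using assms by (simp add: positions_def)
  have "A'.prefix_elt F j = \<phi> (A.prefix_elt F j)"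
    using word_prod_image[OF ps] by (simp add: A'.prefix_elt_def A.prefix_elt_def prefix)
  thus "flat_letter A' F j = \<phi> (flat_letter A F j)"
    unfolding A'.flat_letter_eq A.flat_letter_eq word using A.nth_word_carrier[OF assms] by simp
  show "flat_root A' F j = L (flat_root A F j)"
    unfolding flat_root_def prefix word using A.nth_word[OF assms] A.simple_root_in_V
    by (simp add: L_word_action[OF ps] L_simple_root)
qed

lemma B_eq: "A'\<lparr>word := word B, face := p ` face A'\<rparr> = B"
  using elt_B face_B by (simp add: A'_def)

lemma flat_data:
  assumes "j \<in> positions A"
  shows flat_letter_equiv: "flat_letter B (p ` F) (p j) = \<phi> (flat_letter A F j)"
    and flat_root_equiv: "flat_root B (p ` F) (p j) = L (flat_root A F j)"
  using A'.commutes_to_flat_data[of "word B" p] commutes assms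
  unfolding B_eq by (simp_all add: flat_data_A')

text \<open>One \<open>\<phi>\<close> serves all sets of positions, since it maps the letters for
  \<open>F\<close> to the letters for the image of \<open>F\<close> and hence one generated subgroup
  onto the other.\<close>

lemma equivalence_induced:
  assumes F: "F \<subseteq> positions A"
  shows "\<exists>q. equivalence_via (induced_quadruple A F) (induced_quadruple B (p ` F)) \<phi> q \<and>
    (\<forall>k<card F. sorted_list_of_set (p ` F) ! q k = p (sorted_list_of_set F ! k))"
proof -
  have "\<exists>q. commutes_to (grp B) (word (induced_quadruple A' F)) (word (induced_quadruple B (p ` F))) q \<and>
      (\<forall>k<card F. sorted_list_of_set (p ` F) ! q k = p (sorted_list_of_set F ! k))"
    using A'.commutes_to_flat_data[of "word B" p] commutes F unfolding B_eq by simp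
  then obtain q where q: "commutes_to (grp B) (word (induced_quadruple A' F)) (word (induced_quadruple B (p ` F))) q"
    "\<And>k. k < card F \<Longrightarrow> sorted_list_of_set (p ` F) ! q k = p (sorted_list_of_set F ! k)" by blast
  let ?AF = "induced_quadruple A F" and ?BF = "induced_quadruple B (p ` F)"
  have fin: "finite F" "finite (p ` F)" using F finite_subset finite_positions by blast+
  have card: "card (p ` F) = card F"
    using bij_p by (metis bij_is_inj card_image inj_on_subset subset_UNIV)
  have word: "word (induced_quadruple A' F) = map \<phi> (word ?AF)"
    using F fin by (auto simp: word_induced flat_data_A')
  have letters: "flat_letter A F ` F \<subseteq> carrier (grp A)" using F by auto
  have lettersB: "flat_letter B (p ` F) ` p ` F = \<phi> ` flat_letter A F ` F"
    unfolding image_image using F by (intro image_cong) (auto simp: flat_letter_equiv)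
  have gens: "gens ?AF = flat_letter A F ` F" "gens ?BF = \<phi> ` flat_letter A F ` F"
    using fin lettersB by (simp_all add: gens_induced)
  have car: "carrier (grp ?AF) = generate (grp A) (flat_letter A F ` F)"
    "carrier (grp ?BF) = \<phi> ` generate (grp A) (flat_letter A F ` F)"
    using fin lettersB hom.generate_img[OF letters] by (simp_all add: grp_induced)
  have sub: "carrier (grp ?AF) \<subseteq> carrier (grp A)"
    unfolding car using A.generate_incl[OF letters] .
  have "\<phi> \<in> iso (grp ?AF) (grp ?BF)"
  proof -
    have "\<phi> (x \<otimes>\<^bsub>grp ?AF\<^esub> y) = \<phi> x \<otimes>\<^bsub>grp ?BF\<^esub> \<phi> y" if "x \<in> carrier (grp ?AF)" "y \<in> carrier (grp ?AF)" for x y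
      using hom.hom_mult[OF subsetD[OF sub that(1)] subsetD[OF sub that(2)]] by (simp add: grp_induced)
    moreover have "bij_betw \<phi> (carrier (grp ?AF)) (carrier (grp ?BF))"
      using inj_on_subset[OF inj sub] unfolding car by (simp add: bij_betw_def)
    ultimately show ?thesis by (auto simp: iso_def hom_def bij_betw_def)
  qed
  moreover have comm: "commutes_to (grp ?BF) (map \<phi> (word ?AF)) (word ?BF) q"
    by (rule commutes_to_cong_mult[OF q(1)[unfolded word]]) (simp add: grp_induced)
  have faceB: "face ?BF = q ` face ?AF"
  proof -
    have "flat_index (p ` F) (p j) = q (flat_index F j)" if j: "j \<in> F" for j
    proof -
      have k: "flat_index F j < card F" using nth_flat_index[OF fin(1) j] by simp
      have "q (flat_index F j) < card (p ` F)"
        using commutes_to_less_iff[OF comm] k by (simp add: word_induced card)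
      thus ?thesis using q(2)[OF k] nth_flat_index[OF fin(1) j] flat_index_nth by metis
    qed
    moreover have "p ` F \<inter> p ` face A = p ` (F \<inter> face A)"
      using bij_p by (simp add: image_Int bij_is_inj)
    ultimately show ?thesis unfolding face_induced face_B by (simp add: image_image)
  qed
  moreover have "\<phi> (elt ?AF) = elt ?BF"
  proof -
    let ?C = "{..<card F} - face ?AF"
    have lenB: "length (word ?BF) = card F" by (simp add: word_induced card)
    have "q ` ?C = {..<card F} - face ?BF"
      using commutes_to_positions[OF comm] commutes_to_bij[OF comm]
      by (simp add: image_set_diff bij_is_inj faceB word_induced)
    hence "word_prod (grp B) (nths (word ?BF) ({..<card F} - face ?BF)) =
        word_prod (grp B) (nths (map \<phi> (word ?AF)) ?C)"
      using word_prod_commutes_to[OF q(1)[unfolded word] B.is_group, of ?C] letters fin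
      by (force simp: word_induced)
    also have "\<dots> = \<phi> (word_prod (grp A) (nths (word ?AF) ?C))"
    proof -
      have "set (nths (word ?AF) ?C) \<subseteq> carrier (grp A)"
        using letters fin set_nths_subset[of "word ?AF" ?C] by (auto simp: word_induced)
      thus ?thesis unfolding nths_map by (rule word_prod_map)
    qed
    finally show ?thesis
      by (simp add: induced_quadruple_def Let_def card)
  qed
  moreover note faceB
  ultimately have "equivalence_via ?AF ?BF \<phi> q" using gens comm by (simp add: equivalence_via_def)
  thus ?thesis using q(2) by blast
qed

end

lemma equivalence_via_refl: "equivalence_via X X id id"
  using commutes_to.refl by (simp add: equivalence_via_def iso_def hom_def)

lemma equivalence_via_trans:
  assumes "equivalence_via X Y \<phi> p" "equivalence_via Y Z \<psi> q"
    and "word X \<in> lists (gens X)" "gens X \<subseteq> carrier (grp X)" "group (grp X)" "group (grp Y)" "group (grp Z)"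
  shows "equivalence_via X Z (\<psi> \<circ> \<phi>) (q \<circ> p)"
proof -
  note XY = assms(1)[unfolded equivalence_via_def] and YZ = assms(2)[unfolded equivalence_via_def]
  have "\<psi> \<circ> \<phi> \<in> iso (grp X) (grp Z)" using XY YZ by (auto intro: iso_set_trans)
  moreover have "commutes_to (grp Z) (map (\<psi> \<circ> \<phi>) (word X)) (word Z) (q \<circ> p)"
  proof (rule commutes_to_trans)
    have sub: "set (map \<phi> (word X)) \<subseteq> carrier (grp Y)"
      using XY assms(3,4) by (auto simp: iso_def hom_def)
    have "commutes_to (grp Z) (map \<psi> (map \<phi> (word X))) (map \<psi> (word Y)) p"
    proof (rule commutes_to_map[of "grp Y"])
      show "inj_on \<psi> (set (map \<phi> (word X)))"
        using YZ sub by (auto simp: iso_def bij_betw_def intro: inj_on_subset)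
      fix a b assume "a \<in> set (map \<phi> (word X))" "b \<in> set (map \<phi> (word X))"
        "a \<otimes>\<^bsub>grp Y\<^esub> b = b \<otimes>\<^bsub>grp Y\<^esub> a"
      moreover from this have "a \<in> carrier (grp Y)" "b \<in> carrier (grp Y)" using sub by blast+
      moreover have "\<psi> \<in> hom (grp Y) (grp Z)" using YZ iso_imp_homomorphism by blast
      ultimately show "\<psi> a \<otimes>\<^bsub>grp Z\<^esub> \<psi> b = \<psi> b \<otimes>\<^bsub>grp Z\<^esub> \<psi> a"
        using hom_mult by metis
    qed (use XY in simp)
    thus "commutes_to (grp Z) (map (\<psi> \<circ> \<phi>) (word X)) (map \<psi> (word Y)) p" by simp
  qed (use YZ in simp)
  moreover have "(\<psi> \<circ> \<phi>) ` gens X = gens Z" using XY YZ by (metis image_comp)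
  moreover have "(\<psi> \<circ> \<phi>) (elt X) = elt Z" using XY YZ by simp
  moreover have "face Z = (q \<circ> p) ` face X" using XY YZ by (metis image_comp)
  ultimately show ?thesis unfolding equivalence_via_def by (intro conjI)
qed

lemma equivalence_via_sym:
  assumes "quadruple X" "quadruple Y" "equivalence_via X Y \<phi> p"
  shows "equivalence_via Y X (inv_into (carrier (grp X)) \<phi>) (inv_into UNIV p)"
proof -
  interpret quad_equiv X Y \<phi> p by unfold_locales fact+
  let ?\<psi> = "inv_into (carrier (grp X)) \<phi>"
  have inv: "?\<psi> (\<phi> x) = x" if "x \<in> carrier (grp X)" for x using inj that by simp
  have iso': "?\<psi> \<in> iso (grp Y) (grp X)" using A.iso_set_sym[OF iso] .
  have word: "map ?\<psi> (map \<phi> (word X)) = word X"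
    using A.word_lists A.S_carrier by (auto intro!: map_idI inv)
  have "commutes_to (grp X) (map ?\<psi> (word Y)) (map ?\<psi> (map \<phi> (word X))) (inv_into UNIV p)"
  proof (rule commutes_to_map[OF commutes_to_sym[OF commutes]])
    have sub: "set (word Y) \<subseteq> carrier (grp Y)" using B.word_lists B.lists_carrier by blast
    thus "inj_on ?\<psi> (set (word Y))"
      using iso' by (auto simp: iso_def bij_betw_def intro: inj_on_subset)
    fix a b assume "a \<in> set (word Y)" "b \<in> set (word Y)" "a \<otimes>\<^bsub>grp Y\<^esub> b = b \<otimes>\<^bsub>grp Y\<^esub> a"
    moreover from this have "a \<in> carrier (grp Y)" "b \<in> carrier (grp Y)" using sub by blast+
    ultimately show "?\<psi> a \<otimes>\<^bsub>grp X\<^esub> ?\<psi> b = ?\<psi> b \<otimes>\<^bsub>grp X\<^esub> ?\<psi> a"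
      using hom_mult[OF iso_imp_homomorphism[OF iso']] by metis
  qed
  moreover have "?\<psi> ` gens Y = gens X"
    unfolding gens[symmetric] using A.S_carrier inj by (simp add: inv_into_image_cancel)
  moreover have "elt X \<in> carrier (grp X)" using A.quadruple by (simp add: quadruple_def)
  moreover have "inv_into UNIV p ` face Y = face X"
    unfolding face_B using bij_p by (simp add: bij_is_inj image_inv_f_f)
  ultimately show ?thesis
    using iso' word inv elt_B unfolding equivalence_via_def by simp
qed

section \<open>Equivalences of flats\<close>

text \<open>
  The data of a morphism in terms of positions: \<open>P\<close> maps the positions in \<open>F\<close> to those in \<open>F'\<close>,
  and \<open>h\<close> is any linear extension of the induced isomorphism.
\<close>

definition flat_equiv ::
  "'g quadruple \<Rightarrow> nat set \<Rightarrow> 'g quadruple \<Rightarrow> nat set \<Rightarrow> (nat \<Rightarrow> nat) \<Rightarrow> ('g vec \<Rightarrow> 'g vec) \<Rightarrow> bool" where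
  "flat_equiv X F Y F' P h \<longleftrightarrow> linear h \<and> (\<forall>i\<in>F. h (flat_root X F i) = flat_root Y F' (P i)) \<and>
     (\<exists>\<phi> p. equivalence_via (induced_quadruple X F) (induced_quadruple Y F') \<phi> p \<and>
       (\<forall>k<card F. sorted_list_of_set F' ! p k = P (sorted_list_of_set F ! k)))"

lemma irreducible_flat_finite: "irreducible_flat X F \<Longrightarrow> finite F"
  unfolding irreducible_flat_def flat_def flat_of_def using finite_positions by auto

lemma subword_morphism_iff:
  "(F, F', l) \<in> subword_morphisms X Y \<longleftrightarrow> irreducible_flat X F \<and> irreducible_flat Y F' \<and>
     (\<exists>P h. flat_equiv X F Y F' P h \<and> l = restrict h (root_span X F))"
  (is "?A \<longleftrightarrow> ?B")
proof
  assume ?A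
  then obtain \<phi> p h where irr: "irreducible_flat X F" "irreducible_flat Y F'"
    and eq: "equivalence_via (induced_quadruple X F) (induced_quadruple Y F') \<phi> p"
    and h: "linear h" "l = restrict h (root_span X F)"
      "\<And>k. k < card F \<Longrightarrow> h (flat_root X F (sorted_list_of_set F ! k)) = flat_root Y F' (sorted_list_of_set F' ! p k)"
    by (auto simp: subword_morphisms_def induced_linear_map_def)
  note fin = irreducible_flat_finite[OF irr(1)]
  \<comment> \<open>The bijection \<open>p\<close> acts on ranks; the numberings of the two flats
    turn it into a map of positions.\<close>
  have "flat_equiv X F Y F' (\<lambda>i. sorted_list_of_set F' ! p (flat_index F i)) h"
    unfolding flat_equiv_def using h(1) h(3)[OF nth_flat_index(2)[OF fin]] nth_flat_index(1)[OF fin] eq flat_index_nth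
    by (intro conjI ballI exI[of _ \<phi>] exI[of _ p]) auto
  thus ?B using irr h(2) by blast
next
  assume ?B
  thus ?A unfolding subword_morphisms_def induced_linear_map_def flat_equiv_def
    using nth_sorted_list_of_set_in[of _ F] by simp metis
qed

text \<open>The source of the zero morphism: both induced groups are trivial and both induced words
  are empty.\<close>

lemma flat_equiv_empty: "flat_equiv X {} Y {} P id"
  if "group (grp X)" "group (grp Y)" for P
proof -
  have gen: "generate (grp Z) {} = {\<one>\<^bsub>grp Z\<^esub>}" if "group (grp Z)" for Z :: "'g quadruple"
    using group.generate_empty[OF that] .
  have "monoid (grp X)" "monoid (grp Y)" using that group.is_monoid by auto
  hence "equivalence_via (induced_quadruple X {}) (induced_quadruple Y {}) (\<lambda>_. \<one>\<^bsub>grp Y\<^esub>) id"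
    using commutes_to.refl gen[OF that(1)] gen[OF that(2)]
    by (simp add: equivalence_via_def induced_quadruple_def iso_def hom_def bij_betw_def monoid.l_one
        monoid.one_closed)
  thus ?thesis unfolding flat_equiv_def
    by (intro conjI exI[of _ "\<lambda>_. \<one>\<^bsub>grp Y\<^esub>"] exI[of _ id]) (auto intro: linear_id)
qed

locale flat_pair = X: realized_flat X F + Y: realized_flat Y F' for X :: "'g quadruple" and F and Y :: "'g quadruple" and F' +
  fixes P h
  assumes flat_equiv: "flat_equiv X F Y F' P h"
begin

lemma linear_h: "linear h"
  using flat_equiv by (simp add: flat_equiv_def)

lemma equivalence_ex:
  obtains \<phi> p where "equivalence_via X.XF Y.XF \<phi> p" "quad_equiv X.XF Y.XF \<phi> p"
    "\<And>i. i \<in> F \<Longrightarrow> P i \<in> F' \<and> p (flat_index F i) = flat_index F' (P i)" "card F = card F'"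
proof -
  obtain \<phi> p where eq: "equivalence_via X.XF Y.XF \<phi> p"
    and P: "\<And>k. k < card F \<Longrightarrow> sorted_list_of_set F' ! p k = P (sorted_list_of_set F ! k)"
    using flat_equiv by (auto simp: flat_equiv_def)
  interpret E: quad_equiv X.XF Y.XF \<phi> p
    by unfold_locales (use X.quadruple_XF Y.quadruple_XF eq in auto)
  have img: "p ` {..<card F} = {..<card F'}" using E.image_positions by simp
  have "P i \<in> F' \<and> p (flat_index F i) = flat_index F' (P i)" if "i \<in> F" for i
  proof -
    have k: "flat_index F i < card F" "sorted_list_of_set F ! flat_index F i = i"
      using nth_flat_index[OF X.finite_F that] by auto
    hence pk: "p (flat_index F i) < card F'" using img by blast
    thus ?thesis using P[OF k(1)] k(2) nth_sorted_list_of_set_in[OF pk] flat_index_nth[OF pk] by simp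
  qed
  moreover have "card F = card F'"
    using card_image[OF inj_on_subset[OF bij_is_inj[OF E.bij_p] subset_UNIV], of "{..<card F}"] img by simp
  ultimately show thesis using that eq E.quad_equiv_axioms by blast
qed

lemma bij_P: "bij_betw P F F'" and P_face: "P ` (F \<inter> face X) = F' \<inter> face Y"
proof -
  obtain \<phi> p where "quad_equiv X.XF Y.XF \<phi> p"
    and p: "\<And>i. i \<in> F \<Longrightarrow> P i \<in> F'" "\<And>i. i \<in> F \<Longrightarrow> p (flat_index F i) = flat_index F' (P i)"
    using equivalence_ex by metis
  then interpret E: quad_equiv X.XF Y.XF \<phi> p by simp
  note inj_b = inj_on_flat_index[OF X.finite_F order_refl]
    and inj_b' = inj_on_flat_index[OF Y.finite_F order_refl]
  have img: "flat_index F' ` P ` H = p ` flat_index F ` H" if "H \<subseteq> F" for H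
    using that p(2) by (auto simp: image_image intro!: image_cong)
  have sub: "P ` H \<subseteq> F'" if "H \<subseteq> F" for H using that p(1) by auto
  have "inj_on P F"
  proof (rule inj_onI)
    fix i j assume ij: "i \<in> F" "j \<in> F" "P i = P j"
    hence "p (flat_index F i) = p (flat_index F j)" using p(2) by metis
    hence "flat_index F i = flat_index F j" using bij_is_inj[OF E.bij_p] by (auto dest: injD)
    thus "i = j" using inj_b ij by (auto dest: inj_onD)
  qed
  moreover have "flat_index F' ` P ` F = flat_index F' ` F'"
    using img[of F] E.image_positions by (simp add: flat_index_image)
  hence "P ` F = F'" using inj_on_image_eq_iff[OF inj_b' sub[OF order_refl] order_refl] by blast
  ultimately show "bij_betw P F F'" by (simp add: bij_betw_def)
  have "flat_index F' ` P ` (F \<inter> face X) = flat_index F' ` (F' \<inter> face Y)"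
    using img[of "F \<inter> face X"] E.face_B by (simp add: face_induced)
  thus "P ` (F \<inter> face X) = F' \<inter> face Y"
    using inj_on_image_eq_iff[OF inj_b' sub[of "F \<inter> face X"], of "F' \<inter> face Y"] by blast
qed

text \<open>The equivalence is restricted to the renumbered \<open>H\<close>, and
  \<open>induced_XF\<close> reads the result in \<open>X\<close> and \<open>Y\<close>. The formula
  for roots holds at all positions of \<open>F\<close>, not only at those of \<open>H\<close>; with
  \<open>H = {}\<close> it says that \<open>h\<close> matches the root functions.\<close>

lemma restrict_flat:
  assumes H: "H \<subseteq> F"
  shows flat_root_P: "\<And>i. i \<in> F \<Longrightarrow> h (flat_root X H i) = flat_root Y (P ` H) (P i)"
    and flat_equiv_restrict: "flat_equiv X H Y (P ` H) P h"
proof -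
  obtain \<phi> p where "quad_equiv X.XF Y.XF \<phi> p"
    and p: "\<And>i. i \<in> F \<Longrightarrow> P i \<in> F'" "\<And>i. i \<in> F \<Longrightarrow> p (flat_index F i) = flat_index F' (P i)"
    using equivalence_ex by metis
  then interpret E: quad_equiv X.XF Y.XF \<phi> p by simp
  let ?b = "flat_index F" and ?b' = "flat_index F'"
  have PH: "P ` H \<subseteq> F'" using H p(1) by auto
  have img: "p ` ?b ` H = ?b' ` P ` H"
    using H p(2) by (auto simp: image_image intro!: image_cong)
  have b_pos: "?b i \<in> positions X.XF" if "i \<in> F" for i
    using nth_flat_index[OF X.finite_F that] by simp
  \<comment> \<open>On \<open>V(F)\<close> the map \<open>h\<close> is the linear map of the
    isomorphism \<open>\<phi>\<close>, carried over by the two embeddings. It suffices to compare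
    them on simple roots.\<close>
  have h\<Lambda>: "h (X.\<Lambda> v) = Y.\<Lambda> (E.L v)" if "v \<in> X.ind.V" for v
  proof (rule linear_eq_on[OF linear_compose[OF linear_flat_embedding linear_h, unfolded comp_def]
        linear_compose[OF E.linear_L linear_flat_embedding, unfolded comp_def] that])
    fix x assume "x \<in> simple_root ` gens X.XF"
    then obtain j where j: "j \<in> F" "x = simple_root (flat_letter X F j)" by (auto simp: X.gens_XF)
    have "\<phi> (flat_letter X F j) = flat_letter Y F' (P j)"
      using E.nth_word_B[OF b_pos[OF j(1)]] p(1,2)[OF j(1)] nth_flat_index[OF X.finite_F j(1)]
        nth_flat_index[OF Y.finite_F p(1)[OF j(1)]] by (simp add: word_induced)
    hence "Y.\<Lambda> (E.L x) = flat_root Y F' (P j)"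
      using j p(1) E.L_simple_root Y.embedding_simple_root by (simp add: X.gens_XF)
    thus "h (X.\<Lambda> x) = Y.\<Lambda> (E.L x)"
      using j flat_equiv X.embedding_simple_root by (simp add: flat_equiv_def)
  qed
  show root: "h (flat_root X H i) = flat_root Y (P ` H) (P i)" if i: "i \<in> F" for i
  proof -
    have "h (flat_root X H i) = Y.\<Lambda> (E.L (flat_root X.XF (?b ` H) (?b i)))"
      using X.flat_root_XF[OF H i] h\<Lambda> by metis
    also have "E.L (flat_root X.XF (?b ` H) (?b i)) = flat_root Y.XF (?b' ` P ` H) (?b' (P i))"
      using E.flat_root_equiv[OF b_pos[OF i], of "?b ` H"] p(2)[OF i] unfolding img by simp
    finally show ?thesis using Y.flat_root_XF(1)[OF PH p(1)[OF i]] by simp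
  qed
  have "?b ` H \<subseteq> positions X.XF" using b_pos H by blast
  from E.equivalence_induced[OF this] obtain q where
    q: "equivalence_via (induced_quadruple X H) (induced_quadruple Y (P ` H)) \<phi> q"
    "\<And>k. k < card (?b ` H) \<Longrightarrow> sorted_list_of_set (?b' ` P ` H) ! q k = p (sorted_list_of_set (?b ` H) ! k)"
    unfolding img X.induced_XF[OF H] Y.induced_XF[OF PH] by blast
  have finH: "finite H" "finite (P ` H)" using H X.finite_F finite_subset by blast+
  have cH: "card (?b ` H) = card H" using inj_on_flat_index[OF X.finite_F H] by (rule card_image)
  have "sorted_list_of_set (P ` H) ! q k = P (sorted_list_of_set H ! k)" if k: "k < card H" for k
  proof -
    have "length (word (induced_quadruple Y (P ` H))) = length (word (induced_quadruple X H))"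
      using q(1) commutes_to_length by (fastforce simp: equivalence_via_def)
    hence c: "card (P ` H) = card H" by (simp add: word_induced)
    have "commutes_to (grp (induced_quadruple Y (P ` H))) (map \<phi> (word (induced_quadruple X H)))
        (word (induced_quadruple Y (P ` H))) q" using q(1) by (simp add: equivalence_via_def)
    hence qk: "q k < card (P ` H)" using commutes_to_less_iff k c by (fastforce simp: word_induced)
    have HF: "sorted_list_of_set H ! k \<in> F" using nth_sorted_list_of_set_in[OF k] H by blast
    have "?b' (sorted_list_of_set (P ` H) ! q k) = ?b' (P (sorted_list_of_set H ! k))"
      using q(2)[of k] k qk p(2)[OF HF] cH
      by (simp add: sorted_list_of_set_image[OF strict_mono_on_flat_index[OF X.finite_F H] finH(1)]
          sorted_list_of_set_image[OF strict_mono_on_flat_index[OF Y.finite_F PH] finH(2)])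
    thus ?thesis
      using inj_on_flat_index[OF Y.finite_F order_refl] nth_sorted_list_of_set_in[OF qk] PH p(1)[OF HF]
      by (meson inj_onD subsetD)
  qed
  thus "flat_equiv X H Y (P ` H) P h"
    unfolding flat_equiv_def using linear_h root H q(1) by blast
qed

lemma root_function_P: "i \<in> F \<Longrightarrow> h (root_function X i) = root_function Y (P i)"
  using flat_root_P[of "{}" i] by (simp add: root_function_eq_flat_root)

text \<open>Outside \<open>V(F)\<close> the map \<open>h\<close> is arbitrary and may fail to be
  invertible, so \<open>h'\<close> is built afresh from the independent flat roots. Several
  positions may carry the same root, hence the check \<open>wd\<close> that equal roots on one side
  come from equal roots on the other.\<close>

lemma flat_equiv_sym: "\<exists>h'. flat_equiv Y F' X F (inv_into F P) h'"
proof -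
  obtain \<phi> p where eq: "equivalence_via X.XF Y.XF \<phi> p" and "quad_equiv X.XF Y.XF \<phi> p"
    and p: "\<And>i. i \<in> F \<Longrightarrow> P i \<in> F'" "\<And>i. i \<in> F \<Longrightarrow> p (flat_index F i) = flat_index F' (P i)"
    using equivalence_ex by metis
  then interpret E: quad_equiv X.XF Y.XF \<phi> p by simp
  have inv: "inv_into F P (P i) = i" if "i \<in> F" for i
    using bij_P that by (simp add: bij_betw_def)
  have P_ex: "\<exists>i\<in>F. j = P i" if "j \<in> F'" for j
    using bij_P that by (auto simp: bij_betw_def)
  have letter: "\<phi> (flat_letter X F i) = flat_letter Y F' (P i)" if "i \<in> F" for i
    using E.nth_word_B[of "flat_index F i"] p(1,2)[OF that] nth_flat_index[OF X.finite_F that]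
      nth_flat_index[OF Y.finite_F p(1)[OF that]] by (simp add: word_induced)
  have wd: "flat_root X F i = flat_root X F j"
    if "i \<in> F" "j \<in> F" "flat_root Y F' (P i) = flat_root Y F' (P j)" for i j
  proof -
    have "\<phi> (flat_letter X F i) = \<phi> (flat_letter X F j)"
      using that p(1) letter Y.flat_letter_eq_iff by metis
    moreover have "flat_letter X F i \<in> carrier (grp X.XF)" "flat_letter X F j \<in> carrier (grp X.XF)"
      using that X.ind.S_carrier by (auto simp: X.gens_XF)
    ultimately have "flat_letter X F i = flat_letter X F j" using E.inj by (auto dest: inj_onD)
    thus ?thesis using X.flat_letter_eq_iff that by simp
  qed
  define g where "g = flat_root X F \<circ> inv_into F (flat_root Y F' \<circ> P)"
  have "independent (flat_root Y F' ` F')" using Y.realized by (simp add: realized_on_flat_def)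
  then obtain h' where h': "linear h'" "\<And>x. x \<in> flat_root Y F' ` F' \<Longrightarrow> h' x = g x"
    using linear_independent_extend[of "flat_root Y F' ` F'" g] by blast
  have "h' (flat_root Y F' (P i)) = flat_root X F i" if "i \<in> F" for i
  proof -
    let ?y = "flat_root Y F' (P i)"
    define j where "j = inv_into F (flat_root Y F' \<circ> P) ?y"
    have mem: "?y \<in> (flat_root Y F' \<circ> P) ` F" using that by auto
    have j: "j \<in> F" unfolding j_def using mem by (rule inv_into_into)
    have "flat_root Y F' (P j) = ?y" using f_inv_into_f[OF mem] by (simp add: j_def)
    hence "flat_root X F j = flat_root X F i" using wd[OF j that] by blast
    moreover have "h' ?y = flat_root X F j" using h'(2)[of ?y] p(1)[OF that] by (simp add: g_def j_def)
    ultimately show ?thesis by simp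
  qed
  hence "\<forall>j\<in>F'. h' (flat_root Y F' j) = flat_root X F (inv_into F P j)" using P_ex inv by metis
  moreover have "sorted_list_of_set F ! inv_into UNIV p k = inv_into F P (sorted_list_of_set F' ! k)"
    if k: "k < card F'" for k
  proof -
    obtain i where i: "i \<in> F" "sorted_list_of_set F' ! k = P i"
      using P_ex nth_sorted_list_of_set_in[OF k] by blast
    have "k = p (flat_index F i)" using p(2)[OF i(1)] i(2) flat_index_nth[OF k] by simp
    hence "inv_into UNIV p k = flat_index F i" using bij_is_inj[OF E.bij_p] by simp
    thus ?thesis using nth_flat_index[OF X.finite_F i(1)] inv[OF i(1)] i(2) by simp
  qed
  moreover have "equivalence_via Y.XF X.XF (inv_into (carrier (grp X.XF)) \<phi>) (inv_into UNIV p)"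
    using equivalence_via_sym[OF X.quadruple_XF Y.quadruple_XF eq] .
  ultimately show ?thesis using h'(1) unfolding flat_equiv_def by blast
qed

end

lemma flat_equiv_trans:
  assumes "flat_pair X F Y F' P h" "flat_pair Y F' Z F'' P' h'"
  shows "flat_equiv X F Z F'' (P' \<circ> P) (h' \<circ> h)"
proof -
  interpret XY: flat_pair X F Y F' P h by fact
  interpret YZ: flat_pair Y F' Z F'' P' h' by fact
  obtain \<phi> p where 1: "equivalence_via XY.X.XF XY.Y.XF \<phi> p" "\<And>i. i \<in> F \<Longrightarrow> P i \<in> F'"
    "\<And>i. i \<in> F \<Longrightarrow> p (flat_index F i) = flat_index F' (P i)"
    using XY.equivalence_ex by metis
  obtain \<psi> q where 2: "equivalence_via XY.Y.XF YZ.Y.XF \<psi> q" "\<And>i. i \<in> F' \<Longrightarrow> P' i \<in> F''"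
    "\<And>i. i \<in> F' \<Longrightarrow> q (flat_index F' i) = flat_index F'' (P' i)"
    using YZ.equivalence_ex by metis
  have "equivalence_via XY.X.XF YZ.Y.XF (\<psi> \<circ> \<phi>) (q \<circ> p)"
    using equivalence_via_trans[OF 1(1) 2(1) XY.X.word_lists_XF XY.X.ind.S_carrier XY.X.group_XF
        XY.Y.group_XF YZ.Y.group_XF] .
  moreover have "sorted_list_of_set F'' ! (q \<circ> p) k = (P' \<circ> P) (sorted_list_of_set F ! k)" if k: "k < card F" for k
  proof -
    define i where "i = sorted_list_of_set F ! k"
    have i: "i \<in> F" "flat_index F i = k"
      unfolding i_def using nth_sorted_list_of_set_in[OF k] flat_index_nth[OF k] by auto
    have "q (p k) = flat_index F'' (P' (P i))" using 1(2,3)[OF i(1)] 2(3)[OF 1(2)[OF i(1)]] i(2) by simp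
    thus ?thesis using nth_flat_index[OF YZ.Y.finite_F 2(2)[OF 1(2)[OF i(1)]]] by (simp add: i_def)
  qed
  moreover have "linear (h' \<circ> h)" using linear_compose[OF XY.linear_h YZ.linear_h] .
  moreover have "(h' \<circ> h) (flat_root X F i) = flat_root Z F'' ((P' \<circ> P) i)" if "i \<in> F" for i
    using that XY.flat_equiv YZ.flat_equiv 1(2)[OF that] by (simp add: flat_equiv_def)
  ultimately show ?thesis unfolding flat_equiv_def by blast
qed

section \<open>Root independent objects\<close>

lemma independent_if_image_independent:
  assumes "linear f" "independent (f ` B)" "inj_on f B"
  shows "independent B"
proof
  assume "dependent B"
  then obtain a where a: "a \<in> B" "a \<in> span (B - {a})" by (auto simp: dependent_def)
  hence "f a \<in> span (f ` (B - {a}))" using linear_span_image[OF assms(1), of "B - {a}"] by blast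
  moreover have "f ` (B - {a}) = f ` B - {f a}" using assms(3) a(1) by (auto dest: inj_onD)
  ultimately show False using assms(2) a(1) by (auto simp: dependent_def)
qed

locale subword_object = quad +
  assumes irreducible: "irreducible_quadruple X"
    and flats_induce: "flats_induce_quadruples X"
    and root_independent: "root_independent X"
begin

lemma root_function_in_V: "j \<in> positions X \<Longrightarrow> root_function X j \<in> V"
  by (simp add: root_function_eq_flat_root flat_root_in_V)

lemma root_span_face: "root_span X (face X) = V"
  using irreducible by (simp add: irreducible_quadruple_def root_space_def)

text \<open>The roots of the face span \<open>V\<close>, and the face has as many positions as there
  are simple roots. A basis extracted from these roots therefore exhausts them, and no root is
  repeated.\<close>

lemma inj_on_root_function: "inj_on (root_function X) (face X)"
  and independent_roots: "independent (root_function X ` face X)"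
proof -
  have fin: "finite (face X)" using face_sub finite_subset finite_positions by blast
  obtain B where B: "B \<subseteq> root_function X ` face X" "independent B" "root_function X ` face X \<subseteq> span B"
    using maximal_independent_subset by blast
  have "span B = V"
    using B span_mono[OF B(1)] span_minimal[OF B(3) subspace_span] root_span_face
    by (auto simp: root_span_def)
  hence "card B = dim (simple_root ` gens X)" using dim_eq_card[OF _ B(2)] by metis
  also have "\<dots> = card (simple_root ` gens X)"
    by (rule dim_eq_card_independent[OF independent_simple_roots])
  also have "\<dots> = card (face X)"
    using root_independent by (simp add: card_image inj_on_def root_independent_def)
  finally have c: "card B = card (face X)" .
  have eq: "B = root_function X ` face X"
    using B(1) c fin by (intro card_seteq) (auto intro: card_image_le)
  show "independent (root_function X ` face X)" using B(2) eq by simp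
  show "inj_on (root_function X) (face X)" using c fin unfolding eq by (intro eq_card_imp_inj_on)
qed

lemma root_in_span_iff:
  assumes "J \<subseteq> face X" "i \<in> face X"
  shows "root_function X i \<in> root_span X J \<longleftrightarrow> i \<in> J"
proof
  assume *: "root_function X i \<in> root_span X J"
  show "i \<in> J"
  proof (rule ccontr)
    assume "i \<notin> J"
    hence "root_function X ` J \<subseteq> root_function X ` face X - {root_function X i}"
      using assms inj_on_root_function by (auto dest: inj_onD)
    hence "root_function X i \<in> span (root_function X ` face X - {root_function X i})"
      using * span_mono unfolding root_span_def by blast
    thus False using independent_roots assms(2) unfolding dependent_def by blast
  qed
qed (simp add: root_span_def span_base)

definition face_flat where "face_flat J = flat_of X (root_span X J)"

lemma root_span_sub_V: "J \<subseteq> positions X \<Longrightarrow> root_span X J \<subseteq> V"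
  unfolding root_span_def by (intro span_minimal) (auto simp: root_function_in_V)

lemma
  assumes J: "J \<subseteq> face X"
  shows root_span_face_flat: "root_span X (face_flat J) = root_span X J"
    and face_flat_Int_face: "face_flat J \<inter> face X = J"
    and irreducible_face_flat: "irreducible_flat X (face_flat J)"
proof -
  have J': "J \<subseteq> positions X" using J face_sub by blast
  have sub: "J \<subseteq> face_flat J"
    using J' by (auto simp: face_flat_def flat_of_def root_span_def intro: span_base)
  have "root_span X (face_flat J) \<subseteq> root_span X J"
    unfolding root_span_def[of X "face_flat J"]
    by (rule span_minimal) (auto simp: face_flat_def flat_of_def root_span_def)
  thus span: "root_span X (face_flat J) = root_span X J"
    using sub unfolding root_span_def by (meson image_mono span_mono subset_antisym)
  show int: "face_flat J \<inter> face X = J"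
    using root_in_span_iff[OF J] sub J by (auto simp: face_flat_def flat_of_def)
  have "subspace (root_span X J)" by (simp add: root_span_def)
  thus "irreducible_flat X (face_flat J)"
    unfolding irreducible_flat_def flat_def using span int root_span_sub_V[OF J']
    by (auto simp: face_flat_def root_space_def)
qed

lemma irreducible_flat_eq:
  assumes "irreducible_flat X F"
  shows "F = face_flat (F \<inter> face X)" and "root_span X F = root_span X (F \<inter> face X)"
    and "F \<subseteq> positions X"
proof -
  obtain U where U: "subspace U" "F = flat_of X U" and span: "root_span X F = root_span X (F \<inter> face X)"
    using assms by (auto simp: irreducible_flat_def flat_def)
  have "root_span X F \<subseteq> U"
    unfolding root_span_def by (rule span_minimal) (use U in \<open>auto simp: flat_of_def\<close>)
  moreover have "root_function X i \<in> root_span X F" if "i \<in> F" for i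
    using that by (simp add: root_span_def span_base)
  ultimately show "F = face_flat (F \<inter> face X)"
    unfolding face_flat_def span[symmetric] using U by (auto simp: flat_of_def)
  show "root_span X F = root_span X (F \<inter> face X)" by (rule span)
  show "F \<subseteq> positions X" using U by (auto simp: flat_of_def)
qed

lemma realized_flat: "irreducible_flat X F \<Longrightarrow> realized_flat X F"
  using flats_induce by unfold_locales (auto simp: irreducible_flat_def flats_induce_quadruples_def)

lemma irreducible_positions: "irreducible_flat X (positions X)"
proof -
  have "root_span X (positions X) = V"
    using root_span_face root_span_sub_V[OF order_refl] span_mono[OF image_mono[OF face_sub]]
    unfolding root_span_def by blast
  moreover have "positions X = flat_of X V" using root_function_in_V by (auto simp: flat_of_def)
  ultimately show ?thesis
    unfolding irreducible_flat_def flat_def using root_span_face face_sub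
    by (auto simp: root_space_def Int_absorb1 intro!: exI[of _ V])
qed

lemma irreducible_empty: "irreducible_flat X {}"
proof -
  have "root_function X j \<noteq> 0" for j by (simp add: root_function_eq_flat_root)
  hence "{} = flat_of X {0}" by (auto simp: flat_of_def)
  moreover have "subspace {0 :: 'a vec}" "{0} \<subseteq> V" by (auto simp: span_zero)
  ultimately have "flat X {}" unfolding flat_def root_space_def by (intro exI[of _ "{0}"] conjI)
  thus ?thesis by (simp add: irreducible_flat_def)
qed

text \<open>A flat of the induced quadruple is the renumbering of a flat of \<open>X\<close>,
  defined by the embedded subspace, so the realization condition is inherited along the isometric
  embedding. Root independence is a dimension count: the face roots and the embedded simple roots
  are both bases of \<open>V(F)\<close>.\<close>

lemma induced_object:
  assumes irr: "irreducible_flat X F"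
  shows "subword_object (induced_quadruple X F)"
proof -
  interpret F: realized_flat X F by (rule realized_flat[OF irr])
  interpret XF: quad F.XF by unfold_locales (rule F.quadruple_XF)
  note span = irreducible_flat_eq(2)[OF irr]
  have image_span: "F.\<Lambda> ` root_span F.XF (flat_index F ` H) = root_span X H" if "H \<subseteq> F" for H
  proof -
    have "F.\<Lambda> ` root_function F.XF ` flat_index F ` H = root_function X ` H"
      unfolding image_image using that F.root_function_XF(1) by (intro image_cong) auto
    thus ?thesis unfolding root_span_def by (simp only: linear_span_image[OF linear_flat_embedding, symmetric])
  qed
  have span_V: "root_span F.XF (flat_index F ` H) \<subseteq> F.ind.V" if "H \<subseteq> F" for H
    unfolding root_span_def using that F.root_function_XF(2) by (intro span_minimal) auto
  have face: "face F.XF = flat_index F ` (F \<inter> face X)" by (rule face_induced)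
  have irr': "irreducible_quadruple F.XF"
  proof -
    have "F.\<Lambda> ` root_span F.XF (face F.XF) = F.\<Lambda> ` F.ind.V"
      unfolding face using image_span[of "F \<inter> face X"] F.embedding_V span by simp
    hence "root_span F.XF (face F.XF) = F.ind.V"
      using inj_on_image_eq_iff[OF F.inj_on_embedding] span_V[of "F \<inter> face X"] face by auto
    thus ?thesis by (simp add: irreducible_quadruple_def root_space_def)
  qed
  have "realized_on_flat F.XF H" if H: "irreducible_flat F.XF H" for H
  proof -
    obtain U where U: "subspace U" "U \<subseteq> F.ind.V" "H = flat_of F.XF U"
      using H by (auto simp: irreducible_flat_def flat_def root_space_def)
    define H' where "H' = {j \<in> F. flat_index F j \<in> H}"
    have "H \<subseteq> flat_index F ` F" using U(3) flat_index_image[OF F.finite_F] by (auto simp: flat_of_def)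
    hence HH': "H = flat_index F ` H'" by (auto simp: H'_def)
    have H'F: "H' \<subseteq> F" by (auto simp: H'_def)
    have "root_function X j \<in> F.\<Lambda> ` U \<longleftrightarrow> root_function F.XF (flat_index F j) \<in> U" if "j \<in> F" for j
      using inj_on_image_mem_iff[OF F.inj_on_embedding F.root_function_XF(2)[OF that] U(2)]
        F.root_function_XF(1)[OF that] by metis
    \<comment> \<open>The embedded subspace lies in \<open>V(F)\<close>, so no position outside
      \<open>F\<close> can enter its flat.\<close>
    moreover have "F.\<Lambda> ` U \<subseteq> F.W" using F.embedding_in_W[OF subsetD[OF U(2)]] by (rule image_subsetI)
    hence "j \<in> F" if "root_function X j \<in> F.\<Lambda> ` U" "j \<in> positions X" for j
      using that F.root_in_W_iff[OF that(2)] by (simp add: subsetD)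
    moreover have "flat_index F j \<in> positions F.XF" if "j \<in> F" for j
      using nth_flat_index[OF F.finite_F that] by simp
    ultimately have flat: "H' = flat_of X (F.\<Lambda> ` U)"
      using F.F_sub by (auto simp: H'_def U(3) flat_of_def)
    have inter: "H \<inter> face F.XF = flat_index F ` (H' \<inter> face X)"
      unfolding HH' face using H'F inj_on_flat_index[OF F.finite_F order_refl] by (auto dest: inj_onD)
    have "root_span X H' = root_span X (H' \<inter> face X)"
      using H image_span[OF H'F] image_span[of "H' \<inter> face X"] H'F inter HH'
      by (simp add: irreducible_flat_def inf.coboundedI1)
    moreover have "subspace (F.\<Lambda> ` U)" by (rule linear_subspace_image[OF linear_flat_embedding U(1)])
    moreover have "F.\<Lambda> ` U \<subseteq> root_space X"
      using U(2) F.embedding_in_W F.W_sub_V by (auto simp: root_space_def)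
    ultimately have "irreducible_flat X H'" using flat by (auto simp: irreducible_flat_def flat_def)
    hence real: "realized_on_flat X H'" using flats_induce by (simp add: flats_induce_quadruples_def)
    have root: "F.\<Lambda> (flat_root F.XF H k) \<in> flat_root X H' ` H'" if "k \<in> H" for k
      using that F.flat_root_XF(1)[OF H'F] H'F by (auto simp: HH')
    have VH: "flat_root F.XF H k \<in> F.ind.V" if "k \<in> H" for k
      using that F.flat_root_XF(2)[OF H'F] H'F by (auto simp: HH')
    have "F.\<Lambda> ` flat_root F.XF H ` H = flat_root X H' ` H'"
      using F.flat_root_XF(1)[OF H'F] H'F unfolding HH' image_image by (intro image_cong) auto
    hence "independent (F.\<Lambda> ` flat_root F.XF H ` H)" using real by (simp add: realized_on_flat_def)
    moreover have "inj_on F.\<Lambda> (flat_root F.XF H ` H)"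
      using F.inj_on_embedding by (rule inj_on_subset) (use VH in blast)
    ultimately have "independent (flat_root F.XF H ` H)"
      by (rule independent_if_image_independent[OF linear_flat_embedding])
    moreover have "coxeter_form (grp F.XF) (flat_root F.XF H j) (flat_root F.XF H k) =
        - cos (pi / real (group.ord (grp F.XF) (flat_letter F.XF H j \<otimes>\<^bsub>grp F.XF\<^esub> flat_letter F.XF H k)))"
      if jk: "j \<in> H" "k \<in> H" for j k
    proof -
      obtain a b where ab: "a \<in> H'" "b \<in> H'" "j = flat_index F a" "k = flat_index F b"
        using jk by (auto simp: HH')
      have abF: "a \<in> F" "b \<in> F" using ab H'F by auto
      have "coxeter_form (grp F.XF) (flat_root F.XF H j) (flat_root F.XF H k) =
          coxeter_form (grp X) (flat_root X H' a) (flat_root X H' b)"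
        using F.embedding_isometry[OF VH[OF jk(1)] VH[OF jk(2)]] F.flat_root_XF(1)[OF H'F] abF ab(3,4)
        by (simp add: HH')
      also have "\<dots> = - cos (pi / real (ord (flat_letter X H' a \<bullet> flat_letter X H' b)))"
        using real ab by (simp add: realized_on_flat_def)
      finally show ?thesis
        using F.flat_letter_XF[OF H'F] abF ab(3,4) by (simp add: HH' F.ord_XF)
    qed
    ultimately show ?thesis by (simp add: realized_on_flat_def)
  qed
  hence "flats_induce_quadruples F.XF" by (simp add: flats_induce_quadruples_def)
  moreover have "root_independent F.XF"
  proof -
    have inj: "inj_on (root_function X) (F \<inter> face X)"
      using inj_on_root_function by (rule inj_on_subset) simp
    have ind: "independent (root_function X ` (F \<inter> face X))"
      using independent_roots by (rule independent_mono) auto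
    have ind': "independent (flat_root X F ` F)" using F.realized by (simp add: realized_on_flat_def)
    have "card (face F.XF) = card (F \<inter> face X)"
      unfolding face by (intro card_image inj_on_flat_index F.finite_F) simp
    also have "\<dots> = card (root_function X ` (F \<inter> face X))" using inj by (simp add: card_image)
    also have "\<dots> = dim F.W"
      unfolding span by (simp add: root_span_def dim_eq_card_independent[OF ind])
    also have "\<dots> = card (flat_root X F ` F)"
      by (simp add: F.W_eq_span dim_eq_card_independent[OF ind'])
    also have "\<dots> = card (F.\<Lambda> ` simple_root ` gens F.XF)" by (simp add: F.embedding_image_roots)
    also have "\<dots> = card (simple_root ` gens F.XF)"
      by (intro card_image inj_on_subset[OF F.inj_on_embedding] span_superset)
    also have "\<dots> = card (gens F.XF)" by (simp add: card_image inj_on_def)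
    finally show ?thesis by (simp add: root_independent_def)
  qed
  ultimately show ?thesis
    using irr' F.quadruple_XF by (simp add: subword_object_def subword_object_axioms_def quad_def)
qed

end

section \<open>Morphisms as partial injections between faces\<close>

lemma Obj_iff: "X \<in> Obj root_independent_category \<longleftrightarrow> subword_object X"
  by (auto simp: root_independent_category_def full_subcategory_def subword_category_def
      subword_object_def subword_object_axioms_def quad_def)

lemma Hom_eq [simp]: "Hom root_independent_category = subword_morphisms"
  and Idn_eq [simp]: "Idn root_independent_category = subword_identity"
  and Cmp_eq [simp]: "Cmp root_independent_category = subword_compose"
  by (simp_all add: root_independent_category_def full_subcategory_def subword_category_def)

text \<open>Defined through \<open>l\<close>, because a morphism records no map of positions. For
  root independent objects nothing is lost: distinct face positions have distinct roots.\<close>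

definition face_relation :: "'g quadruple \<Rightarrow> 'g quadruple \<Rightarrow> 'g morphism \<Rightarrow> (nat \<times> nat) set" where
  "face_relation X Y f = (case f of (F, F', l) \<Rightarrow>
     {(i, j). i \<in> F \<inter> face X \<and> j \<in> F' \<inter> face Y \<and> l (root_function X i) = root_function Y j})"

locale object_pair = X: subword_object X + Y: subword_object Y + flat_pair X F Y F' P h
  for X :: "'g quadruple" and F and Y :: "'g quadruple" and F' P h +
  assumes irr: "irreducible_flat X F" and irr': "irreducible_flat Y F'"

lemma object_pairI:
  assumes "subword_object X" "subword_object Y" "irreducible_flat X F" "irreducible_flat Y F'"
    "flat_equiv X F Y F' P h"
  shows "object_pair X F Y F' P h"
  using assms subword_object.realized_flat
  by (intro object_pair.intro flat_pair.intro flat_pair_axioms.intro object_pair_axioms.intro) auto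

context object_pair
begin

abbreviation arrow where "arrow \<equiv> (F, F', restrict h (root_span X F))"

lemma arrow_hom: "arrow \<in> subword_morphisms X Y"
  using irr irr' flat_equiv by (auto simp: subword_morphism_iff)

lemma P_in: "i \<in> F \<inter> face X \<Longrightarrow> P i \<in> F' \<inter> face Y"
  using P_face by blast

lemma face_relation_arrow: "face_relation X Y arrow = (\<lambda>i. (i, P i)) ` (F \<inter> face X)"
proof -
  have eq: "restrict h (root_span X F) (root_function X i) = root_function Y (P i)" if "i \<in> F" for i
    using that root_function_P by (simp add: root_span_def span_base)
  have "root_function Y (P i) = root_function Y j \<longleftrightarrow> j = P i" if "i \<in> F \<inter> face X" "j \<in> F' \<inter> face Y" for i j
    using that P_in[OF that(1)] Y.inj_on_root_function by (auto dest: inj_onD)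
  thus ?thesis unfolding face_relation_def using eq P_in by (auto simp: image_iff)
qed

lemma image_span:
  assumes "J \<subseteq> F \<inter> face X"
  shows "h ` root_span X J = root_span Y (P ` J)"
proof -
  have "h ` root_function X ` J = root_function Y ` P ` J"
    unfolding image_image using assms root_function_P by (intro image_cong) auto
  thus ?thesis unfolding root_span_def by (simp only: linear_span_image[OF linear_h, symmetric])
qed

text \<open>The face roots in \<open>F\<close> form a basis of \<open>V(F)\<close>, and
  \<open>h\<close> sends them without repetition to face roots of \<open>Y\<close>, which are
  independent.\<close>

lemma inj_on_h: "inj_on h (root_span X F)"
proof -
  have roots: "h ` root_function X ` (F \<inter> face X) = root_function Y ` (F' \<inter> face Y)"
    unfolding P_face[symmetric] image_image using root_function_P by (intro image_cong) auto
  have "inj_on h (span (root_function X ` (F \<inter> face X)))"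
  proof (rule linear_inj_on_span_independent_image[OF linear_h])
    show "independent (h ` root_function X ` (F \<inter> face X))"
      unfolding roots using Y.independent_roots by (rule independent_mono) auto
    show "inj_on h (root_function X ` (F \<inter> face X))"
    proof (rule inj_onI, clarify)
      fix i j assume ij: "i \<in> F" "i \<in> face X" "j \<in> F" "j \<in> face X"
        "h (root_function X i) = h (root_function X j)"
      hence "root_function Y (P i) = root_function Y (P j)" using root_function_P by simp
      hence "P i = P j" using ij P_in[of i] P_in[of j] Y.inj_on_root_function by (auto dest: inj_onD)
      hence "i = j" using bij_P ij by (auto simp: bij_betw_def dest: inj_onD)
      thus "root_function X i = root_function X j" by simp
    qed
  qed
  thus ?thesis using X.irreducible_flat_eq(2)[OF irr] by (simp add: root_span_def)
qed

text \<open>\<open>h\<close> is injective on \<open>V(F)\<close> and carries roots to roots, so a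
  root of \<open>F\<close> lies in the span of the roots at \<open>J\<close> exactly if its image
  lies in the span of the image roots.\<close>

lemma P_face_flat:
  assumes J: "J \<subseteq> F \<inter> face X"
  shows "X.face_flat J \<subseteq> F" and "P ` X.face_flat J = Y.face_flat (P ` J)"
proof -
  have span: "root_span X J \<subseteq> root_span X F" "root_span Y (P ` J) \<subseteq> root_span Y F'"
    using J P_in unfolding root_span_def by (intro span_mono image_mono; blast)+
  have F: "F = flat_of X (root_span X F)" "F' = flat_of Y (root_span Y F')"
    using X.irreducible_flat_eq(1,2)[OF irr] Y.irreducible_flat_eq(1,2)[OF irr']
    by (simp_all add: X.face_flat_def Y.face_flat_def)
  show sub: "X.face_flat J \<subseteq> F"
    by (subst F(1)) (use span(1) in \<open>auto simp: X.face_flat_def flat_of_def\<close>)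
  have sub': "Y.face_flat (P ` J) \<subseteq> F'"
    by (subst F(2)) (use span(2) in \<open>auto simp: Y.face_flat_def flat_of_def\<close>)
  have iff: "i \<in> X.face_flat J \<longleftrightarrow> P i \<in> Y.face_flat (P ` J)" if i: "i \<in> F" for i
  proof -
    have "root_function X i \<in> root_span X F" using i by (simp add: root_span_def span_base)
    hence "root_function X i \<in> root_span X J \<longleftrightarrow> root_function Y (P i) \<in> root_span Y (P ` J)"
      using inj_on_image_mem_iff[OF inj_on_h _ span(1)] image_span[OF J] root_function_P[OF i] by metis
    moreover have "i \<in> positions X" "P i \<in> positions Y"
      using i X.irreducible_flat_eq(3)[OF irr] Y.irreducible_flat_eq(3)[OF irr'] bij_P
      by (auto simp: bij_betw_def)
    ultimately show ?thesis by (simp add: X.face_flat_def Y.face_flat_def flat_of_def)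
  qed
  have PF: "P ` F = F'" using bij_P by (simp add: bij_betw_def)
  show "P ` X.face_flat J = Y.face_flat (P ` J)"
  proof (intro equalityI subsetI)
    fix j assume j: "j \<in> Y.face_flat (P ` J)"
    then obtain i where "i \<in> F" "j = P i" using sub' PF by blast
    thus "j \<in> P ` X.face_flat J" using iff j by blast
  qed (use iff sub in blast)
qed

lemma object_pair_restrict:
  assumes J: "J \<subseteq> F \<inter> face X"
  shows "object_pair X (X.face_flat J) Y (Y.face_flat (P ` J)) P h"
proof -
  have JX: "J \<subseteq> face X" "P ` J \<subseteq> face Y" using J P_in by blast+
  note irrs = X.irreducible_face_flat[OF JX(1)] Y.irreducible_face_flat[OF JX(2)]
  have "flat_equiv X (X.face_flat J) Y (Y.face_flat (P ` J)) P h"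
    using flat_equiv_restrict[OF P_face_flat(1)[OF J]] P_face_flat(2)[OF J] by simp
  thus ?thesis using irrs X.subword_object_axioms Y.subword_object_axioms by (intro object_pairI)
qed

lemma object_pair_sym: "\<exists>h'. object_pair Y F' X F (inv_into F P) h'"
  using flat_equiv_sym object_pairI[OF Y.subword_object_axioms X.subword_object_axioms irr' irr] by blast

end

lemma morphismE:
  assumes "subword_object X" "subword_object Y" "f \<in> subword_morphisms X Y"
  obtains F F' P h where "object_pair X F Y F' P h" "f = (F, F', restrict h (root_span X F))"
proof -
  obtain F F' l where f: "f = (F, F', l)" by (cases f)
  obtain P h where fe: "irreducible_flat X F" "irreducible_flat Y F'" "flat_equiv X F Y F' P h"
    "l = restrict h (root_span X F)" using assms(3) unfolding f subword_morphism_iff by blast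
  show thesis using that object_pairI[OF assms(1,2) fe(1-3)] f fe(4) by blast
qed

lemma object_pair_trans:
  assumes "object_pair X F Y F' P h" "object_pair Y F' Z F'' P' h'"
  shows "object_pair X F Z F'' (P' \<circ> P) (h' \<circ> h)"
proof -
  interpret XY: object_pair X F Y F' P h by fact
  interpret YZ: object_pair Y F' Z F'' P' h' by fact
  show ?thesis
    using XY.irr YZ.irr' XY.X.subword_object_axioms YZ.Y.subword_object_axioms
      flat_equiv_trans[OF XY.flat_pair_axioms YZ.flat_pair_axioms] by (intro object_pairI)
qed

text \<open>The composite passes through the face positions of \<open>Y\<close> common to both
  middle flats, and \<open>J\<close> consists of the positions of \<open>X\<close> that reach them.
  On the flats spanned by these positions both arrows restrict to equivalences, which can be
  chained.\<close>

lemma compose: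
  assumes "object_pair X F1 Y F2 P h" "object_pair Y F3 Z F4 P' h'"
  defines "J \<equiv> {i \<in> F1 \<inter> face X. P i \<in> F3}"
  defines "g \<equiv> subword_compose X Y Z (F3, F4, restrict h' (root_span Y F3)) (F1, F2, restrict h (root_span X F1))"
  shows "g \<in> subword_morphisms X Z" and "face_relation X Z g = (\<lambda>i. (i, P' (P i))) ` J"
proof -
  interpret XY: object_pair X F1 Y F2 P h by fact
  interpret YZ: object_pair Y F3 Z F4 P' h' by fact
  have J: "J \<subseteq> F1 \<inter> face X" by (auto simp: J_def)
  have PJ: "P ` J = F2 \<inter> F3 \<inter> face Y"
    using XY.P_face by (fastforce simp: J_def image_iff set_eq_iff)
  have PJ3: "P ` J \<subseteq> F3 \<inter> face Y" using PJ by blast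
  let ?G1 = "XY.X.face_flat J" and ?G2 = "XY.Y.face_flat (P ` J)" and ?G4 = "YZ.Y.face_flat (P' ` P ` J)"
  let ?U = "root_span Y (P ` J)" and ?l = "restrict h (root_span X F1)" and ?m = "restrict h' (root_span Y F3)"
  have sub: "root_span X J \<subseteq> root_span X F1" "?U \<subseteq> root_span Y F3"
    using J PJ3 unfolding root_span_def by (intro span_mono image_mono; blast)+
  have "?l ` root_span X J = ?U"
    using XY.image_span[OF J] sub(1) by (auto simp: image_iff subset_iff)
  moreover have "inj_on ?l (root_span X F1)" using XY.inj_on_h by (simp cong: inj_on_cong)
  ultimately have G1: "flat_of X (inv_into (root_span X F1) ?l ` ?U) = ?G1"
    using inv_into_image_cancel sub(1) unfolding XY.X.face_flat_def by metis
  have "?m ` ?U = h' ` ?U" using sub(2) by (intro image_cong) auto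
  hence G4: "flat_of Z (?m ` ?U) = ?G4"
    unfolding YZ.Y.face_flat_def using YZ.image_span[OF PJ3] by (simp only:)
  have span: "root_span X ?G1 = root_span X J"
    using J by (intro XY.X.root_span_face_flat) blast
  \<comment> \<open>The inner restrictions are harmless: \<open>v\<close> lies in the domain of the
    first map, and \<open>h v\<close> in that of the second.\<close>
  have lin: "restrict (?m \<circ> ?l) (root_span X ?G1) = restrict (h' \<circ> h) (root_span X ?G1)"
    unfolding span
  proof (rule restrict_ext)
    fix v assume v: "v \<in> root_span X J"
    hence "h v \<in> ?U" using XY.image_span[OF J] by blast
    thus "(?m \<circ> ?l) v = (h' \<circ> h) v" using v sub by auto
  qed
  have g: "g = (?G1, ?G4, restrict (h' \<circ> h) (root_span X ?G1))"
    unfolding g_def subword_compose.simps Let_def PJ[symmetric] G1 G4 lin ..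
  interpret XZ: object_pair X ?G1 Z ?G4 "P' \<circ> P" "h' \<circ> h"
    using object_pair_trans[OF XY.object_pair_restrict[OF J] YZ.object_pair_restrict[OF PJ3]] .
  show "g \<in> subword_morphisms X Z" unfolding g by (rule XZ.arrow_hom)
  have "?G1 \<inter> face X = J" using J by (intro XY.X.face_flat_Int_face) blast
  thus "face_relation X Z g = (\<lambda>i. (i, P' (P i))) ` J" unfolding g XZ.face_relation_arrow by simp
qed

lemma identity_pair:
  assumes "subword_object X"
  shows "object_pair X (positions X) X (positions X) id id"
proof -
  interpret subword_object X by fact
  have "flat_equiv X (positions X) X (positions X) id id"
    unfolding flat_equiv_def using equivalence_via_refl
    by (intro conjI exI[of _ id]) (auto intro: linear_id)
  thus ?thesis using irreducible_positions assms by (intro object_pairI)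
qed

lemma identity_eq: "subword_identity X = (positions X, positions X, restrict id (root_span X (positions X)))"
  by (simp add: subword_identity_def id_def)

text \<open>The inclusion of a flat as an arrow. Its source flat consists of all positions of the
  induced quadruple and induces this quadruple again, so the underlying group isomorphism is the
  identity.\<close>

lemma embedding_pair:
  assumes "subword_object X" "irreducible_flat X F"
  shows "object_pair (induced_quadruple X F) {..<card F} X F ((!) (sorted_list_of_set F)) (flat_embedding X F)"
proof -
  interpret X: subword_object X by fact
  interpret F: realized_flat X F by (rule X.realized_flat[OF assms(2)])
  interpret A: subword_object F.XF by (rule X.induced_object[OF assms(2)])
  have b: "flat_index F ` F = {..<card F}" by (simp add: flat_index_image)
  have ind: "induced_quadruple F.XF {..<card F} = F.XF"
    using F.induced_XF[OF order_refl] b by simp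
  have irr: "irreducible_flat F.XF {..<card F}" using A.irreducible_positions by simp
  have "F.\<Lambda> (flat_root F.XF {..<card F} k) = flat_root X F (sorted_list_of_set F ! k)" if "k < card F" for k
    using F.flat_root_XF(1)[OF order_refl nth_sorted_list_of_set_in[OF that]] flat_index_nth[OF that] b by simp
  moreover have "sorted_list_of_set {..<card F} ! k = k" if "k < card F" for k
    using that by (simp add: lessThan_atLeast0)
  ultimately have "flat_equiv F.XF {..<card F} X F ((!) (sorted_list_of_set F)) F.\<Lambda>"
    unfolding flat_equiv_def ind using equivalence_via_refl[of F.XF]
    by (intro conjI exI[of _ id]) (auto intro: linear_flat_embedding)
  thus ?thesis using irr assms A.subword_object_axioms by (intro object_pairI)
qed

text \<open>An object has to exist for every type of group elements; any single element
  \<open>a\<close> carries the trivial group.\<close>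

lemma trivial_object: "subword_object (\<lparr>grp = \<lparr>carrier = {a}, monoid.mult = \<lambda>_ _. a, one = a\<rparr>,
    gens = {}, word = [], elt = a, face = {}\<rparr>)" (is "subword_object ?X")
proof -
  have "group (grp ?X)" by (rule groupI) auto
  moreover from this have "generate (grp ?X) {} = {a}" using group.generate_empty by fastforce
  ultimately have "coxeter_system (grp ?X) {}"
    by (auto simp: coxeter_system_def intro: coxeter_congruent.refl)
  hence "quadruple ?X" by (auto simp: quadruple_iff positions_def reduced_expression_def)
  moreover have "realized_on_flat ?X F" if "irreducible_flat ?X F" for F
    using that by (auto simp: irreducible_flat_def flat_def flat_of_def positions_def
        realized_on_flat_def independent_empty)
  ultimately show ?thesis
    by unfold_locales (auto simp: irreducible_quadruple_def root_space_def root_span_def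
        root_independent_def flats_induce_quadruples_def)
qed

interpretation partial_injection_category
  "root_independent_category :: ('g quadruple, 'g morphism) cat" face face_relation
proof (unfold_locales, unfold Obj_iff Hom_eq Idn_eq Cmp_eq)
  show "Obj (root_independent_category :: ('g quadruple, 'g morphism) cat) \<noteq> {}"
    by (rule ex_in_conv[THEN iffD1], rule exI, rule Obj_iff[THEN iffD2], rule trivial_object)
next
  fix X Y :: "'g quadruple" and f
  assume XY: "subword_object X" "subword_object Y" and f: "f \<in> subword_morphisms X Y"
  obtain F F' P h where "object_pair X F Y F' P h" and f: "f = (F, F', restrict h (root_span X F))"
    using morphismE[OF XY f] .
  then interpret object_pair X F Y F' P h by simp
  show "face_relation X Y f \<subseteq> face X \<times> face Y"
    unfolding f face_relation_arrow using P_in by auto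
  show "single_valued (face_relation X Y f)"
    unfolding f face_relation_arrow by (auto simp: single_valued_def)
  show "single_valued ((face_relation X Y f)\<inverse>)"
    unfolding f face_relation_arrow using bij_P
    by (auto simp: single_valued_def bij_betw_def dest: inj_onD)
  obtain h' where "object_pair Y F' X F (inv_into F P) h'" using object_pair_sym by blast
  then interpret inv: object_pair Y F' X F "inv_into F P" h' .
  have "inv_into F P (P i) = i" if "i \<in> F" for i using bij_P that by (simp add: bij_betw_def)
  hence "face_relation Y X inv.arrow = (face_relation X Y f)\<inverse>"
    unfolding f face_relation_arrow inv.face_relation_arrow P_face[symmetric] by force
  thus "\<exists>f'\<in>subword_morphisms Y X. face_relation Y X f' = (face_relation X Y f)\<inverse>"
    using inv.arrow_hom by blast
  fix g assume g: "g \<in> subword_morphisms X Y" and eq: "face_relation X Y f = face_relation X Y g"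
  obtain H H' R k where "object_pair X H Y H' R k" and g: "g = (H, H', restrict k (root_span X H))"
    using morphismE[OF XY g] .
  then interpret g: object_pair X H Y H' R k by simp
  have eq: "(\<lambda>i. (i, P i)) ` (F \<inter> face X) = (\<lambda>i. (i, R i)) ` (H \<inter> face X)"
    using eq unfolding f g face_relation_arrow g.face_relation_arrow .
  \<comment> \<open>The domain and range of the relation determine the two flats; the linear maps
    then agree because they agree on the basis of face roots.\<close>
  from arg_cong[OF eq, of Domain] have D: "F \<inter> face X = H \<inter> face X" by (simp add: Domain_fst image_image)
  from arg_cong[OF eq, of Range] have R: "F' \<inter> face Y = H' \<inter> face Y"
    by (simp add: Range_snd image_image P_face g.P_face)
  have F: "F = H" "F' = H'"
    using X.irreducible_flat_eq(1)[OF irr] X.irreducible_flat_eq(1)[OF g.irr]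
      Y.irreducible_flat_eq(1)[OF irr'] Y.irreducible_flat_eq(1)[OF g.irr'] D R by metis+
  have PR: "P i = R i" if "i \<in> F \<inter> face X" for i using that eq by blast
  have "h v = k v" if "v \<in> root_span X F" for v
  proof (rule linear_eq_on[OF linear_h g.linear_h, of _ "root_function X ` (F \<inter> face X)"])
    show "v \<in> span (root_function X ` (F \<inter> face X))"
      using that X.irreducible_flat_eq(2)[OF irr] by (simp add: root_span_def)
    fix x assume "x \<in> root_function X ` (F \<inter> face X)"
    thus "h x = k x" using root_function_P g.root_function_P PR F by auto
  qed
  thus "f = g" unfolding f g F[symmetric] by (auto intro: restrict_ext)
next
  fix X :: "'g quadruple" assume X: "subword_object X"
  then interpret X: subword_object X .
  interpret object_pair X "positions X" X "positions X" id id using X by (rule identity_pair)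
  show "subword_identity X \<in> subword_morphisms X X" unfolding identity_eq by (rule arrow_hom)
  show "face_relation X X (subword_identity X) = Id_on (face X)"
    unfolding identity_eq face_relation_arrow using X.face_sub by (auto simp: Id_on_def)
  fix J assume J: "J \<subseteq> face X"
  let ?F = "X.face_flat J"
  note irr = X.irreducible_face_flat[OF J]
  interpret F: realized_flat X ?F by (rule X.realized_flat[OF irr])
  interpret e: object_pair F.XF "{..<card ?F}" X ?F "(!) (sorted_list_of_set ?F)" "flat_embedding X ?F"
    by (rule embedding_pair[OF X irr])
  have "face F.XF \<subseteq> {..<card ?F}" using e.X.face_sub by simp
  hence "Domain (face_relation F.XF X e.arrow) = face F.XF"
    unfolding e.face_relation_arrow by (auto simp: Domain_fst image_image)
  moreover have "Range (face_relation F.XF X e.arrow) = J"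
    using e.P_face X.face_flat_Int_face[OF J] by (simp add: e.face_relation_arrow Range_snd image_image)
  ultimately show "\<exists>A\<in>Obj root_independent_category. \<exists>f\<in>subword_morphisms A X.
      Domain (face_relation A X f) = face A \<and> Range (face_relation A X f) = J"
    using e.arrow_hom X.induced_object[OF irr] Obj_iff by blast
next
  fix X Y Z :: "'g quadruple" and f g
  assume XYZ: "subword_object X" "subword_object Y" "subword_object Z"
    and f: "f \<in> subword_morphisms X Y" and g: "g \<in> subword_morphisms Y Z"
  obtain F1 F2 P h where 1: "object_pair X F1 Y F2 P h" and f: "f = (F1, F2, restrict h (root_span X F1))"
    using morphismE[OF XYZ(1,2) f] .
  obtain F3 F4 P' h' where 2: "object_pair Y F3 Z F4 P' h'" and g: "g = (F3, F4, restrict h' (root_span Y F3))"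
    using morphismE[OF XYZ(2,3) g] .
  interpret XY: object_pair X F1 Y F2 P h by fact
  interpret YZ: object_pair Y F3 Z F4 P' h' by fact
  show "subword_compose X Y Z g f \<in> subword_morphisms X Z"
    unfolding f g by (rule compose(1)[OF 1 2])
  show "face_relation X Z (subword_compose X Y Z g f) = face_relation X Y f O face_relation Y Z g"
    unfolding f g compose(2)[OF 1 2] XY.face_relation_arrow YZ.face_relation_arrow
    using XY.P_in by (auto simp: image_iff relcomp_unfold)
next
  fix X Y :: "'g quadruple" assume XY: "subword_object X" "subword_object Y"
  interpret X: subword_object X by fact
  interpret Y: subword_object Y by fact
  \<comment> \<open>The zero morphism; its linear map lives on the zero space, so \<open>id\<close>
    may serve.\<close>
  have "({}, {}, restrict id (root_span X {})) \<in> subword_morphisms X Y"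
    using X.irreducible_empty Y.irreducible_empty flat_equiv_empty[OF X.is_group Y.is_group]
    by (auto simp: subword_morphism_iff)
  thus "subword_morphisms X Y \<noteq> {}" by blast
qed

theorem theorem2p8:
  shows "proto_abelian (root_independent_category :: ('g quadruple, 'g morphism) cat)"
  by (rule proto_abelian)

end
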